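(* Let $R$ be a ring, $\mathfrak{a}$ an ideal of $R$ and $S'\in\mathrm{Den}_l(R,\mathfrak{a})$. Suppose that for each element $s\in S'$ there is an element $t\in S'$ such that the element $ts$ is a normal element of $R$. Let $S$ be the set of all normal elements of $R$ that belong to $S'$. Then: 1. $S\in\mathrm{Den}_l(R,\mathfrak{a})$ and $S^{-1}R\simeq S'^{-1}R$. 2. Suppose that $|\min(\mathfrak{a})|<\infty$ (e.g. $R$ is a one-sided Noetherian ring), and for each $\mathfrak{p}\in\min(\mathfrak{a})$ let $\pi_{\mathfrak{p}}:R\to R/\mathfrak{p}$, $r\mapsto r+\mathfrak{p}$. Then: (i) The map $\min(\mathfrak{a})\to\mathrm{Spec}(S'^{-1}R)=\mathrm{Spec}(\overline{S'}^{-1}\overline{R})$, $\mathfrak{p}\mapsto\overline{S'}^{-1}\overline{\mathfrak{p}}$ is an injection, and $\mathfrak{n}_{\overline{S'}^{-1}\overline{R}}\subseteq\overline{S'}^{-1}\mathfrak{n}_{\overline{R}}$. (ii) $\widetilde{S'}\in\mathrm{Den}(\widetilde{R},0)$, $\overline{S'}^{-1}\overline{R}/\overline{S'}^{-1}\mathfrak{n}_{\overline{R}}\simeq\widetilde{S'}^{-1}\widetilde{R}$, and the map $\min(\mathfrak{a})\to\min(\widetilde{S'}^{-1}\widetilde{R})$, $\mathfrak{p}\mapsto\widetilde{S'}^{-1}\widetilde{\overline{\mathfrak{p}}}$ is a bijection. (iii) For each $\mathfrak{p}\in\min(\mathfrak{a})$, $\pi_{\mathfrak{p}}(S')\in\mathrm{Den}(R/\mathfrak{p},0)$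 and $\pi_{\mathfrak{p}}(S')^{-1}(R/\mathfrak{p})\simeq\widetilde{S'}^{-1}\widetilde{R}/\widetilde{S'}^{-1}\widetilde{\overline{\mathfrak{p}}}\simeq\overline{S'}^{-1}\overline{R}/\overline{S'}^{-1}\overline{\mathfrak{p}}$, and the diagram formed by the following natural ring homomorphisms is commutative: the factorization $R\to\overline{R}\to\widetilde{R}\to R/\mathfrak{p}$ of $\pi_{\mathfrak{p}}$; the localization maps $\overline{R}\to\overline{S'}^{-1}\overline{R}$, $\widetilde{R}\to\widetilde{S'}^{-1}\widetilde{R}$, $R/\mathfrak{p}\to\pi_{\mathfrak{p}}(S')^{-1}(R/\mathfrak{p})$; the induced maps $\overline{S'}^{-1}\overline{R}\to\widetilde{S'}^{-1}\widetilde{R}\to\pi_{\mathfrak{p}}(S')^{-1}(R/\mathfrak{p})$; the quotient map $\overline{S'}^{-1}\overline{R}\to\overline{S'}^{-1}\overline{R}/\overline{S'}^{-1}\mathfrak{n}_{\overline{R}}$ and the isomorphism of the latter ring with $\widetilde{S'}^{-1}\widetilde{R}$; the quotient map $\widetilde{S'}^{-1}\widetilde{R}\to\widetilde{S'}^{-1}\widetilde{R}/\widetilde{S'}^{-1}\widetilde{\overline{\mathfrak{p}}}$ and the isomorphism of the latter ring with $\pi_{\mathfrak{p}}(S')^{-1}(R/\mathfrak{p})$; the maps $\overline{S'}^{-1}\overline{R}/\mathfrak{n}_{\overline{S'}^{-1}\overline{R}}\to\overline{S'}^{-1}\overline{R}/\overline{S'}^{-1}\mathfrak{n}_{\overline{R}}\to\widetilde{S'}^{-1}\widetilde{R}/\widetilde{S'}^{-1}\widetilde{\overline{\mathfrak{p}}}$;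 and the map $\overline{S'}^{-1}\overline{R}/\overline{S'}^{-1}\mathfrak{n}_{\overline{R}}\to\overline{S'}^{-1}\overline{R}/\overline{S'}^{-1}\overline{\mathfrak{p}}$ followed by the isomorphism of the latter ring with $\widetilde{S'}^{-1}\widetilde{R}/\widetilde{S'}^{-1}\widetilde{\overline{\mathfrak{p}}}$. (iv) Suppose that the prime radical $\mathfrak{n}_{\overline{R}}$ is a nilpotent ideal (e.g. the ring $\overline{R}$ is one-sided Noetherian). Then the map $\min(\mathfrak{a})\to\min(S'^{-1}R)=\min(\overline{S'}^{-1}\overline{R})$, $\mathfrak{p}\mapsto\overline{S'}^{-1}\overline{\mathfrak{p}}$ is a bijection, i.e. $\min(S'^{-1}R)=\{\overline{S'}^{-1}\overline{\mathfrak{p}}\mid\mathfrak{p}\in\min(\mathfrak{a})\}$; moreover $\widetilde{S'}\in\mathrm{Den}(\widetilde{R},0)$, $\overline{S'}^{-1}\mathfrak{n}_{\overline{R}}=\mathfrak{n}_{\overline{S'}^{-1}\overline{R}}$ and $\overline{S'}^{-1}\overline{R}/\overline{S'}^{-1}\mathfrak{n}_{\overline{R}}\simeq\overline{S'}^{-1}\overline{R}/\mathfrak{n}_{\overline{S'}^{-1}\overline{R}}\simeq\widetilde{S'}^{-1}\widetilde{R}$.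
   Context: Rings are associative with $1$; ideals are two-sided. A multiplicative subset $S$ of $R$ is a multiplicative subsemigroup with $1\in S$, $0\notin S$. An element $x\in R$ is normal if $Rx=xR$. $S$ is a left Ore set if $Sr\cap Rs\neq\emptyset$ for all $r\in R$, $s\in S$; it is a left denominator set if moreover $rs=0$ ($r\in R$, $s\in S$) implies $tr=0$ for some $t\in S$; right versions are symmetric. $\mathrm{Den}_l(R,\mathfrak{a})$ (resp. $\mathrm{Den}(R,\mathfrak{a})$) is the set of left (resp. left and right) denominator sets $S$ of $R$ with $\{r\in R\mid sr=0\text{ for some }s\in S\}=\mathfrak{a}$. $S^{-1}R=\{s^{-1}r\mid s\in S,r\in R\}$ is the left localization, and $S^{-1}I=\{s^{-1}i\mid s\in S,i\in I\}$ for a left ideal $I$ of $R$. For a ring $R$: $\mathrm{Spec}(R)$ is the set of prime ideals, $\min(R)$ the set of minimal primes, $\mathfrak{n}_R$ the prime radical (intersection of all primes). For an ideal $\mathfrak{a}$, $\min(\mathfrak{a})$ is the set of prime ideals minimal over $\mathfrak{a}$. Notation: $\overline{R}:=R/\mathfrak{a}$; $\overline{S'}$ is the image of $S'$ in $\overline{R}$ and $S'^{-1}R$ is identified with $\overline{S'}^{-1}\overline{R}$ via the natural isomorphism; $\widetilde{R}:=\overline{R}/\mathfrak{n}_{\overline{R}}$ and $\widetilde{S'}$ is the image of $S'$ in $\widetilde{R}$. For $\mathfrak{p}\in\min(\mathfrak{a})$, $\overline{\mathfrak{p}}$ and $\widetilde{\overline{\mathfrak{p}}}$ are the images of $\mathfrak{p}$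 in $\overline{R}$ and $\widetilde{R}$; $\mathfrak{p}\mapsto\overline{\mathfrak{p}}\mapsto\widetilde{\overline{\mathfrak{p}}}$ are bijections $\min(\mathfrak{a})\to\min(\overline{R})\to\min(\widetilde{R})$. *)

theory Defs
  imports "HOL-Algebra.QuotRing" "HOL-Algebra.Ideal_Product"
begin

section \<open>Prime ideals of noncommutative rings\<close>

text \<open>
  The library locale \<^locale>\<open>primeideal\<close> is restricted to commutative rings and to the
  elementwise condition. Over an arbitrary ring, primeness is a condition on products of
  two-sided ideals.
\<close>

definition prime_ideal :: "('a, 'b) ring_scheme \<Rightarrow> 'a set \<Rightarrow> bool"
  where "prime_ideal R P \<longleftrightarrow> ideal P R \<and> P \<noteq> carrier R \<and>
    (\<forall>I J. ideal I R \<longrightarrow> ideal J R \<longrightarrow> I \<cdot>\<^bsub>R\<^esub> J \<subseteq> P \<longrightarrow> I \<subseteq> P \<or> J \<subseteq> P)"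

definition Spec :: "('a, 'b) ring_scheme \<Rightarrow> 'a set set"
  where "Spec R = {P. prime_ideal R P}"

definition min_primes :: "('a, 'b) ring_scheme \<Rightarrow> 'a set set"
  where "min_primes R = {P \<in> Spec R. \<forall>Q \<in> Spec R. Q \<subseteq> P \<longrightarrow> Q = P}"

definition min_primes_over :: "('a, 'b) ring_scheme \<Rightarrow> 'a set \<Rightarrow> 'a set set"
  where "min_primes_over R I =
    {P \<in> Spec R. I \<subseteq> P \<and> (\<forall>Q \<in> Spec R. I \<subseteq> Q \<longrightarrow> Q \<subseteq> P \<longrightarrow> Q = P)}"

text \<open>The intersection is taken inside the carrier, so that it is the whole ring if there are no primes.\<close>

definition prime_radical :: "('a, 'b) ring_scheme \<Rightarrow> 'a set"
  where "prime_radical R = carrier R \<inter> \<Inter>(Spec R)"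

definition nilpotent_ideal :: "('a, 'b) ring_scheme \<Rightarrow> 'a set \<Rightarrow> bool"
  where "nilpotent_ideal R I \<longleftrightarrow> ideal I R \<and> (\<exists>k::nat. I [^]\<^bsub>ideals_set R\<^esub> k = {\<zero>\<^bsub>R\<^esub>})"


section \<open>Denominator sets\<close>

definition normal_elem :: "('a, 'b) ring_scheme \<Rightarrow> 'a \<Rightarrow> bool"
  where "normal_elem R x \<longleftrightarrow> x \<in> carrier R \<and> carrier R #>\<^bsub>R\<^esub> x = x <#\<^bsub>R\<^esub> carrier R"

definition mult_subset :: "('a, 'b) ring_scheme \<Rightarrow> 'a set \<Rightarrow> bool"
  where "mult_subset R S \<longleftrightarrow> submonoid S R \<and> \<zero>\<^bsub>R\<^esub> \<notin> S"

definition left_Ore_set :: "('a, 'b) ring_scheme \<Rightarrow> 'a set \<Rightarrow> bool"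
  where "left_Ore_set R S \<longleftrightarrow> mult_subset R S \<and>
    (\<forall>r \<in> carrier R. \<forall>s \<in> S. (S #>\<^bsub>R\<^esub> r) \<inter> (carrier R #>\<^bsub>R\<^esub> s) \<noteq> {})"

definition right_Ore_set :: "('a, 'b) ring_scheme \<Rightarrow> 'a set \<Rightarrow> bool"
  where "right_Ore_set R S \<longleftrightarrow> mult_subset R S \<and>
    (\<forall>r \<in> carrier R. \<forall>s \<in> S. (r <#\<^bsub>R\<^esub> S) \<inter> (s <#\<^bsub>R\<^esub> carrier R) \<noteq> {})"

definition left_den_set :: "('a, 'b) ring_scheme \<Rightarrow> 'a set \<Rightarrow> bool"
  where "left_den_set R S \<longleftrightarrow> left_Ore_set R S \<and>
    (\<forall>r \<in> carrier R. \<forall>s \<in> S. r \<otimes>\<^bsub>R\<^esub> s = \<zero>\<^bsub>R\<^esub> \<longrightarrow> (\<exists>t \<in> S. t \<otimes>\<^bsub>R\<^esub> r = \<zero>\<^bsub>R\<^esub>))"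

definition right_den_set :: "('a, 'b) ring_scheme \<Rightarrow> 'a set \<Rightarrow> bool"
  where "right_den_set R S \<longleftrightarrow> right_Ore_set R S \<and>
    (\<forall>r \<in> carrier R. \<forall>s \<in> S. s \<otimes>\<^bsub>R\<^esub> r = \<zero>\<^bsub>R\<^esub> \<longrightarrow> (\<exists>t \<in> S. r \<otimes>\<^bsub>R\<^esub> t = \<zero>\<^bsub>R\<^esub>))"

definition ass :: "('a, 'b) ring_scheme \<Rightarrow> 'a set \<Rightarrow> 'a set"
  where "ass R S = {r \<in> carrier R. \<exists>s \<in> S. s \<otimes>\<^bsub>R\<^esub> r = \<zero>\<^bsub>R\<^esub>}"

definition Den_l :: "('a, 'b) ring_scheme \<Rightarrow> 'a set \<Rightarrow> 'a set set"
  where "Den_l R I = {S. left_den_set R S \<and> ass R S = I}"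

definition Den :: "('a, 'b) ring_scheme \<Rightarrow> 'a set \<Rightarrow> 'a set set"
  where "Den R I = {S. left_den_set R S \<and> right_den_set R S \<and> ass R S = I}"


section \<open>Left localization\<close>

text \<open>
  \<open>S\<^sup>-\<^sup>1R\<close> is the set of classes \<open>s\<^sup>-\<^sup>1r\<close> of pairs \<open>(s, r)\<close>, two pairs being identified if they
  have a common expansion \<open>(u s, u r) = (v s', v r')\<close> with denominator in \<open>S\<close>. The multiplier
  \<open>u\<close> itself ranges over all of \<open>R\<close>. Sums use a common denominator,
  \<open>s\<^sup>-\<^sup>1r + s'\<^sup>-\<^sup>1r' = (u s)\<^sup>-\<^sup>1(u r + v r')\<close> for \<open>u s = v s' \<in> S\<close>, and products move the second
  denominator to the left, \<open>s\<^sup>-\<^sup>1r \<cdot> s'\<^sup>-\<^sup>1r' = (u s)\<^sup>-\<^sup>1(v r')\<close> for \<open>u r = v s'\<close> with \<open>u \<in> S\<close>.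
  As for \<^const>\<open>rcoset_mult\<close>, the operations are unions over all choices; if \<open>S\<close> is a left
  denominator set then all choices give the same class.
\<close>

definition frac_rel :: "'a set \<Rightarrow> ('a, 'b) ring_scheme \<Rightarrow> (('a \<times> 'a) \<times> ('a \<times> 'a)) set"
  where "frac_rel S R = {((s, r), (s', r')).
    s \<in> S \<and> r \<in> carrier R \<and> s' \<in> S \<and> r' \<in> carrier R \<and>
    (\<exists>u \<in> carrier R. \<exists>v \<in> carrier R.
       u \<otimes>\<^bsub>R\<^esub> s = v \<otimes>\<^bsub>R\<^esub> s' \<and> u \<otimes>\<^bsub>R\<^esub> s \<in> S \<and> u \<otimes>\<^bsub>R\<^esub> r = v \<otimes>\<^bsub>R\<^esub> r')}"

definition frac :: "'a set \<Rightarrow> ('a, 'b) ring_scheme \<Rightarrow> 'a \<Rightarrow> 'a \<Rightarrow> ('a \<times> 'a) set"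
  where "frac S R s r = frac_rel S R `` {(s, r)}"

definition loc_add ::
  "'a set \<Rightarrow> ('a, 'b) ring_scheme \<Rightarrow> ('a \<times> 'a) set \<Rightarrow> ('a \<times> 'a) set \<Rightarrow> ('a \<times> 'a) set"
  where "loc_add S R X Y =
    (\<Union>(s, r) \<in> X. \<Union>(s', r') \<in> Y.
       \<Union>(u, v) \<in> {(u, v). u \<in> carrier R \<and> v \<in> carrier R \<and>
                          u \<otimes>\<^bsub>R\<^esub> s = v \<otimes>\<^bsub>R\<^esub> s' \<and> u \<otimes>\<^bsub>R\<^esub> s \<in> S}.
         frac S R (u \<otimes>\<^bsub>R\<^esub> s) (u \<otimes>\<^bsub>R\<^esub> r \<oplus>\<^bsub>R\<^esub> v \<otimes>\<^bsub>R\<^esub> r'))"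

definition loc_mult ::
  "'a set \<Rightarrow> ('a, 'b) ring_scheme \<Rightarrow> ('a \<times> 'a) set \<Rightarrow> ('a \<times> 'a) set \<Rightarrow> ('a \<times> 'a) set"
  where "loc_mult S R X Y =
    (\<Union>(s, r) \<in> X. \<Union>(s', r') \<in> Y.
       \<Union>(u, v) \<in> {(u, v). u \<in> S \<and> v \<in> carrier R \<and> u \<otimes>\<^bsub>R\<^esub> r = v \<otimes>\<^bsub>R\<^esub> s'}.
         frac S R (u \<otimes>\<^bsub>R\<^esub> s) (v \<otimes>\<^bsub>R\<^esub> r'))"

definition Loc :: "'a set \<Rightarrow> ('a, 'b) ring_scheme \<Rightarrow> ('a \<times> 'a) set ring"
  where "Loc S R =
    \<lparr>carrier = (S \<times> carrier R) // frac_rel S R, mult = loc_mult S R,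
      one = frac S R \<one>\<^bsub>R\<^esub> \<one>\<^bsub>R\<^esub>, zero = frac S R \<one>\<^bsub>R\<^esub> \<zero>\<^bsub>R\<^esub>, add = loc_add S R\<rparr>"

definition loc_map :: "'a set \<Rightarrow> ('a, 'b) ring_scheme \<Rightarrow> 'a \<Rightarrow> ('a \<times> 'a) set"
  where "loc_map S R r = frac S R \<one>\<^bsub>R\<^esub> r"

text \<open>\<open>Loc_ideal S R I\<close> is \<open>S\<^sup>-\<^sup>1I\<close>, as a subset of \<open>S\<^sup>-\<^sup>1R\<close>.\<close>

definition Loc_ideal :: "'a set \<Rightarrow> ('a, 'b) ring_scheme \<Rightarrow> 'a set \<Rightarrow> ('a \<times> 'a) set set"
  where "Loc_ideal S R I = {frac S R s i | s i. s \<in> S \<and> i \<in> I}"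


section \<open>Induced maps\<close>

text \<open>
  \<open>quot_lift f\<close> is the map \<open>x + I \<mapsto> f x\<close> on a quotient ring induced by a map \<open>f\<close> that is constant
  on the cosets of \<open>I\<close>. \<open>loc_lift T Q f\<close> is the map \<open>s\<^sup>-\<^sup>1r \<mapsto> (f s)\<^sup>-\<^sup>1(f r)\<close> into \<open>T\<^sup>-\<^sup>1Q\<close>
  induced by a ring homomorphism \<open>f\<close> into \<open>Q\<close> that maps the denominators into \<open>T\<close>.
\<close>

definition quot_lift :: "('a \<Rightarrow> 'c) \<Rightarrow> 'a set \<Rightarrow> 'c"
  where "quot_lift f X = the_elem (f ` X)"

definition loc_lift ::
  "'c set \<Rightarrow> ('c, 'd) ring_scheme \<Rightarrow> ('a \<Rightarrow> 'c) \<Rightarrow> ('a \<times> 'a) set \<Rightarrow> ('c \<times> 'c) set"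
  where "loc_lift T Q f X = the_elem ((\<lambda>(s, r). frac T Q (f s) (f r)) ` X)"

end

theory Submission
  imports Defs
begin

text \<open>
  The heart of the matter is that a regular normal element \<open>x\<close> of a ring with finitely many minimal
  primes lies in no minimal prime. Conjugation by \<open>x\<close> is an automorphism; it permutes the minimal
  primes, so a power \<open>y\<close> of \<open>x\<close> normalizes a minimal prime \<open>P\<close>, and then the elements \<open>y\<^sup>k z\<close> with
  \<open>z \<notin> P\<close> form an m-system without zero. A prime avoiding it is contained in \<open>P\<close>, hence equal to \<open>P\<close>,
  and so \<open>y \<notin> P\<close>.

  The images of the normal elements of \<open>S'\<close> in \<open>R/\<aa>\<close> are regular, so they avoid the primes minimal
  over \<open>\<aa>\<close> and become regular in every \<open>R/\<pp>\<close>. As every element of \<open>S'\<close> has a normal left multiple in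
  \<open>S'\<close>, all of \<open>S'\<close> becomes regular modulo each \<open>\<pp>\<close>, and modulo their intersection. For an ideal \<open>I\<close>
  modulo which the denominators are regular, \<open>S\<^sup>-\<^sup>1I\<close> is the kernel of the map of localizations
  induced by the projection onto the quotient by \<open>I\<close>, it contracts to \<open>I\<close>, and it is prime if \<open>I\<close> is.
\<close>

section \<open>Prime ideals\<close>

text \<open>Over a noncommutative ring, \<open>S^-1 I\<close> need not be a two-sided ideal for a
  two-sided \<open>I\<close>, nor is a prime of the localization known to contract to a prime.
  Realizing \<open>S^-1 I\<close> as a kernel removes the first difficulty, but it requires the
  denominators to be regular modulo \<open>I\<close> on both sides. For normal elements outside
  \<open>\<pp>\<close> this follows from primeness of \<open>\<pp>\<close>; for an arbitrary element
  of \<open>S'\<close> only a left multiple is known to be normal, and cancellation on the right has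
  to be deduced by conjugating with such a multiple. The second difficulty is met by never
  contracting a prime: a finite family of incomparable primes whose intersection lies in the prime
  radical is the set of all minimal primes. Over the quotient of \<open>R/\<aa>\<close> by its prime
  radical the localized primes intersect in zero. Over \<open>R/\<aa>\<close> itself their
  intersection is only known to lie in the localized radical, and nilpotency is what forces the
  latter into every prime.\<close>

lemma (in ring) ideal_memI:
  assumes "I \<subseteq> carrier R" "\<zero> \<in> I"
    and "\<And>a b. \<lbrakk>a \<in> I; b \<in> I\<rbrakk> \<Longrightarrow> a \<oplus> b \<in> I"
    and l: "\<And>a x. \<lbrakk>a \<in> I; x \<in> carrier R\<rbrakk> \<Longrightarrow> x \<otimes> a \<in> I"
    and "\<And>a x. \<lbrakk>a \<in> I; x \<in> carrier R\<rbrakk> \<Longrightarrow> a \<otimes> x \<in> I"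
  shows "ideal I R"
proof (rule idealI[OF ring_axioms])
  have "\<ominus> a \<in> I" if "a \<in> I" for a
    using l[OF that, of "\<ominus> \<one>"] assms(1) that l_minus[of \<one> a] by auto
  then show "subgroup I (add_monoid R)"
    using assms by unfold_locales (auto simp: a_inv_def[symmetric])
qed (use assms in auto)

lemma prime_ideal_ideal: "prime_ideal R P \<Longrightarrow> ideal P R"
  by (simp add: prime_ideal_def)

lemma prime_ideal_subset: "prime_ideal R P \<Longrightarrow> P \<subseteq> carrier R"
  using ideal.Icarr[OF prime_ideal_ideal] by (intro subsetI)

text \<open>Most arguments on fractions and homomorphic images give access to elements and not to
  products of ideals, so primeness is tested there on sets \<open>x R y\<close>.\<close>

lemma (in ring) prime_ideal_iff:
  "prime_ideal R P \<longleftrightarrow> ideal P R \<and> P \<noteq> carrier R \<and>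
    (\<forall>x\<in>carrier R. \<forall>y\<in>carrier R. (\<forall>r\<in>carrier R. x \<otimes> r \<otimes> y \<in> P) \<longrightarrow> x \<in> P \<or> y \<in> P)"
  (is "?L \<longleftrightarrow> ?R")
proof
  assume L: ?L
  then interpret P: ideal P R by (rule prime_ideal_ideal)
  have "x \<in> P \<or> y \<in> P" if x: "x \<in> carrier R" and y: "y \<in> carrier R"
    and xy: "\<And>r. r \<in> carrier R \<Longrightarrow> x \<otimes> r \<otimes> y \<in> P" for x y
  proof -
    \<comment> \<open>\<open>J\<close> and \<open>I\<close> replace the ideals generated by
      \<open>y\<close> and \<open>x\<close>. Both are two-sided by construction, their product lies
      in \<open>P\<close>, and they contain \<open>y\<close> and \<open>x\<close>, so generated
      ideals never have to be described.\<close>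
    define J where "J = {j \<in> carrier R. \<forall>r\<in>carrier R. x \<otimes> r \<otimes> j \<in> P}"
    define I where "I = {i \<in> carrier R. \<forall>j\<in>J. i \<otimes> j \<in> P}"
    have J: "ideal J R"
    proof (rule ideal_memI)
      fix a q assume a: "a \<in> J" and q: "q \<in> carrier R"
      have "x \<otimes> r \<otimes> (q \<otimes> a) \<in> P" if "r \<in> carrier R" for r
      proof -
        have "x \<otimes> (r \<otimes> q) \<otimes> a \<in> P" using a q that by (simp add: J_def)
        then show ?thesis using a q that x by (simp add: J_def m_assoc)
      qed
      then show "q \<otimes> a \<in> J" using a q by (simp add: J_def)
      have "x \<otimes> r \<otimes> (a \<otimes> q) \<in> P" if "r \<in> carrier R" for r
      proof -
        have "x \<otimes> r \<otimes> a \<otimes> q \<in> P" using a q that P.I_r_closed by (simp add: J_def)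
        then show ?thesis using a q that x by (simp add: J_def m_assoc)
      qed
      then show "a \<otimes> q \<in> J" using a q by (simp add: J_def)
    qed (use x in \<open>auto simp: J_def r_distr\<close>)
    have Jl: "q \<otimes> a \<in> J" if "q \<in> carrier R" "a \<in> J" for q a
      using J that by (simp add: ideal.I_l_closed)
    have Jc: "a \<in> carrier R" if "a \<in> J" for a using that by (simp add: J_def)
    have I: "ideal I R"
    proof (rule ideal_memI)
      fix a q assume a: "a \<in> I" and q: "q \<in> carrier R"
      show "q \<otimes> a \<in> I" using a q P.I_l_closed Jc by (auto simp: I_def m_assoc)
      show "a \<otimes> q \<in> I" using a q Jl Jc by (auto simp: I_def m_assoc)
    qed (auto simp: I_def l_distr Jc)
    have "i \<in> P" if "i \<in> I \<cdot> J" for i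
      using that by (induction rule: ideal_prod.induct) (auto simp: I_def)
    then have "I \<subseteq> P \<or> J \<subseteq> P" using L I J unfolding prime_ideal_def by blast
    moreover have "x \<otimes> j \<in> P" if "j \<in> J" for j
    proof -
      have "x \<otimes> \<one> \<otimes> j \<in> P" using that one_closed unfolding J_def by blast
      then show ?thesis using x by simp
    qed
    then have "x \<in> I" using x by (simp add: I_def)
    moreover have "y \<in> J" using y xy by (auto simp: J_def)
    ultimately show ?thesis by blast
  qed
  moreover have "P \<noteq> carrier R" using L by (simp add: prime_ideal_def)
  ultimately show ?R using P.is_ideal by simp
next
  assume R: ?R
  show ?L unfolding prime_ideal_def
  proof (intro conjI allI impI)
    fix I J assume I: "ideal I R" and J: "ideal J R" and IJ: "I \<cdot> J \<subseteq> P"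
    show "I \<subseteq> P \<or> J \<subseteq> P"
    proof (rule ccontr)
      assume "\<not> ?thesis"
      then obtain x y where x: "x \<in> I" "x \<notin> P" and y: "y \<in> J" "y \<notin> P" by blast
      have "x \<otimes> r \<otimes> y \<in> P" if "r \<in> carrier R" for r
        using IJ ideal_prod.prod[of "x \<otimes> r" I y J R] ideal.I_r_closed[OF I] x y that by blast
      then show False using R x y ideal.Icarr[OF I] ideal.Icarr[OF J] by blast
    qed
  qed (use R in auto)
qed

lemma (in ring) prime_idealD:
  assumes "prime_ideal R P" "x \<in> carrier R" "y \<in> carrier R" "x \<notin> P" "y \<notin> P"
  obtains r where "r \<in> carrier R" "x \<otimes> r \<otimes> y \<notin> P"
  using assms unfolding prime_ideal_iff by blast

lemma (in ring) prime_ideal_one_notin: "prime_ideal R P \<Longrightarrow> \<one> \<notin> P"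
  using ideal.one_imp_carrier unfolding prime_ideal_def by blast

text \<open>Krull's argument with an m-system in place of a multiplicative set. An ideal
  \<open>P\<close> maximal among those missing \<open>M\<close> is prime: if \<open>I\<close> and
  \<open>J\<close> are not inside \<open>P\<close>, then \<open>P + I\<close> and
  \<open>P + J\<close> meet \<open>M\<close>, and the m-system property puts an element of
  \<open>P + I J\<close> into \<open>M\<close>.\<close>

lemma (in ring) ex_prime_disjoint:
  assumes M: "M \<subseteq> carrier R" "M \<noteq> {}"
    and msys: "\<And>x y. \<lbrakk>x \<in> M; y \<in> M\<rbrakk> \<Longrightarrow> \<exists>r\<in>carrier R. x \<otimes> r \<otimes> y \<in> M"
    and "\<zero> \<notin> M"
  shows "\<exists>P. prime_ideal R P \<and> P \<inter> M = {}"
proof -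
  define A where "A = {I. ideal I R \<and> I \<inter> M = {}}"
  have "\<exists>U\<in>A. \<forall>X\<in>C. X \<subseteq> U" if C: "subset.chain A C" for C
  proof (cases "C = {}")
    case True
    have "{\<zero>} \<in> A" using assms zeroideal by (auto simp: A_def)
    then show ?thesis using True by auto
  next
    case False
    have CI: "ideal X R" "X \<inter> M = {}" if "X \<in> C" for X
      using C that by (auto simp: subset.chain_def A_def)
    have lin: "X \<subseteq> Y \<or> Y \<subseteq> X" if "X \<in> C" "Y \<in> C" for X Y
      using C that by (auto simp: subset.chain_def)
    have "ideal (\<Union>C) R"
    proof (rule ideal_memI)
      show "\<Union>C \<subseteq> carrier R" using ideal.Icarr[OF CI(1)] by (intro subsetI) (auto simp only: Union_iff)
      show "\<zero> \<in> \<Union>C"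
        using False CI(1) additive_subgroup.zero_closed ideal.axioms(1) by blast
      fix a assume a: "a \<in> \<Union>C"
      then obtain X where X: "X \<in> C" "a \<in> X" by blast
      show "x \<otimes> a \<in> \<Union>C" "a \<otimes> x \<in> \<Union>C" if "x \<in> carrier R" for x
        using X CI(1)[OF X(1)] that by (auto intro: ideal.I_l_closed ideal.I_r_closed)
      show "a \<oplus> b \<in> \<Union>C" if b: "b \<in> \<Union>C" for b
      proof -
        obtain Y where Y: "Y \<in> C" "b \<in> Y" using b by blast
        then obtain Z where "Z \<in> C" "a \<in> Z" "b \<in> Z" using lin[OF X(1) Y(1)] X Y by blast
        then show ?thesis
          using CI(1) additive_subgroup.a_closed ideal.axioms(1) by (metis UnionI)
      qed
    qed
    then show ?thesis using CI(2) by (intro bexI[of _ "\<Union>C"]) (auto simp: A_def)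
  qed
  then obtain P where P: "P \<in> A" and max: "\<And>X. X \<in> A \<Longrightarrow> P \<subseteq> X \<Longrightarrow> X = P"
    using subset_Zorn[of A] by metis
  interpret P: ideal P R using P by (simp add: A_def)
  have meets: "\<exists>p\<in>P. \<exists>i\<in>I. p \<oplus> i \<in> M" if I: "ideal I R" "\<not> I \<subseteq> P" for I
  proof -
    interpret I: ideal I R by fact
    have sub: "P \<subseteq> set_add R P I" "I \<subseteq> set_add R P I"
    proof -
      have "x \<in> set_add R P I" if "x \<in> P" for x
        unfolding set_add_def' using that I.zero_closed r_zero[OF P.Icarr[OF that], symmetric] by blast
      then show "P \<subseteq> set_add R P I" by (rule subsetI)
      have "x \<in> set_add R P I" if "x \<in> I" for x
        unfolding set_add_def' using that P.zero_closed l_zero[OF I.Icarr[OF that], symmetric] by blast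
      then show "I \<subseteq> set_add R P I" by (rule subsetI)
    qed
    then have "set_add R P I \<notin> A" using max I(2) by blast
    then have "(set_add R P I) \<inter> M \<noteq> {}" using add_ideals[OF P.is_ideal I(1)] by (auto simp: A_def)
    then show ?thesis unfolding set_add_def' by auto
  qed
  have "prime_ideal R P"
    unfolding prime_ideal_def
  proof (intro conjI allI impI)
    show "P \<noteq> carrier R" using P M by (auto simp: A_def)
    fix I J assume I: "ideal I R" and J: "ideal J R" and IJ: "I \<cdot> J \<subseteq> P"
    show "I \<subseteq> P \<or> J \<subseteq> P"
    proof (rule ccontr)
      assume "\<not> ?thesis"
      then obtain p i q j where *: "p \<in> P" "i \<in> I" "p \<oplus> i \<in> M" "q \<in> P" "j \<in> J" "q \<oplus> j \<in> M"
        using meets[OF I] meets[OF J] by blast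
      then obtain r where r: "r \<in> carrier R" "(p \<oplus> i) \<otimes> r \<otimes> (q \<oplus> j) \<in> M" using msys by blast
      note c = ideal.Icarr[OF I] ideal.Icarr[OF J]
      have irj: "i \<otimes> r \<otimes> j \<in> P"
        using IJ ideal_prod.prod[of "i \<otimes> r" I j J R] ideal.I_r_closed[OF I] r * by blast
      \<comment> \<open>The product \<open>(p + i) r (q + j)\<close> expands into terms with a
        factor from \<open>P\<close> and the single term \<open>i r j\<close>, which lies in
        \<open>I J\<close>.\<close>
      have "p \<otimes> (r \<otimes> (q \<oplus> j)) \<oplus> ((i \<otimes> r) \<otimes> q \<oplus> i \<otimes> r \<otimes> j) \<in> P"
      proof (rule P.a_closed[OF P.I_r_closed[OF \<open>p \<in> P\<close>] P.a_closed[OF P.I_l_closed[OF \<open>q \<in> P\<close>]]])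
      qed (use * r c irj in auto)
      also have "p \<otimes> (r \<otimes> (q \<oplus> j)) \<oplus> ((i \<otimes> r) \<otimes> q \<oplus> i \<otimes> r \<otimes> j) = (p \<oplus> i) \<otimes> r \<otimes> (q \<oplus> j)"
        using * r c by (simp add: m_assoc l_distr r_distr a_ac)
      finally show False using P r by (auto simp: A_def)
    qed
  qed (rule P.is_ideal)
  then show ?thesis using P by (auto simp: A_def)
qed

corollary (in ring) ex_prime: "\<one> \<noteq> \<zero> \<Longrightarrow> \<exists>P. prime_ideal R P"
  using ex_prime_disjoint[of "{\<one>}"] by auto

text \<open>A minimal prime is sought, whereas Zorn's lemma produces maximal sets, so it is applied
  to complements. The bound of a chain is the complement of the intersection of its primes, and such
  an intersection is again prime.\<close>

lemma (in ring) prime_contains_min_prime_over: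
  assumes "prime_ideal R P" "I \<subseteq> P"
  shows "\<exists>Q\<in>min_primes_over R I. Q \<subseteq> P"
proof -
  define A where "A = {carrier R - Q | Q. prime_ideal R Q \<and> I \<subseteq> Q \<and> Q \<subseteq> P}"
  have "\<exists>U\<in>A. \<forall>X\<in>C. X \<subseteq> U" if C: "subset.chain A C" for C
  proof (cases "C = {}")
    case True
    have "carrier R - P \<in> A" using assms by (auto simp: A_def)
    then show ?thesis using True by auto
  next
    case False
    \<comment> \<open>\<open>D\<close> recovers the primes from the chain of their complements;
      since primes lie in the carrier, a complement determines its prime.\<close>
    define D where "D = {Q. prime_ideal R Q \<and> carrier R - Q \<in> C}"
    have CD: "\<exists>Q\<in>D. X = carrier R - Q \<and> I \<subseteq> Q \<and> Q \<subseteq> P" if "X \<in> C" for X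
      using C that unfolding subset.chain_def A_def D_def by blast
    have DI: "ideal Q R" if "Q \<in> D" for Q using that prime_ideal_ideal by (auto simp: D_def)
    have Dc: "Q \<subseteq> carrier R" if "Q \<in> D" for Q using that prime_ideal_subset by (auto simp: D_def)
    have DIP: "I \<subseteq> Q \<and> Q \<subseteq> P" if Q: "Q \<in> D" for Q
    proof -
      have "carrier R - Q \<in> C" using Q by (simp add: D_def)
      then obtain Q' where Q': "Q' \<in> D" "carrier R - Q = carrier R - Q'" "I \<subseteq> Q'" "Q' \<subseteq> P"
        using CD by meson
      then have "Q = Q'" using Dc[OF Q] Dc[OF Q'(1)] by (simp add: double_diff set_eq_iff) blast
      then show ?thesis using Q' by simp
    qed
    have lin: "Q \<subseteq> Q' \<or> Q' \<subseteq> Q" if "Q \<in> D" "Q' \<in> D" for Q Q'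
    proof -
      have "carrier R - Q \<subseteq> carrier R - Q' \<or> carrier R - Q' \<subseteq> carrier R - Q"
      proof -
        have "carrier R - Q \<in> C" "carrier R - Q' \<in> C" using that by (auto simp: D_def)
        moreover have "X \<subseteq> Y \<or> Y \<subseteq> X" if "X \<in> C" "Y \<in> C" for X Y
          using C that by (auto simp: subset.chain_def)
        ultimately show ?thesis by simp
      qed
      then show ?thesis
        using Dc[OF that(1)] Dc[OF that(2)] by blast
    qed
    have Dn: "D \<noteq> {}" using False CD by blast
    have "prime_ideal R (\<Inter>D)"
      unfolding prime_ideal_iff
    proof (intro conjI ballI impI)
      show "ideal (\<Inter>D) R" using i_Intersect[OF DI Dn] by simp
      show "\<Inter>D \<noteq> carrier R"
        using Dn prime_ideal_one_notin by (auto simp: D_def)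
      fix x y assume x: "x \<in> carrier R" and y: "y \<in> carrier R"
        and xy: "\<forall>r\<in>carrier R. x \<otimes> r \<otimes> y \<in> \<Inter>D"
      show "x \<in> \<Inter>D \<or> y \<in> \<Inter>D"
      proof (rule ccontr)
        assume "\<not> ?thesis"
        then obtain Q Q' where "Q \<in> D" "Q' \<in> D" "x \<notin> Q" "y \<notin> Q'" by blast
        \<comment> \<open>Linearity turns two witnesses into one: the smaller of \<open>Q\<close>
          and \<open>Q'\<close> misses both \<open>x\<close> and \<open>y\<close>.\<close>
        then obtain Z where Z: "Z \<in> D" "x \<notin> Z" "y \<notin> Z" using lin[of Q Q'] by blast
        then show False using xy x y prime_idealD[of Z x y] unfolding D_def by blast
      qed
    qed
    moreover have "I \<subseteq> \<Inter>D" "\<Inter>D \<subseteq> P" using DIP Dn by blast+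
    ultimately have "carrier R - \<Inter>D \<in> A" by (auto simp: A_def)
    moreover have "X \<subseteq> carrier R - \<Inter>D" if "X \<in> C" for X
      using CD[OF that] by auto
    ultimately show ?thesis by (intro bexI[of _ "carrier R - \<Inter>D"]) simp_all
  qed
  then obtain U where U: "U \<in> A" and max: "\<And>X. X \<in> A \<Longrightarrow> U \<subseteq> X \<Longrightarrow> X = U"
    using subset_Zorn[of A] by metis
  obtain Q where Q: "U = carrier R - Q" "prime_ideal R Q" "I \<subseteq> Q" "Q \<subseteq> P"
    using U by (auto simp: A_def)
  have "Q' = Q" if Q': "prime_ideal R Q'" "I \<subseteq> Q'" "Q' \<subseteq> Q" for Q'
  proof -
    have "carrier R - Q' \<in> A" unfolding A_def using Q' Q(4) by blast
    then have "carrier R - Q' = carrier R - Q" using max Q' Q(1) by blast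
    then show ?thesis using Q' Q prime_ideal_subset[of R] by blast
  qed
  then show ?thesis using Q by (intro bexI[of _ Q]) (auto simp: min_primes_over_def Spec_def)
qed

lemma (in ring) min_primes_eq_over_zero: "min_primes R = min_primes_over R {\<zero>}"
proof -
  have "{\<zero>} \<subseteq> P" if "P \<in> Spec R" for P
    using that additive_subgroup.zero_closed ideal.axioms(1)
    by (auto simp: Spec_def prime_ideal_def)
  then show ?thesis by (auto simp: min_primes_def min_primes_over_def)
qed

lemma (in ring) prime_radical_eq_Inter_min_primes:
  "prime_radical R = carrier R \<inter> \<Inter>(min_primes R)"
proof -
  have "\<exists>Q\<in>min_primes R. Q \<subseteq> P" if "P \<in> Spec R" for P
    using that prime_contains_min_prime_over[of P "{\<zero>}"] prime_ideal_ideal[of R P]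
      additive_subgroup.zero_closed ideal.axioms(1)
    unfolding min_primes_eq_over_zero by (fastforce simp: Spec_def)
  moreover have "min_primes R \<subseteq> Spec R" by (auto simp: min_primes_def)
  ultimately show ?thesis by (auto simp: prime_radical_def)
qed

lemma (in ring) ideal_carrier_Inter:
  assumes "\<And>I. I \<in> F \<Longrightarrow> ideal I R"
  shows "ideal (carrier R \<inter> \<Inter>F) R"
proof (cases "F = {}")
  case False
  then show ?thesis using i_intersect[OF oneideal i_Intersect[OF assms]] by simp
qed (simp add: oneideal)

lemma (in ring) ideal_prime_radical: "ideal (prime_radical R) R"
  unfolding prime_radical_def by (rule ideal_carrier_Inter) (simp add: Spec_def prime_ideal_ideal)

text \<open>Since \<open>I K \<subseteq> I \<inter> K\<close>, primeness splits off one factor at a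
  time. Intersecting with the carrier makes the empty family the unit ideal, which no prime
  contains, so the induction can start there.\<close>

lemma (in ring) prime_contains_finite_Inter:
  assumes P: "prime_ideal R P" and "finite F" "\<And>I. I \<in> F \<Longrightarrow> ideal I R"
    and "carrier R \<inter> \<Inter>F \<subseteq> P"
  shows "\<exists>I\<in>F. I \<subseteq> P"
  using assms(2-)
proof (induction F)
  case empty
  then show ?case using prime_ideal_one_notin[OF P] by auto
next
  case (insert I F)
  have K: "ideal (carrier R \<inter> \<Inter>F) R" by (rule ideal_carrier_Inter) (use insert in auto)
  have "I \<cdot> (carrier R \<inter> \<Inter>F) \<subseteq> I \<inter> (carrier R \<inter> \<Inter>F)"
    by (rule ideal_prod_inter) (use insert K in auto)
  then have "I \<cdot> (carrier R \<inter> \<Inter>F) \<subseteq> P" using insert.prems(2) by blast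
  then have "I \<subseteq> P \<or> carrier R \<inter> \<Inter>F \<subseteq> P"
    using P K insert.prems(1)[of I] by (auto simp: prime_ideal_def)
  then show ?case using insert by auto
qed

text \<open>This determines the minimal primes without a description of the spectrum: every prime
  contains the radical, hence the intersection of the finite family, hence one of its members. It is
  applied to families of localized primes.\<close>

lemma (in ring) min_primes_eqI:
  assumes "finite F" "F \<subseteq> Spec R" "carrier R \<inter> \<Inter>F \<subseteq> prime_radical R"
    and incomp: "\<And>P Q. \<lbrakk>P \<in> F; Q \<in> F; P \<subseteq> Q\<rbrakk> \<Longrightarrow> P = Q"
  shows "min_primes R = F"
proof -
  have below: "\<exists>Q\<in>F. Q \<subseteq> P" if "P \<in> Spec R" for P
  proof (rule prime_contains_finite_Inter)
    show "carrier R \<inter> \<Inter>F \<subseteq> P" using assms(3) that by (auto simp: prime_radical_def)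
  qed (use assms that in \<open>auto simp: Spec_def prime_ideal_ideal\<close>)
  show ?thesis
  proof (intro subset_antisym subsetI)
    fix P assume P: "P \<in> min_primes R"
    then obtain Q where "Q \<in> F" "Q \<subseteq> P" using below[of P] unfolding min_primes_def by blast
    then have "Q = P" using P assms(2) by (auto simp: min_primes_def)
    then show "P \<in> F" using \<open>Q \<in> F\<close> by simp
  next
    fix P assume P: "P \<in> F"
    have "Q = P" if Q: "Q \<in> Spec R" "Q \<subseteq> P" for Q
    proof -
      obtain Q' where "Q' \<in> F" "Q' \<subseteq> Q" using below[OF Q(1)] by blast
      then have "Q' = P" using incomp[OF _ P] Q(2) by blast
      then show ?thesis using \<open>Q' \<subseteq> Q\<close> Q(2) by blast
    qed
    then show "P \<in> min_primes R" using P assms(2) by (auto simp: min_primes_def)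
  qed
qed

lemma ring_isoD:
  assumes "h \<in> ring_iso R S"
  shows "h \<in> ring_hom R S" "bij_betw h (carrier R) (carrier S)"
  using assms by (auto simp: ring_iso_def)

section \<open>Prime ideals under surjective homomorphisms\<close>

context ring_hom_ring
begin

text \<open>As \<open>P\<close> contains the kernel, it is a union of fibres of \<open>h\<close>, so
  membership in the image can be tested upstairs; the second conclusion is what transports
  primeness.\<close>

lemma prime_ideal_image:
  assumes surj: "h ` carrier R = carrier S" and P: "prime_ideal R P"
    and ker: "\<And>x. \<lbrakk>x \<in> carrier R; h x = \<zero>\<^bsub>S\<^esub>\<rbrakk> \<Longrightarrow> x \<in> P"
  shows "prime_ideal S (h ` P)"
    and "\<And>x. x \<in> carrier R \<Longrightarrow> h x \<in> h ` P \<longleftrightarrow> x \<in> P"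
proof -
  interpret P: ideal P R using P by (rule prime_ideal_ideal)
  show mem: "h x \<in> h ` P \<longleftrightarrow> x \<in> P" if x: "x \<in> carrier R" for x
  proof
    assume "h x \<in> h ` P"
    then obtain p where p: "p \<in> P" "h x = h p" by auto
    then have "h (x \<ominus> p) = \<zero>\<^bsub>S\<^esub>" using x P.Icarr[OF p(1)]
      by (simp add: R.minus_eq S.r_neg)
    then have "x \<ominus> p \<in> P" using ker x P.Icarr[OF p(1)] by simp
    then have "(x \<ominus> p) \<oplus> p \<in> P" using p(1) by (rule P.a_closed)
    then show "x \<in> P" using x P.Icarr[OF p(1)] by (simp add: R.minus_eq R.add.m_assoc R.l_neg)
  qed simp
  have img: "\<exists>x\<in>carrier R. y = h x" if "y \<in> carrier S" for y using surj that by auto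
  show "prime_ideal S (h ` P)"
    unfolding S.prime_ideal_iff
  proof (intro conjI ballI impI)
    show "ideal (h ` P) S"
    proof (rule S.ideal_memI)
      show "h ` P \<subseteq> carrier S" using P.Icarr by auto
      show "\<zero>\<^bsub>S\<^esub> \<in> h ` P" using P.zero_closed hom_zero by (metis imageI)
      show "a \<oplus>\<^bsub>S\<^esub> b \<in> h ` P" if ab: "a \<in> h ` P" "b \<in> h ` P" for a b
      proof -
        obtain x y where "x \<in> P" "y \<in> P" "a = h x" "b = h y" using ab by auto
        then show ?thesis
          using P.a_closed P.Icarr hom_add[of x y] by (intro image_eqI[of _ _ "x \<oplus> y"]) auto
      qed
      fix a y assume a: "a \<in> h ` P" and y: "y \<in> carrier S"
      obtain p x where "p \<in> P" "a = h p" "x \<in> carrier R" "y = h x" using a img[OF y] by auto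
      then show "y \<otimes>\<^bsub>S\<^esub> a \<in> h ` P" "a \<otimes>\<^bsub>S\<^esub> y \<in> h ` P"
        using P.I_l_closed[of p x] P.I_r_closed[of p x] P.Icarr[of p]
        by (auto intro: image_eqI[of _ _ "x \<otimes> p"] image_eqI[of _ _ "p \<otimes> x"])
    qed
    show "h ` P \<noteq> carrier S" using mem[OF R.one_closed] R.prime_ideal_one_notin[OF P] by auto
    fix x' y' assume "x' \<in> carrier S" "y' \<in> carrier S"
      and *: "\<forall>r\<in>carrier S. x' \<otimes>\<^bsub>S\<^esub> r \<otimes>\<^bsub>S\<^esub> y' \<in> h ` P"
    then obtain x y where xy: "x \<in> carrier R" "x' = h x" "y \<in> carrier R" "y' = h y" using img by metis
    have "x \<otimes> r \<otimes> y \<in> P" if "r \<in> carrier R" for r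
    proof -
      have "h x \<otimes>\<^bsub>S\<^esub> h r \<otimes>\<^bsub>S\<^esub> h y \<in> h ` P" using * that xy by simp
      then have "h (x \<otimes> r \<otimes> y) \<in> h ` P" using that xy by simp
      then show ?thesis using mem[of "x \<otimes> r \<otimes> y"] that xy by simp
    qed
    then have "x \<in> P \<or> y \<in> P" using R.prime_idealD[OF P] xy by metis
    then show "x' \<in> h ` P \<or> y' \<in> h ` P" using xy by auto
  qed
qed

lemma prime_ideal_vimage:
  assumes surj: "h ` carrier R = carrier S" and Q: "prime_ideal S Q"
  shows "prime_ideal R {x \<in> carrier R. h x \<in> Q}" and "h ` {x \<in> carrier R. h x \<in> Q} = Q"
proof -
  interpret Q: ideal Q S using Q by (rule prime_ideal_ideal)
  show "h ` {x \<in> carrier R. h x \<in> Q} = Q"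
  proof (intro subset_antisym subsetI)
    fix y assume y: "y \<in> Q"
    then obtain x where "x \<in> carrier R" "y = h x" using Q.Icarr[OF y] unfolding surj[symmetric] by auto
    then show "y \<in> h ` {x \<in> carrier R. h x \<in> Q}" using y by auto
  qed auto
  show "prime_ideal R {x \<in> carrier R. h x \<in> Q}"
    unfolding R.prime_ideal_iff
  proof (intro conjI ballI impI)
    show "ideal {x \<in> carrier R. h x \<in> Q} R" using ideal_vimage[OF Q.is_ideal] by simp
    show "{x \<in> carrier R. h x \<in> Q} \<noteq> carrier R"
      using S.prime_ideal_one_notin[OF Q] R.one_closed hom_one by (metis (lifting) mem_Collect_eq)
    fix x y assume xy: "x \<in> carrier R" "y \<in> carrier R"
      and *: "\<forall>r\<in>carrier R. x \<otimes> r \<otimes> y \<in> {x \<in> carrier R. h x \<in> Q}"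
    have "h x \<otimes>\<^bsub>S\<^esub> r' \<otimes>\<^bsub>S\<^esub> h y \<in> Q" if r': "r' \<in> carrier S" for r'
    proof -
      obtain r where r: "r \<in> carrier R" "r' = h r" using surj r' by auto
      then have "h (x \<otimes> r \<otimes> y) \<in> Q" using * by simp
      then show ?thesis using r xy by simp
    qed
    then have "h x \<in> Q \<or> h y \<in> Q" using S.prime_idealD[OF Q, of "h x" "h y"] xy by auto
    then show "x \<in> {x \<in> carrier R. h x \<in> Q} \<or> y \<in> {x \<in> carrier R. h x \<in> Q}" using xy by simp
  qed
qed

text \<open>Taking images both preserves and reflects inclusion between primes that contain the
  kernel, and every prime of the target is such an image, so minimality corresponds on the two
  sides. It serves for the projection onto \<open>R/\<aa>\<close> and, with kernel zero, for
  isomorphisms.\<close>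

lemma min_primes_over_image:
  assumes surj: "h ` carrier R = carrier S"
    and ker: "\<And>x. x \<in> carrier R \<Longrightarrow> h x = \<zero>\<^bsub>S\<^esub> \<longleftrightarrow> x \<in> I"
    and I: "I \<subseteq> carrier R"
  shows "bij_betw ((`) h) (min_primes_over R I) (min_primes S)"
proof -
  have mem: "h x \<in> h ` P \<longleftrightarrow> x \<in> P"
    if "prime_ideal R P" "I \<subseteq> P" "x \<in> carrier R" for P x
    using prime_ideal_image(2)[OF surj that(1)] that ker by blast
  have le: "h ` P \<subseteq> h ` P' \<longleftrightarrow> P \<subseteq> P'"
    if P: "prime_ideal R P" "I \<subseteq> P" and P': "prime_ideal R P'" "I \<subseteq> P'" for P P'
    using mem[OF P'] prime_ideal_subset[OF P(1)] by blast
  have img: "prime_ideal S (h ` P)" if "prime_ideal R P" "I \<subseteq> P" for P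
    using prime_ideal_image(1)[OF surj that(1)] that ker by blast
  have pre: "\<exists>P. prime_ideal R P \<and> I \<subseteq> P \<and> Q = h ` P" if Q: "prime_ideal S Q" for Q
  proof (intro exI conjI)
    have "\<zero>\<^bsub>S\<^esub> \<in> Q" using Q additive_subgroup.zero_closed ideal.axioms(1) prime_ideal_ideal by blast
    moreover have "h x = \<zero>\<^bsub>S\<^esub>" if "x \<in> I" for x using ker[of x] that I by blast
    ultimately show "I \<subseteq> {x \<in> carrier R. h x \<in> Q}" using I by auto
  qed (use prime_ideal_vimage[OF surj Q] in auto)
  show ?thesis
    unfolding bij_betw_def
  proof (intro conjI subset_antisym subsetI)
    show "inj_on ((`) h) (min_primes_over R I)"
    proof (rule inj_onI)
      fix P P' assume *: "P \<in> min_primes_over R I" "P' \<in> min_primes_over R I" "h ` P = h ` P'"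
      then have P: "prime_ideal R P" "I \<subseteq> P" and P': "prime_ideal R P'" "I \<subseteq> P'"
        by (auto simp: min_primes_over_def Spec_def)
      show "P = P'" using le[OF P P'] le[OF P' P] *(3) by blast
    qed
    fix Q assume "Q \<in> (`) h ` min_primes_over R I"
    then obtain P where Q: "Q = h ` P" and P: "prime_ideal R P" "I \<subseteq> P"
      and min: "\<And>P'. \<lbrakk>prime_ideal R P'; I \<subseteq> P'; P' \<subseteq> P\<rbrakk> \<Longrightarrow> P' = P"
      by (auto simp: min_primes_over_def Spec_def)
    have "Q' = Q" if Q': "prime_ideal S Q'" "Q' \<subseteq> Q" for Q'
    proof -
      obtain P' where P': "prime_ideal R P'" "I \<subseteq> P'" "Q' = h ` P'" using pre[OF Q'(1)] by blast
      then have "P' \<subseteq> P" using le[OF P'(1,2) P] Q'(2) Q by simp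
      then show ?thesis using min P' Q by blast
    qed
    then show "Q \<in> min_primes S" using img[OF P] Q by (simp add: min_primes_def Spec_def)
  next
    fix Q assume "Q \<in> min_primes S"
    then have Q: "prime_ideal S Q" and min: "\<And>Q'. \<lbrakk>prime_ideal S Q'; Q' \<subseteq> Q\<rbrakk> \<Longrightarrow> Q' = Q"
      by (auto simp: min_primes_def Spec_def)
    obtain P where P: "prime_ideal R P" "I \<subseteq> P" "Q = h ` P" using pre[OF Q] by blast
    have "P' = P" if P': "prime_ideal R P'" "I \<subseteq> P'" "P' \<subseteq> P" for P'
    proof -
      have "h ` P' = h ` P" using min[OF img[OF P'(1,2)]] P' P by blast
      then show ?thesis using le[OF P(1,2) P'(1,2)] P' by blast
    qed
    then show "Q \<in> (`) h ` min_primes_over R I"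
      using P by (auto simp: min_primes_over_def Spec_def)
  qed
qed

end

text \<open>Meant for two isomorphisms: conjugation by a regular normal element, and the
  identification of \<open>S'^-1 R\<close> with the localization of \<open>R/\<aa>\<close>.\<close>

lemma ring_iso_Spec:
  assumes "ring R" "ring S" and h: "h \<in> ring_iso R S"
  shows "(`) h ` Spec R = Spec S" and "bij_betw ((`) h) (min_primes R) (min_primes S)"
proof -
  interpret ring_hom_ring R S h
    by (rule ring_hom_ringI2[OF assms(1,2) ring_isoD(1)[OF h]])
  have surj: "h ` carrier R = carrier S" and inj: "inj_on h (carrier R)"
    using ring_isoD(2)[OF h] by (auto simp: bij_betw_def)
  have ker: "h x = \<zero>\<^bsub>S\<^esub> \<longleftrightarrow> x \<in> {\<zero>\<^bsub>R\<^esub>}" if "x \<in> carrier R" for x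
    using inj that inj_onD[OF inj, of x "\<zero>\<^bsub>R\<^esub>"] by auto
  show "bij_betw ((`) h) (min_primes R) (min_primes S)"
    unfolding R.min_primes_eq_over_zero by (rule min_primes_over_image[OF surj ker]) auto
  have "prime_ideal S (h ` P)" if P: "prime_ideal R P" for P
  proof (rule prime_ideal_image(1)[OF surj P])
    show "x \<in> P" if "x \<in> carrier R" "h x = \<zero>\<^bsub>S\<^esub>" for x
      using ker[OF that(1)] that(2) additive_subgroup.zero_closed[OF ideal.axioms(1)]
        prime_ideal_ideal[OF P] by auto
  qed
  moreover have "\<exists>P. prime_ideal R P \<and> Q = h ` P" if "prime_ideal S Q" for Q
    using prime_ideal_vimage[OF surj that] by metis
  ultimately show "(`) h ` Spec R = Spec S" unfolding Spec_def by blast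
qed

section \<open>Regular normal elements\<close>

lemma (in ring) normal_elemD:
  assumes "normal_elem R x"
  shows "x \<in> carrier R"
    and "r \<in> carrier R \<Longrightarrow> \<exists>r'\<in>carrier R. x \<otimes> r = r' \<otimes> x"
    and "r \<in> carrier R \<Longrightarrow> \<exists>r'\<in>carrier R. r \<otimes> x = x \<otimes> r'"
proof -
  show "x \<in> carrier R" using assms by (simp add: normal_elem_def)
  have eq: "carrier R #> x = x <# carrier R" using assms by (simp add: normal_elem_def)
  show "\<exists>r'\<in>carrier R. x \<otimes> r = r' \<otimes> x" if "r \<in> carrier R"
  proof -
    have "x \<otimes> r \<in> carrier R #> x" using that unfolding eq l_coset_def by auto
    then show ?thesis by (auto simp: r_coset_def)
  qed
  show "\<exists>r'\<in>carrier R. r \<otimes> x = x \<otimes> r'" if "r \<in> carrier R"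
  proof -
    have "r \<otimes> x \<in> x <# carrier R" using that unfolding eq[symmetric] r_coset_def by auto
    then show ?thesis by (auto simp: l_coset_def)
  qed
qed

lemma (in ring) normal_elemI:
  assumes x: "x \<in> carrier R"
    and "\<And>r. r \<in> carrier R \<Longrightarrow> \<exists>r'\<in>carrier R. x \<otimes> r = r' \<otimes> x"
    and "\<And>r. r \<in> carrier R \<Longrightarrow> \<exists>r'\<in>carrier R. r \<otimes> x = x \<otimes> r'"
  shows "normal_elem R x"
proof -
  have "carrier R #> x = x <# carrier R"
    unfolding l_coset_def r_coset_def using assms(2,3) by (fastforce simp: set_eq_iff)
  then show ?thesis using x by (simp add: normal_elem_def)
qed

lemma (in ring_hom_ring) normal_elem_image:
  assumes surj: "h ` carrier R = carrier S" and x: "normal_elem R x"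
  shows "normal_elem S (h x)"
proof (rule S.normal_elemI)
  note n = R.normal_elemD[OF x]
  show "h x \<in> carrier S" using n(1) by simp
  fix r assume "r \<in> carrier S"
  then obtain q where q: "q \<in> carrier R" "r = h q" using surj by auto
  obtain q' where "q' \<in> carrier R" "x \<otimes> q = q' \<otimes> x" using n(2)[OF q(1)] by auto
  then show "\<exists>r'\<in>carrier S. h x \<otimes>\<^bsub>S\<^esub> r = r' \<otimes>\<^bsub>S\<^esub> h x"
    using n(1) q by (metis hom_closed hom_mult)
  obtain q' where "q' \<in> carrier R" "q \<otimes> x = x \<otimes> q'" using n(3)[OF q(1)] by auto
  then show "\<exists>r'\<in>carrier S. r \<otimes>\<^bsub>S\<^esub> h x = h x \<otimes>\<^bsub>S\<^esub> r'"
    using n(1) q by (metis hom_closed hom_mult)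
qed

lemma (in ring) normal_elem_mult:
  assumes x: "normal_elem R x" and y: "normal_elem R y"
  shows "normal_elem R (x \<otimes> y)"
proof (rule normal_elemI)
  note c = normal_elemD(1)[OF x] normal_elemD(1)[OF y]
  show "x \<otimes> y \<in> carrier R" using c by simp
  fix r assume r: "r \<in> carrier R"
  obtain q where q: "q \<in> carrier R" "y \<otimes> r = q \<otimes> y" using normal_elemD(2)[OF y r] by auto
  obtain p where p: "p \<in> carrier R" "x \<otimes> q = p \<otimes> x" using normal_elemD(2)[OF x q(1)] by auto
  have "x \<otimes> y \<otimes> r = p \<otimes> (x \<otimes> y)" using c r p q by (metis m_assoc)
  then show "\<exists>r'\<in>carrier R. x \<otimes> y \<otimes> r = r' \<otimes> (x \<otimes> y)" using p(1) by blast
  obtain q where q: "q \<in> carrier R" "r \<otimes> x = x \<otimes> q" using normal_elemD(3)[OF x r] by auto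
  obtain p where p: "p \<in> carrier R" "q \<otimes> y = y \<otimes> p" using normal_elemD(3)[OF y q(1)] by auto
  have "r \<otimes> (x \<otimes> y) = x \<otimes> y \<otimes> p" using c r p q by (metis m_assoc)
  then show "\<exists>r'\<in>carrier R. r \<otimes> (x \<otimes> y) = x \<otimes> y \<otimes> r'" using p(1) by blast
qed

lemma (in ring) normal_elem_one: "normal_elem R \<one>"
  by (rule normal_elemI) auto

definition regular_elem :: "('a, 'b) ring_scheme \<Rightarrow> 'a \<Rightarrow> bool"
  where "regular_elem R x \<longleftrightarrow> x \<in> carrier R \<and>
    (\<forall>r\<in>carrier R. (x \<otimes>\<^bsub>R\<^esub> r = \<zero>\<^bsub>R\<^esub> \<longrightarrow> r = \<zero>\<^bsub>R\<^esub>) \<and> (r \<otimes>\<^bsub>R\<^esub> x = \<zero>\<^bsub>R\<^esub> \<longrightarrow> r = \<zero>\<^bsub>R\<^esub>))"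

lemma regular_elemD:
  assumes "regular_elem R x"
  shows "x \<in> carrier R"
    and "\<lbrakk>r \<in> carrier R; x \<otimes>\<^bsub>R\<^esub> r = \<zero>\<^bsub>R\<^esub>\<rbrakk> \<Longrightarrow> r = \<zero>\<^bsub>R\<^esub>"
    and "\<lbrakk>r \<in> carrier R; r \<otimes>\<^bsub>R\<^esub> x = \<zero>\<^bsub>R\<^esub>\<rbrakk> \<Longrightarrow> r = \<zero>\<^bsub>R\<^esub>"
  using assms unfolding regular_elem_def by blast+

lemma (in ring) minus_eq_zeroD:
  assumes "r \<in> carrier R" "q \<in> carrier R" "r \<ominus> q = \<zero>" shows "r = q"
proof -
  have "(r \<ominus> q) \<oplus> q = r" using assms(1,2) by (simp add: minus_eq a_assoc l_neg)
  then show ?thesis using assms by simp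
qed

lemma (in ring) regular_elem_cancel:
  assumes "regular_elem R x" "r \<in> carrier R" "q \<in> carrier R"
  shows "x \<otimes> r = x \<otimes> q \<Longrightarrow> r = q" and "r \<otimes> x = q \<otimes> x \<Longrightarrow> r = q"
proof -
  note x = regular_elemD(1)[OF assms(1)]
  have d: "r \<ominus> q \<in> carrier R" using assms by simp
  show "r = q" if "x \<otimes> r = x \<otimes> q"
  proof -
    have "x \<otimes> (r \<ominus> q) = \<zero>" using that x assms(2,3) by (simp add: minus_eq r_distr r_minus r_neg)
    then have "r \<ominus> q = \<zero>" by (rule regular_elemD(2)[OF assms(1) d])
    then show ?thesis by (rule minus_eq_zeroD[OF assms(2,3)])
  qed
  show "r = q" if "r \<otimes> x = q \<otimes> x"
  proof -
    have "(r \<ominus> q) \<otimes> x = \<zero>" using that x assms(2,3) by (simp add: minus_eq l_distr l_minus r_neg)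
    then have "r \<ominus> q = \<zero>" by (rule regular_elemD(3)[OF assms(1) d])
    then show ?thesis by (rule minus_eq_zeroD[OF assms(2,3)])
  qed
qed

lemma (in ring) regular_elem_pow: "regular_elem R x \<Longrightarrow> regular_elem R (x [^] (n::nat))"
proof (induction n)
  case (Suc n)
  have c: "x \<in> carrier R" "x [^] n \<in> carrier R" using regular_elemD(1)[OF Suc.prems] by auto
  note Sn = regular_elemD(2,3)[OF Suc.IH[OF Suc.prems]] regular_elemD(2,3)[OF Suc.prems]
  show ?case unfolding regular_elem_def
  proof (intro conjI ballI impI)
    fix r assume r: "r \<in> carrier R"
    show "r = \<zero>" if "x [^] Suc n \<otimes> r = \<zero>"
    proof -
      have "x [^] n \<otimes> (x \<otimes> r) = \<zero>" using that c r by (simp add: m_assoc)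
      then show ?thesis using Sn(1)[of "x \<otimes> r"] Sn(3)[of r] c r by simp
    qed
    show "r = \<zero>" if "r \<otimes> x [^] Suc n = \<zero>"
    proof -
      have "(r \<otimes> x [^] n) \<otimes> x = \<zero>" using that c r by (simp add: m_assoc)
      then show ?thesis using Sn(4)[of "r \<otimes> x [^] n"] Sn(2)[of r] c r by simp
    qed
  qed (use c in simp)
next
  case 0
  show ?case unfolding regular_elem_def by (intro conjI ballI impI) (auto dest: sym)
qed

text \<open>Condition \<open>n2\<close> expresses, without inverting \<open>y\<close>, that
  conjugation by \<open>y\<close> maps \<open>P\<close> into itself. The set \<open>M\<close>
  contains the complement of \<open>P\<close> through \<open>k = 0\<close>, which forces the prime
  that misses it into \<open>P\<close>, and it contains \<open>y\<close> through
  \<open>k = 1\<close> and \<open>z = 1\<close>.\<close>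

lemma (in ring) regular_notin_min_prime_of_normalizing:
  assumes P: "P \<in> min_primes R" and y: "regular_elem R y"
    and n1: "\<And>r. r \<in> carrier R \<Longrightarrow> \<exists>r'\<in>carrier R. y \<otimes> r = r' \<otimes> y"
    and n2: "\<And>z. z \<in> carrier R - P \<Longrightarrow> \<exists>z'\<in>carrier R - P. z \<otimes> y = y \<otimes> z'"
  shows "y \<notin> P"
proof -
  have pP: "prime_ideal R P" using P by (simp add: min_primes_def Spec_def)
  have P0: "\<zero> \<in> P"
    using additive_subgroup.zero_closed[OF ideal.axioms(1)[OF prime_ideal_ideal[OF pP]]] .
  have P1: "\<one> \<notin> P" using prime_ideal_one_notin[OF pP] .
  have yc: "y \<in> carrier R" "y [^] (k::nat) \<in> carrier R" for k
    using regular_elemD(1)[OF y] by auto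
  have m1: "\<exists>r'\<in>carrier R. y [^] k \<otimes> r = r' \<otimes> y [^] k" if "r \<in> carrier R" for r and k :: nat
    using that
  proof (induction k arbitrary: r)
    case (Suc k)
    obtain q where q: "q \<in> carrier R" "y \<otimes> r = q \<otimes> y" using n1[OF Suc.prems] by auto
    obtain p where p: "p \<in> carrier R" "y [^] k \<otimes> q = p \<otimes> y [^] k" using Suc.IH[OF q(1)] by auto
    have "y [^] Suc k \<otimes> r = y [^] k \<otimes> q \<otimes> y" using q yc Suc.prems by (simp add: m_assoc)
    also have "\<dots> = p \<otimes> y [^] Suc k" using p yc by (simp add: m_assoc)
    finally have "y [^] Suc k \<otimes> r = p \<otimes> y [^] Suc k" .
    then show ?case using p(1) by blast
  qed auto
  have m2: "\<exists>z'\<in>carrier R - P. z \<otimes> y [^] k = y [^] k \<otimes> z'" if "z \<in> carrier R - P" for z and k :: nat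
    using that
  proof (induction k arbitrary: z)
    case (Suc k)
    obtain q where q: "q \<in> carrier R - P" "z \<otimes> y [^] k = y [^] k \<otimes> q" using Suc by blast
    obtain p where p: "p \<in> carrier R - P" "q \<otimes> y = y \<otimes> p" using n2[OF q(1)] by auto
    have "z \<otimes> y [^] Suc k = y [^] k \<otimes> q \<otimes> y" using q yc Suc.prems by (simp add: m_assoc flip: q(2))
    also have "\<dots> = y [^] Suc k \<otimes> p" using p q yc by (simp add: m_assoc)
    finally have "z \<otimes> y [^] Suc k = y [^] Suc k \<otimes> p" .
    then show ?case using p(1) by blast
  qed auto
  define M where "M = {y [^] k \<otimes> z | k z. z \<in> carrier R - P \<and> k \<in> (UNIV :: nat set)}"
  have "\<exists>Q. prime_ideal R Q \<and> Q \<inter> M = {}"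
  proof (rule ex_prime_disjoint)
    show "M \<subseteq> carrier R" "M \<noteq> {}" using yc P1 by (auto simp: M_def)
    show "\<zero> \<notin> M"
    proof
      assume "\<zero> \<in> M"
      then obtain k :: nat and z where "z \<in> carrier R - P" "y [^] k \<otimes> z = \<zero>" by (auto simp: M_def)
      then show False using regular_elemD(2)[OF regular_elem_pow[OF y, of k], of z] P0 by auto
    qed
    fix a b assume "a \<in> M" "b \<in> M"
    then obtain k l :: nat and z w where a: "z \<in> carrier R - P" "a = y [^] k \<otimes> z"
      and b: "w \<in> carrier R - P" "b = y [^] l \<otimes> w" by (auto simp: M_def)
    obtain z' where z': "z' \<in> carrier R - P" "z \<otimes> y [^] l = y [^] l \<otimes> z'" using m2[OF a(1)] by blast
    obtain r where r: "r \<in> carrier R" "z' \<otimes> r \<otimes> w \<notin> P"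
      using prime_idealD[OF pP, of z' w] z' b by blast
    \<comment> \<open>The factor to insert between \<open>a\<close> and \<open>b\<close> is not
      \<open>r\<close> but its conjugate: \<open>r' y^l = y^l r\<close> lets \<open>y^l\<close> pass
      to the left, first over \<open>r\<close> and then over \<open>z\<close>.\<close>
    obtain r' where r': "r' \<in> carrier R" "y [^] l \<otimes> r = r' \<otimes> y [^] l" using m1[OF r(1)] by blast
    have "a \<otimes> r' \<otimes> b = y [^] k \<otimes> z \<otimes> (r' \<otimes> y [^] l) \<otimes> w"
      using a b r r' z' yc by (simp add: m_assoc)
    also have "\<dots> = y [^] k \<otimes> (z \<otimes> y [^] l) \<otimes> r \<otimes> w"
      using a(1) b(1) r(1) r'(1) yc by (simp add: m_assoc flip: r'(2))
    also have "\<dots> = y [^] k \<otimes> (y [^] l \<otimes> z') \<otimes> r \<otimes> w" by (simp only: z'(2))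
    also have "\<dots> = y [^] (k + l) \<otimes> (z' \<otimes> r \<otimes> w)"
      using a b r z' yc by (simp add: m_assoc flip: nat_pow_mult)
    finally have "a \<otimes> r' \<otimes> b \<in> M" using r z' b(1) unfolding M_def by blast
    then show "\<exists>r\<in>carrier R. a \<otimes> r \<otimes> b \<in> M" using r' by blast
  qed
  then obtain Q where Q: "prime_ideal R Q" "Q \<inter> M = {}" by blast
  have "z \<in> M" if "z \<in> carrier R - P" for z
    unfolding M_def using that by (auto intro!: exI[of _ "0::nat"] exI[of _ z])
  then have "Q \<subseteq> P" using Q prime_ideal_subset[OF Q(1)] by blast
  then have "Q = P" using P Q(1) by (auto simp: min_primes_def Spec_def)
  moreover have "y \<in> M"
    unfolding M_def using P1 yc by (auto intro!: exI[of _ "1::nat"] exI[of _ \<one>])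
  ultimately show ?thesis using Q(2) by blast
qed

theorem (in ring) regular_normal_notin_min_prime:
  assumes x: "regular_elem R x" "normal_elem R x"
    and fin: "finite (min_primes R)" and P: "P \<in> min_primes R"
  shows "x \<notin> P"
proof
  assume xP: "x \<in> P"
  note xc = regular_elemD(1)[OF x(1)]
  \<comment> \<open>\<open>\<sigma>\<close> is the conjugation that sends \<open>r\<close> to
    \<open>x r x^-1\<close>; it exists by normality and is unique because \<open>x\<close> cancels
    on the right. This uniqueness is \<open>\<sigma>eq\<close>, from which the homomorphism laws and
    surjectivity are read off.\<close>
  obtain \<sigma> where \<sigma>: "\<And>r. r \<in> carrier R \<Longrightarrow> \<sigma> r \<in> carrier R \<and> x \<otimes> r = \<sigma> r \<otimes> x"
    using normal_elemD(2)[OF x(2)] by metis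
  have \<sigma>eq: "\<sigma> r = q" if "r \<in> carrier R" "q \<in> carrier R" "x \<otimes> r = q \<otimes> x" for r q
    using \<sigma>[OF that(1)] that regular_elem_cancel(2)[OF x(1), of "\<sigma> r" q] by simp
  have "\<sigma> \<in> ring_hom R R"
  proof (rule ring_hom_memI)
    fix a b assume ab: "a \<in> carrier R" "b \<in> carrier R"
    note * = \<sigma>[OF ab(1)] \<sigma>[OF ab(2)]
    show "\<sigma> (a \<otimes> b) = \<sigma> a \<otimes> \<sigma> b"
    proof (rule \<sigma>eq)
      have "x \<otimes> (a \<otimes> b) = \<sigma> a \<otimes> (x \<otimes> b)" using * ab xc by (metis m_assoc)
      then show "x \<otimes> (a \<otimes> b) = \<sigma> a \<otimes> \<sigma> b \<otimes> x" using * ab xc by (simp add: m_assoc)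
    qed (use * ab in auto)
    show "\<sigma> (a \<oplus> b) = \<sigma> a \<oplus> \<sigma> b"
      by (rule \<sigma>eq) (use * ab xc in \<open>auto simp: l_distr r_distr\<close>)
  next
    show "\<sigma> \<one> = \<one>" by (rule \<sigma>eq) (use xc in auto)
  qed (use \<sigma> in auto)
  moreover have "bij_betw \<sigma> (carrier R) (carrier R)"
    unfolding bij_betw_def
  proof (intro conjI inj_onI subset_antisym subsetI)
    fix a b assume "a \<in> carrier R" "b \<in> carrier R" "\<sigma> a = \<sigma> b"
    then show "a = b" using \<sigma>[of a] \<sigma>[of b] regular_elem_cancel(1)[OF x(1), of a b] by simp
  next
    fix q assume q: "q \<in> carrier R"
    then obtain r where "r \<in> carrier R" "q \<otimes> x = x \<otimes> r" using normal_elemD(3)[OF x(2)] by blast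
    then show "q \<in> \<sigma> ` carrier R" using \<sigma>eq[of r q] q by auto
  qed (use \<sigma> in auto)
  ultimately have iso: "\<sigma> \<in> ring_iso R R" by (simp add: ring_iso_def)
  have pw: "(\<sigma> ^^ k) r \<in> carrier R \<and> x [^] k \<otimes> r = (\<sigma> ^^ k) r \<otimes> x [^] k"
    if r: "r \<in> carrier R" for k r
  proof (induction k)
    case (Suc k)
    then have a: "(\<sigma> ^^ k) r \<in> carrier R" and b: "x [^] k \<otimes> r = (\<sigma> ^^ k) r \<otimes> x [^] k" by auto
    have "x [^] Suc k \<otimes> r = x \<otimes> (x [^] k \<otimes> r)"
      using xc r nat_pow_Suc2[OF xc, of k] by (simp add: m_assoc)
    also have "\<dots> = x \<otimes> (\<sigma> ^^ k) r \<otimes> x [^] k" using xc a by (simp add: b m_assoc)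
    also have "\<dots> = \<sigma> ((\<sigma> ^^ k) r) \<otimes> (x \<otimes> x [^] k)" using xc \<sigma>[OF a] by (simp add: m_assoc)
    finally show ?case using \<sigma>[OF a] nat_pow_Suc2[OF xc, of k] by simp
  qed (use r in auto)
  define F where "F k = (\<sigma> ^^ k) ` P" for k
  have Fmin: "F k \<in> min_primes R" for k
  proof (induction k)
    case (Suc k)
    have "\<sigma> ` F k \<in> min_primes R"
      using ring_iso_Spec(2)[OF ring_axioms ring_axioms iso] Suc by (auto simp: bij_betw_def)
    then show ?case by (simp add: F_def image_comp)
  qed (use P in \<open>simp add: F_def\<close>)
  \<comment> \<open>The images \<open>F k\<close> of \<open>P\<close> are minimal primes, so one of
    them repeats, and with \<open>m = j - i\<close> the prime normalized by \<open>x^m\<close> is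
    \<open>F i\<close>. Passing from \<open>P\<close> to \<open>F i\<close> loses nothing:
    \<open>\<sigma> x = x\<close>, so \<open>x\<close> lies in \<open>F i\<close> once it lies in
    \<open>P\<close>.\<close>
  have "\<not> inj F"
    using Fmin fin finite_subset[of "range F" "min_primes R"] finite_imageD[of F UNIV] by auto
  then obtain i j where "F i = F j" "i < j" unfolding inj_def by (metis nat_neq_iff)
  then obtain m where m: "F (m + i) = F i" "m > 0" by (metis less_imp_add_positive add.commute)
  have PFi: "F i \<subseteq> carrier R" using Fmin[of i] prime_ideal_subset by (auto simp: min_primes_def Spec_def)
  have img: "(\<sigma> ^^ m) ` F i = F i" using m(1) by (simp add: F_def image_comp funpow_add)
  have "x [^] m \<notin> F i"
  proof (rule regular_notin_min_prime_of_normalizing[OF Fmin regular_elem_pow[OF x(1)]])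
    fix r assume "r \<in> carrier R"
    then show "\<exists>r'\<in>carrier R. x [^] m \<otimes> r = r' \<otimes> x [^] m" using pw by blast
  next
    fix z assume z: "z \<in> carrier R - F i"
    \<comment> \<open>Normality alone yields \<open>z'\<close> in the carrier; that it lies outside
      \<open>F i\<close> is then a consequence of \<open>\<sigma>^m (F i) = F i\<close>.\<close>
    have "\<exists>z'\<in>carrier R. z \<otimes> x [^] k = x [^] k \<otimes> z'" for k :: nat
    proof (induction k)
      case (Suc k)
      then obtain z' where z': "z' \<in> carrier R" "z \<otimes> x [^] k = x [^] k \<otimes> z'" by blast
      obtain q where q: "q \<in> carrier R" "z' \<otimes> x = x \<otimes> q" using normal_elemD(3)[OF x(2) z'(1)] by blast
      have "z \<otimes> x [^] Suc k = x [^] k \<otimes> z' \<otimes> x" using z z' xc by (simp add: m_assoc flip: z'(2))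
      also have "\<dots> = x [^] Suc k \<otimes> q" using z' q xc by (simp add: m_assoc)
      finally have "z \<otimes> x [^] Suc k = x [^] Suc k \<otimes> q" .
      then show ?case using q by blast
    qed (use z in auto)
    then obtain z' where z': "z' \<in> carrier R" "z \<otimes> x [^] m = x [^] m \<otimes> z'" by blast
    then have "z = (\<sigma> ^^ m) z'"
      using pw[OF z'(1), of m] z regular_elem_cancel(2)[OF regular_elem_pow[OF x(1), of m], of z "(\<sigma> ^^ m) z'"]
      by simp
    then have "z' \<notin> F i" using z img by blast
    then show "\<exists>z'\<in>carrier R - F i. z \<otimes> x [^] m = x [^] m \<otimes> z'" using z' by blast
  qed
  moreover have "x \<in> F i"
  proof -
    have "\<sigma> x = x" by (rule \<sigma>eq) (use xc in auto)
    then have "(\<sigma> ^^ i) x = x" by (induction i) auto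
    then show ?thesis using xP unfolding F_def by (metis imageI)
  qed
  moreover have "x [^] m \<in> F i" if "x \<in> F i"
  proof -
    interpret ideal "F i" R using Fmin[of i] by (simp add: min_primes_def Spec_def prime_ideal_ideal)
    obtain m' where "m = Suc m'" using m(2) gr0_implies_Suc by blast
    then show ?thesis using that xc by (simp add: I_l_closed)
  qed
  ultimately show False by blast
qed

section \<open>The ring of left fractions\<close>

locale left_denominator_ring = ring R for R (structure) + fixes S
  assumes den: "left_den_set R S"
begin

lemma S_carrier: "s \<in> S \<Longrightarrow> s \<in> carrier R"
  and one_in_S: "\<one> \<in> S"
  and mult_in_S: "\<lbrakk>s \<in> S; t \<in> S\<rbrakk> \<Longrightarrow> s \<otimes> t \<in> S"
  and zero_notin_S: "\<zero> \<notin> S"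
  using den submonoid.mem_carrier[of S R s] submonoid.one_closed[of S R] submonoid.m_closed[of S R s t]
  by (auto simp: left_den_set_def left_Ore_set_def mult_subset_def)

lemma ore:
  assumes "r \<in> carrier R" "s \<in> S"
  obtains u v where "u \<in> S" "v \<in> carrier R" "u \<otimes> r = v \<otimes> s"
proof -
  have "(S #> r) \<inter> (carrier R #> s) \<noteq> {}"
    using assms den by (auto simp: left_den_set_def left_Ore_set_def)
  then show ?thesis using that by (auto simp: r_coset_def)
qed

text \<open>The second denominator condition turns cancellation of \<open>s\<close> on the right
  into equality after a left multiplication. The comparison of multipliers in
  \<open>frac_rel_common\<close> rests on it.\<close>

lemma right_cancel:
  assumes "s \<in> S" "a \<in> carrier R" "b \<in> carrier R" "a \<otimes> s = b \<otimes> s"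
  obtains t where "t \<in> S" "t \<otimes> a = t \<otimes> b"
proof -
  have "(a \<ominus> b) \<otimes> s = \<zero>"
    using assms S_carrier[OF assms(1)] by (simp add: minus_eq l_distr l_minus r_neg)
  moreover have "a \<ominus> b \<in> carrier R" using assms by simp
  ultimately obtain t where t: "t \<in> S" "t \<otimes> (a \<ominus> b) = \<zero>"
    using den assms(1) unfolding left_den_set_def by meson
  have "t \<otimes> a \<ominus> t \<otimes> b = \<zero>"
    using t(2) assms S_carrier[OF t(1)] by (simp add: minus_eq r_distr r_minus)
  then have "t \<otimes> a = t \<otimes> b" 
    by (rule minus_eq_zeroD[rotated 2]) (use assms S_carrier[OF t(1)] in auto)
  then show ?thesis using that t(1) by blast
qed

lemma frac_relI:
  assumes "s \<in> S" "r \<in> carrier R" "s' \<in> S" "r' \<in> carrier R" "u \<in> carrier R" "v \<in> carrier R"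
    and "u \<otimes> s = v \<otimes> s'" "u \<otimes> s \<in> S" "u \<otimes> r = v \<otimes> r'"
  shows "((s, r), (s', r')) \<in> frac_rel S R"
  using assms unfolding frac_rel_def by blast

lemma frac_relE:
  assumes "((s, r), (s', r')) \<in> frac_rel S R"
  obtains u v where "s \<in> S" "r \<in> carrier R" "s' \<in> S" "r' \<in> carrier R"
    "u \<in> carrier R" "v \<in> carrier R" "u \<otimes> s = v \<otimes> s'" "u \<otimes> s \<in> S" "u \<otimes> r = v \<otimes> r'"
  using assms unfolding frac_rel_def by blast

text \<open>No membership in \<open>S\<close> is required of \<open>e\<close>, \<open>f\<close> and \<open>e \<otimes> p\<close>. The product of fractions needs this
  generality to be independent of the choices in its definition.\<close>

lemma frac_rel_common:
  assumes rel: "((p, x), (q, y)) \<in> frac_rel S R"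
    and e: "e \<in> carrier R" and f: "f \<in> carrier R" and ef: "e \<otimes> p = f \<otimes> q"
  obtains t where "t \<in> S" "t \<otimes> e \<otimes> x = t \<otimes> f \<otimes> y"
proof -
  obtain a b where p: "p \<in> S" and x: "x \<in> carrier R" and q: "q \<in> S" and y: "y \<in> carrier R"
    and a: "a \<in> carrier R" and b: "b \<in> carrier R"
    and ab: "a \<otimes> p = b \<otimes> q" "a \<otimes> p \<in> S" "a \<otimes> x = b \<otimes> y"
    using rel by (rule frac_relE)
  note c = S_carrier[OF p] x S_carrier[OF q] y a b e f
  \<comment> \<open>The Ore condition compares \<open>e p\<close> with the denominator
    \<open>a p\<close>, which is known to lie in \<open>S\<close>. Cancelling \<open>p\<close> and
    then \<open>q\<close> on the right replaces \<open>e\<close> and \<open>f\<close> by multiples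
    of \<open>a\<close> and \<open>b\<close>, for which the numerators agree.\<close>
  obtain g h where g: "g \<in> S" and h: "h \<in> carrier R" and gh: "g \<otimes> (e \<otimes> p) = h \<otimes> (a \<otimes> p)"
    using ore[OF m_closed[OF e S_carrier[OF p]] ab(2)] by blast
  note gc = S_carrier[OF g]
  obtain t where t: "t \<in> S" "t \<otimes> (g \<otimes> e) = t \<otimes> (h \<otimes> a)"
    using right_cancel[OF p, of "g \<otimes> e" "h \<otimes> a"] gh c gc h by (auto simp: m_assoc)
  note tc = S_carrier[OF t(1)]
  have "(t \<otimes> (g \<otimes> f)) \<otimes> q = t \<otimes> (g \<otimes> (e \<otimes> p))" using c gc tc by (simp add: m_assoc ef)
  also have "\<dots> = (t \<otimes> (h \<otimes> b)) \<otimes> q" using c h tc by (simp add: gh ab(1) m_assoc)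
  finally obtain t' where t': "t' \<in> S" "t' \<otimes> (t \<otimes> (g \<otimes> f)) = t' \<otimes> (t \<otimes> (h \<otimes> b))"
    using right_cancel[OF q, of "t \<otimes> (g \<otimes> f)" "t \<otimes> (h \<otimes> b)"] c gc h tc by auto
  note tc' = S_carrier[OF t'(1)]
  have "(t' \<otimes> t \<otimes> g) \<otimes> e \<otimes> x = t' \<otimes> (t \<otimes> (g \<otimes> e)) \<otimes> x" using c gc tc tc' by (simp add: m_assoc)
  also have "\<dots> = t' \<otimes> t \<otimes> h \<otimes> (a \<otimes> x)" using c h tc tc' by (simp add: t(2) m_assoc)
  also have "\<dots> = t' \<otimes> (t \<otimes> (h \<otimes> b)) \<otimes> y" using c h tc tc' by (simp add: ab(3) m_assoc)
  also have "\<dots> = t' \<otimes> (t \<otimes> (g \<otimes> f)) \<otimes> y" by (simp only: t'(2))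
  also have "\<dots> = (t' \<otimes> t \<otimes> g) \<otimes> f \<otimes> y" using c gc tc tc' by (simp add: m_assoc)
  finally show ?thesis using that mult_in_S t'(1) t(1) g by blast
qed

lemma equiv_frac_rel: "equiv (S \<times> carrier R) (frac_rel S R)"
proof (rule equivI)
  show "frac_rel S R \<subseteq> (S \<times> carrier R) \<times> (S \<times> carrier R)" by (auto simp: frac_rel_def)
  show "refl_on (S \<times> carrier R) (frac_rel S R)"
    unfolding refl_on_def
    by (auto intro!: frac_relI[of _ _ _ _ \<one> \<one>] simp: S_carrier)
  show "sym (frac_rel S R)"
    unfolding sym_def frac_rel_def by (auto; metis)
  show "trans (frac_rel S R)"
  proof (rule transI)
    fix P Q V assume "(P, Q) \<in> frac_rel S R" "(Q, V) \<in> frac_rel S R"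
    moreover obtain p x q y v z where [simp]: "P = (p, x)" "Q = (q, y)" "V = (v, z)"
      by (cases P; cases Q; cases V) auto
    ultimately have 1: "((p, x), (q, y)) \<in> frac_rel S R" and 2: "((q, y), (v, z)) \<in> frac_rel S R"
      by auto
    obtain a b where pq: "p \<in> S" "x \<in> carrier R" "q \<in> S" "y \<in> carrier R" "a \<in> carrier R"
      "b \<in> carrier R" and ab: "a \<otimes> p = b \<otimes> q" "a \<otimes> p \<in> S" "a \<otimes> x = b \<otimes> y"
      using 1 by (rule frac_relE)
    obtain c d where cd: "v \<in> S" "z \<in> carrier R" "c \<in> carrier R" "d \<in> carrier R"
      "c \<otimes> q = d \<otimes> v" "c \<otimes> q \<in> S" "c \<otimes> y = d \<otimes> z"
      using 2 by (rule frac_relE)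
    \<comment> \<open>The denominator \<open>b q\<close> of the first expansion is compared with
      \<open>v\<close> directly. The numerators then agree by \<open>frac_rel_common\<close> with
      multipliers \<open>e b\<close> and \<open>f\<close>, neither of which has to lie in
      \<open>S\<close>.\<close>
    obtain e f where ef: "e \<in> S" "f \<in> carrier R" "e \<otimes> (b \<otimes> q) = f \<otimes> v"
      using ore[of "b \<otimes> q" v] pq cd S_carrier by auto
    note k = S_carrier[OF pq(1)] S_carrier[OF pq(3)] S_carrier[OF cd(1)] S_carrier[OF ef(1)]
    obtain t where t: "t \<in> S" "t \<otimes> (e \<otimes> b) \<otimes> y = t \<otimes> f \<otimes> z"
      using frac_rel_common[OF 2, of "e \<otimes> b" f] ef pq cd k by (auto simp: m_assoc)
    note tc = S_carrier[OF t(1)]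
    have "((p, x), (v, z)) \<in> frac_rel S R"
    proof (rule frac_relI[of _ _ _ _ "t \<otimes> e \<otimes> a" "t \<otimes> f"])
      have "t \<otimes> e \<otimes> a \<otimes> p = t \<otimes> e \<otimes> (a \<otimes> p)" using k tc pq by (simp add: m_assoc)
      then show "t \<otimes> e \<otimes> a \<otimes> p \<in> S" using mult_in_S t(1) ef(1) ab(2) by simp
      show "t \<otimes> e \<otimes> a \<otimes> p = t \<otimes> f \<otimes> v" using k tc pq cd ef ab by (simp add: m_assoc)
      have "t \<otimes> e \<otimes> a \<otimes> x = t \<otimes> (e \<otimes> b) \<otimes> y" using k tc pq cd ef ab by (simp add: m_assoc)
      then show "t \<otimes> e \<otimes> a \<otimes> x = t \<otimes> f \<otimes> z" using t(2) by simp
    qed (use pq cd k ef tc in auto)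
    then show "(P, V) \<in> frac_rel S R" by simp
  qed
qed

section \<open>Arithmetic of fractions and the ring laws\<close>

abbreviation fr where "fr \<equiv> frac S R"
abbreviation L where "L \<equiv> Loc S R"

lemma fr_eq_iff:
  assumes "s \<in> S" "r \<in> carrier R" "s' \<in> S" "r' \<in> carrier R"
  shows "fr s r = fr s' r' \<longleftrightarrow> ((s, r), (s', r')) \<in> frac_rel S R"
  unfolding frac_def using eq_equiv_class_iff[OF equiv_frac_rel] assms by auto

lemma fr_expand:
  assumes "s \<in> S" "r \<in> carrier R" "u \<in> carrier R" "u \<otimes> s \<in> S"
  shows "fr (u \<otimes> s) (u \<otimes> r) = fr s r"
  using assms S_carrier by (subst fr_eq_iff) (auto intro!: frac_relI[of _ _ _ _ \<one> u])

lemma fr_eqI: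
  assumes "s \<in> S" "r \<in> carrier R" "s' \<in> S" "r' \<in> carrier R" "u \<in> carrier R" "v \<in> carrier R"
    and "u \<otimes> s = v \<otimes> s'" "u \<otimes> s \<in> S" "u \<otimes> r = v \<otimes> r'"
  shows "fr s r = fr s' r'"
  using frac_relI[OF assms] fr_eq_iff[OF assms(1-4)] by simp

lemma fr_eq_common:
  assumes "s \<in> S" "r \<in> carrier R" "s' \<in> S" "r' \<in> carrier R" "fr s r = fr s' r'"
    and "e \<in> carrier R" "f \<in> carrier R" "e \<otimes> s = f \<otimes> s'"
  obtains t where "t \<in> S" "t \<otimes> e \<otimes> r = t \<otimes> f \<otimes> r'"
proof -
  have "((s, r), (s', r')) \<in> frac_rel S R" using fr_eq_iff[OF assms(1-4)] assms(5) by simp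
  then show ?thesis by (rule frac_rel_common[OF _ assms(6-8)]) (rule that)
qed

lemma fr_self: "\<lbrakk>s \<in> S; r \<in> carrier R\<rbrakk> \<Longrightarrow> (s, r) \<in> fr s r"
  unfolding frac_def using equiv_class_self[OF equiv_frac_rel] by auto

lemma in_frD:
  assumes "(s', r') \<in> fr s r" "s \<in> S" "r \<in> carrier R"
  shows "s' \<in> S" "r' \<in> carrier R" "fr s' r' = fr s r"
proof -
  have *: "((s, r), (s', r')) \<in> frac_rel S R" using assms by (simp add: frac_def)
  show "s' \<in> S" "r' \<in> carrier R" using * by (auto simp: frac_rel_def)
  then show "fr s' r' = fr s r" using * assms fr_eq_iff by metis
qed

lemma L_carrier: "carrier L = {fr s r | s r. s \<in> S \<and> r \<in> carrier R}"
  by (auto simp: Loc_def quotient_def frac_def)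

lemma fr_closed: "\<lbrakk>s \<in> S; r \<in> carrier R\<rbrakk> \<Longrightarrow> fr s r \<in> carrier L"
  by (auto simp: L_carrier)

lemma L_cases:
  assumes "X \<in> carrier L" obtains s r where "s \<in> S" "r \<in> carrier R" "X = fr s r"
  using assms by (auto simp: L_carrier)

text \<open>\<open>loc_add\<close> is a union over all representatives and all common denominators.
  By \<open>key\<close> every choice yields one and the same class, so the union is that class, and
  sums may be computed with any convenient choice.\<close>

lemma fr_add_general:
  assumes s: "s \<in> S" and r: "r \<in> carrier R" and s': "s' \<in> S" and r': "r' \<in> carrier R"
    and u: "u \<in> carrier R" and v: "v \<in> carrier R" and uv: "u \<otimes> s = v \<otimes> s'" "u \<otimes> s \<in> S"
  shows "fr s r \<oplus>\<^bsub>L\<^esub> fr s' r' = fr (u \<otimes> s) (u \<otimes> r \<oplus> v \<otimes> r')"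
proof -
  note c = S_carrier[OF s] r S_carrier[OF s'] r' u v
  have key: "fr (a \<otimes> p) (a \<otimes> x \<oplus> b \<otimes> x') = fr (u \<otimes> s) (u \<otimes> r \<oplus> v \<otimes> r')"
    if px: "(p, x) \<in> fr s r" and px': "(p', x') \<in> fr s' r'"
      and a: "a \<in> carrier R" and b: "b \<in> carrier R" and ab: "a \<otimes> p = b \<otimes> p'" "a \<otimes> p \<in> S"
    for p x p' x' a b
  proof -
    note P = in_frD[OF px s r] note P' = in_frD[OF px' s' r']
    note k = c a b S_carrier[OF P(1)] P(2) S_carrier[OF P'(1)] P'(2)
    define w where "w = a \<otimes> p" define z where "z = u \<otimes> s"
    have w: "w \<in> S" "w \<in> carrier R" and z: "z \<in> S" "z \<in> carrier R"
      using ab uv S_carrier by (auto simp: w_def z_def)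
    have "fr w (a \<otimes> x) = fr z (u \<otimes> r)"
      unfolding w_def z_def using fr_expand[of p x a] fr_expand[of s r u] P s r a u ab uv by simp
    moreover have "fr w (b \<otimes> x') = fr z (v \<otimes> r')"
      unfolding w_def z_def using fr_expand[of p' x' b] fr_expand[of s' r' v] P' s' r' b v ab uv by simp
    moreover obtain e f where ef: "e \<in> S" "f \<in> carrier R" "e \<otimes> w = f \<otimes> z"
      using ore[OF w(2) z(1)] by blast
    ultimately obtain t t' where t: "t \<in> S" "t \<otimes> e \<otimes> (a \<otimes> x) = t \<otimes> f \<otimes> (u \<otimes> r)"
      and t': "t' \<in> S" "t' \<otimes> e \<otimes> (b \<otimes> x') = t' \<otimes> f \<otimes> (v \<otimes> r')"
      using fr_eq_common[OF w(1) _ z(1), of "a \<otimes> x" "u \<otimes> r" e f]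
        fr_eq_common[OF w(1) _ z(1), of "b \<otimes> x'" "v \<otimes> r'" e f] k S_carrier[OF ef(1)]
      by (smt (verit, ccfv_SIG) m_closed)
    note k = k S_carrier[OF ef(1)] S_carrier[OF t(1)] S_carrier[OF t'(1)] ef(2) w(2) z(2)
    \<comment> \<open>The two summands agree after different left multipliers \<open>t\<close> and
      \<open>t'\<close>; a common left multiple \<open>g t = h t'\<close> serves both.\<close>
    obtain g h where gh: "g \<in> S" "h \<in> carrier R" "g \<otimes> t = h \<otimes> t'"
      using ore[OF S_carrier[OF t(1)] t'(1)] by blast
    note k = k S_carrier[OF gh(1)] gh(2)
    have "fr w (a \<otimes> x \<oplus> b \<otimes> x') = fr z (u \<otimes> r \<oplus> v \<otimes> r')"
    proof (rule fr_eqI[of _ _ _ _ "g \<otimes> t \<otimes> e" "g \<otimes> t \<otimes> f"])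
      show "g \<otimes> t \<otimes> e \<otimes> w \<in> S" using gh t ef w mult_in_S by blast
      show "g \<otimes> t \<otimes> e \<otimes> w = g \<otimes> t \<otimes> f \<otimes> z" using k by (simp add: m_assoc ef(3))
      have "g \<otimes> t \<otimes> e \<otimes> (a \<otimes> x) = g \<otimes> (t \<otimes> e \<otimes> (a \<otimes> x))" using k by (simp add: m_assoc)
      also have "\<dots> = g \<otimes> t \<otimes> f \<otimes> (u \<otimes> r)" unfolding t(2) using k by (simp add: m_assoc)
      finally have 1: "g \<otimes> t \<otimes> e \<otimes> (a \<otimes> x) = g \<otimes> t \<otimes> f \<otimes> (u \<otimes> r)" .
      have "g \<otimes> t \<otimes> e \<otimes> (b \<otimes> x') = h \<otimes> (t' \<otimes> e \<otimes> (b \<otimes> x'))" unfolding gh(3) using k by (simp add: m_assoc)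
      also have "\<dots> = g \<otimes> t \<otimes> f \<otimes> (v \<otimes> r')" unfolding t'(2) gh(3) using k by (simp add: m_assoc)
      finally show "g \<otimes> t \<otimes> e \<otimes> (a \<otimes> x \<oplus> b \<otimes> x') = g \<otimes> t \<otimes> f \<otimes> (u \<otimes> r \<oplus> v \<otimes> r')"
        using 1 k by (simp add: r_distr)
    qed (use w z k in auto)
    then show ?thesis by (simp add: w_def z_def)
  qed
  have "fr s r \<oplus>\<^bsub>L\<^esub> fr s' r' = loc_add S R (fr s r) (fr s' r')" by (simp add: Loc_def)
  also have "\<dots> = fr (u \<otimes> s) (u \<otimes> r \<oplus> v \<otimes> r')"
  proof (intro subset_antisym subsetI)
    fix Z assume "Z \<in> loc_add S R (fr s r) (fr s' r')"
    then show "Z \<in> fr (u \<otimes> s) (u \<otimes> r \<oplus> v \<otimes> r')" using key unfolding loc_add_def by blast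
  next
    fix Z assume Z: "Z \<in> fr (u \<otimes> s) (u \<otimes> r \<oplus> v \<otimes> r')"
    show "Z \<in> loc_add S R (fr s r) (fr s' r')"
      unfolding loc_add_def
      by (rule UN_I[OF fr_self[OF s r]], clarify, rule UN_I[OF fr_self[OF s' r']], clarify,
          rule UN_I[of "(u, v)"]) (use Z u v uv in auto)
  qed
  finally show ?thesis .
qed

text \<open>The scheme is that for sums, but choices are compared in two stages: equality of the
  first factors yields multipliers that equate the second denominators, and these feed the
  comparison of the second factors.\<close>

lemma fr_mult_general:
  assumes s: "s \<in> S" and r: "r \<in> carrier R" and s': "s' \<in> S" and r': "r' \<in> carrier R"
    and u: "u \<in> S" and v: "v \<in> carrier R" and uv: "u \<otimes> r = v \<otimes> s'"
  shows "fr s r \<otimes>\<^bsub>L\<^esub> fr s' r' = fr (u \<otimes> s) (v \<otimes> r')"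
proof -
  note c = S_carrier[OF s] r S_carrier[OF s'] r' S_carrier[OF u] v
  have key: "fr (a \<otimes> p) (b \<otimes> x') = fr (u \<otimes> s) (v \<otimes> r')"
    if px: "(p, x) \<in> fr s r" and px': "(p', x') \<in> fr s' r'"
      and a: "a \<in> S" and b: "b \<in> carrier R" and ab: "a \<otimes> x = b \<otimes> p'"
    for p x p' x' a b
  proof -
    note P = in_frD[OF px s r] note P' = in_frD[OF px' s' r']
    note k = c S_carrier[OF a] b S_carrier[OF P(1)] P(2) S_carrier[OF P'(1)] P'(2)
    define w where "w = a \<otimes> p" define z where "z = u \<otimes> s"
    have w: "w \<in> S" "w \<in> carrier R" and z: "z \<in> S" "z \<in> carrier R"
      using mult_in_S a u P s S_carrier by (auto simp: w_def z_def)
    have "fr w (a \<otimes> x) = fr z (u \<otimes> r)"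
      unfolding w_def z_def using fr_expand[of p x a] fr_expand[of s r u] P s r k mult_in_S a u by simp
    moreover obtain e f where ef: "e \<in> S" "f \<in> carrier R" "e \<otimes> w = f \<otimes> z"
      using ore[OF w(2) z(1)] by blast
    ultimately obtain t where t: "t \<in> S" "t \<otimes> e \<otimes> (a \<otimes> x) = t \<otimes> f \<otimes> (u \<otimes> r)"
      using fr_eq_common[OF w(1) _ z(1), of "a \<otimes> x" "u \<otimes> r" e f] k S_carrier[OF ef(1)] by auto
    note k = k S_carrier[OF ef(1)] S_carrier[OF t(1)] ef(2) w(2) z(2)
    \<comment> \<open>The multipliers \<open>t e b\<close> and \<open>t f v\<close> are arbitrary
      ring elements. They match \<open>p'\<close> and \<open>s'\<close> because
      \<open>a x = b p'\<close> and \<open>u r = v s'\<close> carry the agreement of the first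
      numerators over.\<close>
    have "(t \<otimes> e \<otimes> b) \<otimes> p' = t \<otimes> e \<otimes> (a \<otimes> x)" using k by (simp add: ab m_assoc)
    also have "\<dots> = (t \<otimes> f \<otimes> v) \<otimes> s'" unfolding t(2) using k by (simp add: uv m_assoc)
    finally have "(t \<otimes> e \<otimes> b) \<otimes> p' = (t \<otimes> f \<otimes> v) \<otimes> s'" .
    then obtain t' where t': "t' \<in> S" "t' \<otimes> (t \<otimes> e \<otimes> b) \<otimes> x' = t' \<otimes> (t \<otimes> f \<otimes> v) \<otimes> r'"
      using fr_eq_common[OF P'(1,2) s' r' P'(3), of "t \<otimes> e \<otimes> b" "t \<otimes> f \<otimes> v"] k by auto
    note k = k S_carrier[OF t'(1)]
    have "fr w (b \<otimes> x') = fr z (v \<otimes> r')"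
    proof (rule fr_eqI[of _ _ _ _ "t' \<otimes> t \<otimes> e" "t' \<otimes> t \<otimes> f"])
      show "t' \<otimes> t \<otimes> e \<otimes> w \<in> S" using t' t ef w mult_in_S by blast
      show "t' \<otimes> t \<otimes> e \<otimes> w = t' \<otimes> t \<otimes> f \<otimes> z" using k by (simp add: m_assoc ef(3))
      show "t' \<otimes> t \<otimes> e \<otimes> (b \<otimes> x') = t' \<otimes> t \<otimes> f \<otimes> (v \<otimes> r')" using t'(2) k by (simp add: m_assoc)
    qed (use w z k in auto)
    then show ?thesis by (simp add: w_def z_def)
  qed
  have "fr s r \<otimes>\<^bsub>L\<^esub> fr s' r' = loc_mult S R (fr s r) (fr s' r')" by (simp add: Loc_def)
  also have "\<dots> = fr (u \<otimes> s) (v \<otimes> r')"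
  proof (intro subset_antisym subsetI)
    fix Z assume "Z \<in> loc_mult S R (fr s r) (fr s' r')"
    then show "Z \<in> fr (u \<otimes> s) (v \<otimes> r')" using key unfolding loc_mult_def by blast
  next
    fix Z assume Z: "Z \<in> fr (u \<otimes> s) (v \<otimes> r')"
    show "Z \<in> loc_mult S R (fr s r) (fr s' r')"
      unfolding loc_mult_def
      by (rule UN_I[OF fr_self[OF s r]], clarify, rule UN_I[OF fr_self[OF s' r']], clarify,
          rule UN_I[of "(u, v)"]) (use Z u v uv in auto)
  qed
  finally show ?thesis .
qed

lemma fr_add:
  "\<lbrakk>s \<in> S; r \<in> carrier R; r' \<in> carrier R\<rbrakk> \<Longrightarrow> fr s r \<oplus>\<^bsub>L\<^esub> fr s r' = fr s (r \<oplus> r')"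
  using fr_add_general[of s r s r' \<one> \<one>] S_carrier by simp

lemma fr_mult:
  "\<lbrakk>s \<in> S; w \<in> carrier R; s' \<in> S; r \<in> carrier R\<rbrakk> \<Longrightarrow> fr s (w \<otimes> s') \<otimes>\<^bsub>L\<^esub> fr s' r = fr s (w \<otimes> r)"
  using fr_mult_general[of s "w \<otimes> s'" s' r \<one> w] S_carrier one_in_S by simp

lemma one_L: "\<one>\<^bsub>L\<^esub> = fr \<one> \<one>" and zero_L: "\<zero>\<^bsub>L\<^esub> = fr \<one> \<zero>"
  by (simp_all add: Loc_def)

lemma fr_self_one: "s \<in> S \<Longrightarrow> fr s s = \<one>\<^bsub>L\<^esub>"
  using fr_expand[of \<one> \<one> s] S_carrier one_in_S by (simp add: one_L)

lemma fr_zero: "s \<in> S \<Longrightarrow> fr s \<zero> = \<zero>\<^bsub>L\<^esub>"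
  using fr_expand[of \<one> \<zero> s] S_carrier one_in_S by (simp add: zero_L)

lemma L_common:
  assumes "X \<in> carrier L" "Y \<in> carrier L"
  obtains s r r' where "s \<in> S" "r \<in> carrier R" "r' \<in> carrier R" "X = fr s r" "Y = fr s r'"
proof -
  obtain s r s' r' where X: "s \<in> S" "r \<in> carrier R" "X = fr s r"
    and Y: "s' \<in> S" "r' \<in> carrier R" "Y = fr s' r'" using assms by (metis L_cases)
  obtain u v where uv: "u \<in> S" "v \<in> carrier R" "u \<otimes> s = v \<otimes> s'"
    using ore[OF S_carrier[OF X(1)] Y(1)] by blast
  show ?thesis
  proof (rule that[of "u \<otimes> s" "u \<otimes> r" "v \<otimes> r'"])
    show us: "u \<otimes> s \<in> S" using uv X mult_in_S by blast
    show "X = fr (u \<otimes> s) (u \<otimes> r)"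
      unfolding X(3) by (rule fr_expand[OF X(1,2) S_carrier[OF uv(1)] us, symmetric])
    show "Y = fr (u \<otimes> s) (v \<otimes> r')" using fr_expand[of s' r' v] Y uv us by simp
  qed (use X Y uv S_carrier in auto)
qed

lemma L_common3:
  assumes "X \<in> carrier L" "Y \<in> carrier L" "Z \<in> carrier L"
  obtains s r r' r'' where "s \<in> S" "r \<in> carrier R" "r' \<in> carrier R" "r'' \<in> carrier R"
    "X = fr s r" "Y = fr s r'" "Z = fr s r''"
proof -
  obtain s r r' where X: "s \<in> S" "r \<in> carrier R" "r' \<in> carrier R" "X = fr s r" "Y = fr s r'"
    using L_common[OF assms(1,2)] .
  obtain z q where Z: "z \<in> S" "q \<in> carrier R" "Z = fr z q" using L_cases[OF assms(3)] .
  obtain u v where uv: "u \<in> S" "v \<in> carrier R" "u \<otimes> s = v \<otimes> z"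
    using ore[OF S_carrier[OF X(1)] Z(1)] by blast
  show ?thesis
  proof (rule that[of "u \<otimes> s" "u \<otimes> r" "u \<otimes> r'" "v \<otimes> q"])
    show us: "u \<otimes> s \<in> S" using uv X mult_in_S by blast
    show "X = fr (u \<otimes> s) (u \<otimes> r)" "Y = fr (u \<otimes> s) (u \<otimes> r')"
      unfolding X(4,5) using fr_expand[OF X(1) _ S_carrier[OF uv(1)] us] X(2,3) by auto
    show "Z = fr (u \<otimes> s) (v \<otimes> q)" using fr_expand[of z q v] Z uv us by simp
  qed (use X Z uv S_carrier in auto)
qed

text \<open>Every fraction can be written with a numerator that is a left multiple of a prescribed
  denominator, which makes products computable by the rule \<open>fr_mult\<close>.\<close>

lemma L_adapted:
  assumes "X \<in> carrier L" "s' \<in> S"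
  obtains s w where "s \<in> S" "w \<in> carrier R" "X = fr s (w \<otimes> s')"
proof -
  obtain s r where X: "s \<in> S" "r \<in> carrier R" "X = fr s r" using L_cases[OF assms(1)] .
  obtain u v where uv: "u \<in> S" "v \<in> carrier R" "u \<otimes> r = v \<otimes> s'"
    using ore[OF X(2) assms(2)] .
  show ?thesis
    using that[of "u \<otimes> s" v] fr_expand[of s r u] X uv mult_in_S S_carrier by auto
qed

text \<open>Each law is reduced to the same law in \<open>R\<close>: sums are put over a common
  denominator, and in a product each factor is rewritten to end in the denominator of its right
  neighbour, starting from the right.\<close>

lemma ring_L: "ring L"
proof (rule ringI)
  show "abelian_group L"
  proof (rule abelian_groupI)
    fix X Y assume XY: "X \<in> carrier L" "Y \<in> carrier L"
    show "X \<oplus>\<^bsub>L\<^esub> Y \<in> carrier L"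
      using L_common[OF XY] by (metis a_closed fr_add fr_closed)
    show "X \<oplus>\<^bsub>L\<^esub> Y = Y \<oplus>\<^bsub>L\<^esub> X"
      using L_common[OF XY] by (metis a_comm fr_add)
    fix Z assume Z: "Z \<in> carrier L"
    show "X \<oplus>\<^bsub>L\<^esub> Y \<oplus>\<^bsub>L\<^esub> Z = X \<oplus>\<^bsub>L\<^esub> (Y \<oplus>\<^bsub>L\<^esub> Z)"
      using L_common3[OF XY Z] by (smt (verit, best) a_assoc a_closed fr_add)
  next
    show "\<zero>\<^bsub>L\<^esub> \<in> carrier L" using fr_closed one_in_S by (simp add: zero_L)
    fix X assume X: "X \<in> carrier L"
    then obtain s r where "s \<in> S" "r \<in> carrier R" "X = fr s r" using L_cases by blast
    then show "\<zero>\<^bsub>L\<^esub> \<oplus>\<^bsub>L\<^esub> X = X" "\<exists>Y\<in>carrier L. Y \<oplus>\<^bsub>L\<^esub> X = \<zero>\<^bsub>L\<^esub>"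
      using fr_add[of s \<zero> r] fr_add[of s "\<ominus> r" r] fr_closed[of s "\<ominus> r"]
      by (auto simp: fr_zero l_neg)
  qed
  show "Group.monoid L"
  proof (rule monoidI)
    fix X Y assume X: "X \<in> carrier L" and Y: "Y \<in> carrier L"
    obtain s' r' where Y': "s' \<in> S" "r' \<in> carrier R" "Y = fr s' r'" using L_cases[OF Y] .
    obtain s w where X': "s \<in> S" "w \<in> carrier R" "X = fr s (w \<otimes> s')" using L_adapted[OF X Y'(1)] .
    show "X \<otimes>\<^bsub>L\<^esub> Y \<in> carrier L" using X' Y' fr_mult fr_closed by simp
    fix Z assume Z: "Z \<in> carrier L"
    obtain p x where Z': "p \<in> S" "x \<in> carrier R" "Z = fr p x" using L_cases[OF Z] .
    obtain s' v where Y': "s' \<in> S" "v \<in> carrier R" "Y = fr s' (v \<otimes> p)" using L_adapted[OF Y Z'(1)] .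
    obtain s w where X': "s \<in> S" "w \<in> carrier R" "X = fr s (w \<otimes> s')" using L_adapted[OF X Y'(1)] .
    have "X \<otimes>\<^bsub>L\<^esub> Y \<otimes>\<^bsub>L\<^esub> Z = fr s (w \<otimes> v \<otimes> p) \<otimes>\<^bsub>L\<^esub> Z"
      using X' Y' Z' fr_mult S_carrier by (simp add: m_assoc)
    also have "\<dots> = fr s (w \<otimes> v \<otimes> x)" using X' Y' Z' fr_mult by simp
    finally show "X \<otimes>\<^bsub>L\<^esub> Y \<otimes>\<^bsub>L\<^esub> Z = X \<otimes>\<^bsub>L\<^esub> (Y \<otimes>\<^bsub>L\<^esub> Z)"
      using X' Y' Z' fr_mult by (simp add: m_assoc)
  next
    show "\<one>\<^bsub>L\<^esub> \<in> carrier L" using fr_closed one_in_S by (simp add: one_L)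
    fix X assume X: "X \<in> carrier L"
    then obtain s r where sr: "s \<in> S" "r \<in> carrier R" "X = fr s r" using L_cases by blast
    show "\<one>\<^bsub>L\<^esub> \<otimes>\<^bsub>L\<^esub> X = X"
      using sr fr_mult[of s \<one> s r] fr_self_one[of s] S_carrier by simp
    show "X \<otimes>\<^bsub>L\<^esub> \<one>\<^bsub>L\<^esub> = X"
      using sr fr_mult[of s r \<one> \<one>] one_in_S by (simp add: one_L)
  qed
  fix X Y Z assume X: "X \<in> carrier L" and Y: "Y \<in> carrier L" and Z: "Z \<in> carrier L"
  show "(X \<oplus>\<^bsub>L\<^esub> Y) \<otimes>\<^bsub>L\<^esub> Z = X \<otimes>\<^bsub>L\<^esub> Z \<oplus>\<^bsub>L\<^esub> Y \<otimes>\<^bsub>L\<^esub> Z"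
  proof -
    obtain p x where Z': "p \<in> S" "x \<in> carrier R" "Z = fr p x" using L_cases[OF Z] .
    obtain s w where X': "s \<in> S" "w \<in> carrier R" "X = fr s (w \<otimes> p)" using L_adapted[OF X Z'(1)] .
    obtain s' w' where Y': "s' \<in> S" "w' \<in> carrier R" "Y = fr s' (w' \<otimes> p)" using L_adapted[OF Y Z'(1)] .
    \<comment> \<open>Both numerators must still end in \<open>p\<close> once they share a
      denominator. They are therefore adapted to \<open>Z\<close> first and expanded afterwards,
      since expansion only multiplies on the left.\<close>
    obtain u v where uv: "u \<in> S" "v \<in> carrier R" "u \<otimes> s = v \<otimes> s'" using ore[OF S_carrier[OF X'(1)] Y'(1)] .
    have us: "u \<otimes> s \<in> S" using uv X' mult_in_S by blast
    note k = S_carrier[OF Z'(1)] S_carrier[OF uv(1)]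
    have X2: "X = fr (u \<otimes> s) (u \<otimes> w \<otimes> p)"
      using fr_expand[of s "w \<otimes> p" u] X' uv us k by (simp add: m_assoc)
    have Y2: "Y = fr (u \<otimes> s) (v \<otimes> w' \<otimes> p)"
      using fr_expand[of s' "w' \<otimes> p" v] Y' uv us k by (simp add: m_assoc)
    have "X \<oplus>\<^bsub>L\<^esub> Y = fr (u \<otimes> s) ((u \<otimes> w \<oplus> v \<otimes> w') \<otimes> p)"
      unfolding X2 Y2 using fr_add us X' Y' uv k by (simp add: l_distr)
    then have "(X \<oplus>\<^bsub>L\<^esub> Y) \<otimes>\<^bsub>L\<^esub> Z = fr (u \<otimes> s) ((u \<otimes> w \<oplus> v \<otimes> w') \<otimes> x)"
      using fr_mult us X' Y' uv Z' k by simp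
    also have "\<dots> = fr (u \<otimes> s) (u \<otimes> w \<otimes> x) \<oplus>\<^bsub>L\<^esub> fr (u \<otimes> s) (v \<otimes> w' \<otimes> x)"
      using fr_add us X' Y' uv Z' k by (simp add: l_distr)
    also have "\<dots> = X \<otimes>\<^bsub>L\<^esub> Z \<oplus>\<^bsub>L\<^esub> Y \<otimes>\<^bsub>L\<^esub> Z"
      unfolding X2 Y2 using fr_mult us X' Y' uv Z' k by simp
    finally show ?thesis .
  qed
  show "Z \<otimes>\<^bsub>L\<^esub> (X \<oplus>\<^bsub>L\<^esub> Y) = Z \<otimes>\<^bsub>L\<^esub> X \<oplus>\<^bsub>L\<^esub> Z \<otimes>\<^bsub>L\<^esub> Y"
  proof -
    obtain p x y where XY: "p \<in> S" "x \<in> carrier R" "y \<in> carrier R" "X = fr p x" "Y = fr p y"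
      using L_common[OF X Y] .
    obtain s w where Z': "s \<in> S" "w \<in> carrier R" "Z = fr s (w \<otimes> p)" using L_adapted[OF Z XY(1)] .
    show ?thesis using XY Z' by (simp add: fr_add fr_mult r_distr)
  qed
qed

lemma fr_one_closed: "r \<in> carrier R \<Longrightarrow> fr \<one> r \<in> carrier L"
  using fr_closed one_in_S by blast

lemma loc_map_hom: "ring_hom_ring R L (loc_map S R)"
proof (rule ring_hom_ringI2[OF ring_axioms ring_L], rule ring_hom_memI)
  fix x y assume x: "x \<in> carrier R" and y: "y \<in> carrier R"
  show "loc_map S R x \<in> carrier L" using x fr_one_closed by (simp add: loc_map_def)
  show "loc_map S R (x \<otimes> y) = loc_map S R x \<otimes>\<^bsub>L\<^esub> loc_map S R y"
    using fr_mult[of \<one> x \<one> y] x y one_in_S by (simp add: loc_map_def)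
  show "loc_map S R (x \<oplus> y) = loc_map S R x \<oplus>\<^bsub>L\<^esub> loc_map S R y"
    using fr_add[of \<one> x y] x y one_in_S by (simp add: loc_map_def)
qed (simp add: loc_map_def one_L)

lemma fr_eq_zero_iff:
  assumes s: "s \<in> S" and r: "r \<in> carrier R"
  shows "fr s r = \<zero>\<^bsub>L\<^esub> \<longleftrightarrow> r \<in> ass R S"
proof
  assume "fr s r = \<zero>\<^bsub>L\<^esub>"
  then have "fr s r = fr s \<zero>" using s by (simp add: fr_zero)
  then obtain t where "t \<in> S" "t \<otimes> \<one> \<otimes> r = t \<otimes> \<one> \<otimes> \<zero>"
    using fr_eq_common[OF s r s zero_closed, of \<one> \<one>] by auto
  then show "r \<in> ass R S" using r S_carrier by (auto simp: ass_def)
next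
  assume "r \<in> ass R S"
  then obtain t where t: "t \<in> S" "t \<otimes> r = \<zero>" by (auto simp: ass_def)
  have "fr s r = fr (t \<otimes> s) \<zero>" using fr_expand[of s r t] t s r mult_in_S S_carrier by simp
  then show "fr s r = \<zero>\<^bsub>L\<^esub>" using fr_zero mult_in_S t s by simp
qed

end

lemma left_denominator_ringI: "\<lbrakk>ring R; left_den_set R S\<rbrakk> \<Longrightarrow> left_denominator_ring R S"
  by (simp add: left_denominator_ring_def left_denominator_ring_axioms_def)

section \<open>Functoriality of localization\<close>

locale loc_hom = Q: left_denominator_ring Q T + Q': left_denominator_ring Q' T'
  for Q :: "('a, 'c) ring_scheme" and T and Q' :: "('b, 'd) ring_scheme" and T' +
  fixes f
  assumes f: "f \<in> ring_hom Q Q'" and fT: "f ` T \<subseteq> T'"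
begin

sublocale f: ring_hom_ring Q Q' f
  by (rule ring_hom_ringI2[OF Q.ring_axioms Q'.ring_axioms f])

lemma f_T: "s \<in> T \<Longrightarrow> f s \<in> T'"
  using fT by blast

abbreviation F where "F \<equiv> loc_lift T' Q' f"

text \<open>\<open>the_elem\<close> returns the intended value because the image of the class is a
  singleton: \<open>f\<close> carries a common expansion of two pairs to a common expansion of their
  images.\<close>

lemma F_fr:
  assumes s: "s \<in> T" and r: "r \<in> carrier Q"
  shows "F (Q.fr s r) = Q'.fr (f s) (f r)"
proof -
  have *: "Q'.fr (f s') (f r') = Q'.fr (f s) (f r)" if "(s', r') \<in> Q.fr s r" for s' r'
  proof -
    have "((s, r), (s', r')) \<in> frac_rel T Q" using that by (simp add: frac_def)
    then obtain u v where uv: "s' \<in> T" "r' \<in> carrier Q" "u \<in> carrier Q" "v \<in> carrier Q"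
      "u \<otimes>\<^bsub>Q\<^esub> s = v \<otimes>\<^bsub>Q\<^esub> s'" "u \<otimes>\<^bsub>Q\<^esub> s \<in> T" "u \<otimes>\<^bsub>Q\<^esub> r = v \<otimes>\<^bsub>Q\<^esub> r'"
      by (rule Q.frac_relE)
    note k = Q.S_carrier[OF s] Q.S_carrier[OF uv(1)]
    have "f u \<otimes>\<^bsub>Q'\<^esub> f s = f v \<otimes>\<^bsub>Q'\<^esub> f s'" "f u \<otimes>\<^bsub>Q'\<^esub> f r = f v \<otimes>\<^bsub>Q'\<^esub> f r'" "f u \<otimes>\<^bsub>Q'\<^esub> f s \<in> T'"
      using uv k r fT by (auto simp flip: f.hom_mult)
    then have "Q'.fr (f s) (f r) = Q'.fr (f s') (f r')"
      by (intro Q'.fr_eqI[of _ _ _ _ "f u" "f v"]) (use s r uv fT k in auto)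
    then show ?thesis by simp
  qed
  have "(\<lambda>(s, r). Q'.fr (f s) (f r)) ` Q.fr s r = {Q'.fr (f s) (f r)}"
  proof (intro subset_antisym subsetI)
    fix Z assume "Z \<in> (\<lambda>(s, r). Q'.fr (f s) (f r)) ` Q.fr s r"
    then obtain s' r' where "(s', r') \<in> Q.fr s r" "Z = Q'.fr (f s') (f r')"
      by (metis (mono_tags, lifting) imageE old.prod.case surj_pair)
    then show "Z \<in> {Q'.fr (f s) (f r)}" using * by simp
  next
    fix Z assume "Z \<in> {Q'.fr (f s) (f r)}"
    then show "Z \<in> (\<lambda>(s, r). Q'.fr (f s) (f r)) ` Q.fr s r"
      by (intro image_eqI[OF _ Q.fr_self[OF s r]]) (simp only: singleton_iff prod.case)
  qed
  then show ?thesis by (simp add: loc_lift_def)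
qed

lemma F_hom: "ring_hom_ring Q.L Q'.L F"
proof (rule ring_hom_ringI2[OF Q.ring_L Q'.ring_L], rule ring_hom_memI)
  fix X Y assume X: "X \<in> carrier Q.L" and Y: "Y \<in> carrier Q.L"
  obtain p x y where XY: "p \<in> T" "x \<in> carrier Q" "y \<in> carrier Q" "X = Q.fr p x" "Y = Q.fr p y"
    using Q.L_common[OF X Y] .
  have fp: "f p \<in> T'" using XY(1) fT by auto
  show "F X \<in> carrier Q'.L" using XY F_fr fp Q'.fr_closed by simp
  show "F (X \<oplus>\<^bsub>Q.L\<^esub> Y) = F X \<oplus>\<^bsub>Q'.L\<^esub> F Y"
    using XY fp by (simp add: F_fr Q.fr_add Q'.fr_add)
  obtain s w where X': "s \<in> T" "w \<in> carrier Q" "X = Q.fr s (w \<otimes>\<^bsub>Q\<^esub> p)" using Q.L_adapted[OF X XY(1)] .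
  have "f s \<in> T'" using X'(1) fT by auto
  then show "F (X \<otimes>\<^bsub>Q.L\<^esub> Y) = F X \<otimes>\<^bsub>Q'.L\<^esub> F Y"
    unfolding X'(3) XY(5) using X' XY(1-3) fp Q.S_carrier[OF XY(1)]
    by (simp add: F_fr Q.fr_mult Q'.fr_mult)
next
  show "F \<one>\<^bsub>Q.L\<^esub> = \<one>\<^bsub>Q'.L\<^esub>" using Q.one_in_S by (simp add: Q.one_L Q'.one_L F_fr)
qed

lemma F_loc_map: "x \<in> carrier Q \<Longrightarrow> F (loc_map T Q x) = loc_map T' Q' (f x)"
  using Q.one_in_S by (simp add: loc_map_def F_fr)

lemma kernel_F: "a_kernel Q.L Q'.L F = {Q.fr s r | s r. s \<in> T \<and> r \<in> carrier Q \<and> f r \<in> ass Q' T'}"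
proof -
  have "F (Q.fr s r) = \<zero>\<^bsub>Q'.L\<^esub> \<longleftrightarrow> f r \<in> ass Q' T'" if "s \<in> T" "r \<in> carrier Q" for s r
    using that Q'.fr_eq_zero_iff[OF f_T[OF that(1)]] by (simp add: F_fr)
  then show ?thesis unfolding a_kernel_def' Q.L_carrier by blast
qed

end

section \<open>Maps induced on quotient rings\<close>

lemma (in ideal) rcos_eq_iff:
  assumes "x \<in> carrier R" "y \<in> carrier R"
  shows "I +> x = I +> y \<longleftrightarrow> x \<ominus> y \<in> I"
  using quotient_eq_iff_same_a_r_cos[OF is_ideal assms] by simp

lemma (in ideal) rcos_eq_self_iff: "x \<in> carrier R \<Longrightarrow> I +> x = I \<longleftrightarrow> x \<in> I"
  using rcos_eq_iff[of x \<zero>] a_rcos_zero[OF is_ideal additive_subgroup.zero_closed[OF is_additive_subgroup]]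
  by (simp add: minus_eq)

lemma Quot_carrier: "carrier (R Quot I) = (\<lambda>x. I +>\<^bsub>R\<^esub> x) ` carrier R"
  by (auto simp: FactRing_def A_RCOSETS_def')

lemma Quot_zero: "\<zero>\<^bsub>R Quot I\<^esub> = I"
  by (simp add: FactRing_def)

context ring_hom_ring
begin

lemma image_closed: "x \<in> carrier R \<Longrightarrow> h x \<in> carrier S"
  by simp

lemma submonoid_image:
  assumes "submonoid T R" shows "submonoid (h ` T) S"
proof -
  interpret T: submonoid T R by fact
  show ?thesis
  proof
    show "h ` T \<subseteq> carrier S" using T.mem_carrier by auto
    show "\<one>\<^bsub>S\<^esub> \<in> h ` T" unfolding hom_one[symmetric] using T.one_closed by (rule imageI)
    fix x y assume "x \<in> h ` T" "y \<in> h ` T"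
    then obtain s t where "s \<in> T" "t \<in> T" "x = h s" "y = h t" by blast
    then show "x \<otimes>\<^bsub>S\<^esub> y \<in> h ` T"
      using T.m_closed T.mem_carrier by (intro image_eqI[of _ _ "s \<otimes> t"]) auto
  qed
qed

lemma quot_lift_rcos:
  assumes I: "ideal I R" and ker: "\<And>x. x \<in> I \<Longrightarrow> h x = \<zero>\<^bsub>S\<^esub>" and x: "x \<in> carrier R"
  shows "quot_lift h (I +>\<^bsub>R\<^esub> x) = h x"
proof -
  interpret I: ideal I R by fact
  have "h (i \<oplus>\<^bsub>R\<^esub> x) = h x" if "i \<in> I" for i
    using ker[OF that] I.Icarr[OF that] x by simp
  moreover have "I +>\<^bsub>R\<^esub> x = (\<lambda>i. i \<oplus>\<^bsub>R\<^esub> x) ` I" unfolding a_r_coset_def' by blast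
  ultimately have "h ` (I +>\<^bsub>R\<^esub> x) = (\<lambda>i. h x) ` I" by (simp add: image_image)
  then have "h ` (I +>\<^bsub>R\<^esub> x) = {h x}" using I.zero_closed by blast
  then show ?thesis by (simp add: quot_lift_def)
qed

lemma quot_lift_hom:
  assumes I: "ideal I R" and ker: "\<And>x. x \<in> I \<Longrightarrow> h x = \<zero>\<^bsub>S\<^esub>"
  shows "ring_hom_ring (R Quot I) S (quot_lift h)"
proof -
  interpret q: ring_hom_ring R "R Quot I" "(+>\<^bsub>R\<^esub>) I" using I by (rule ideal.rcos_ring_hom_ring)
  note [simp] = quot_lift_rcos[OF assms]
  show ?thesis
  proof (rule ring_hom_ringI2[OF ideal.quotient_is_ring[OF I] S.ring_axioms], rule ring_hom_memI)
    fix X Y assume "X \<in> carrier (R Quot I)" "Y \<in> carrier (R Quot I)"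
    then obtain x y where xy: "x \<in> carrier R" "y \<in> carrier R" "X = I +>\<^bsub>R\<^esub> x" "Y = I +>\<^bsub>R\<^esub> y"
      by (auto simp: Quot_carrier)
    show "quot_lift h X \<in> carrier S" using xy by simp
    show "quot_lift h (X \<otimes>\<^bsub>R Quot I\<^esub> Y) = quot_lift h X \<otimes>\<^bsub>S\<^esub> quot_lift h Y"
      unfolding xy using xy(1,2) by (simp flip: q.hom_mult)
    show "quot_lift h (X \<oplus>\<^bsub>R Quot I\<^esub> Y) = quot_lift h X \<oplus>\<^bsub>S\<^esub> quot_lift h Y"
      unfolding xy using xy(1,2) by (simp flip: q.hom_add)
  next
    show "quot_lift h \<one>\<^bsub>R Quot I\<^esub> = \<one>\<^bsub>S\<^esub>" by (simp flip: q.hom_one)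
  qed
qed

lemma ring_iso_of_trivial_kernel:
  assumes "h ` carrier R = carrier S" and "\<And>x. \<lbrakk>x \<in> carrier R; h x = \<zero>\<^bsub>S\<^esub>\<rbrakk> \<Longrightarrow> x = \<zero>\<^bsub>R\<^esub>"
  shows "h \<in> ring_iso R S"
proof -
  have "a_kernel R S h = {\<zero>\<^bsub>R\<^esub>}" 
    unfolding a_kernel_def' using assms(2) hom_zero R.zero_closed by blast
  then have "inj_on h (carrier R)" by (rule trivial_ker_imp_inj)
  then show ?thesis using assms(1) homh by (simp add: ring_iso_def bij_betw_def)
qed

lemma quot_lift_iso:
  assumes surj: "h ` carrier R = carrier S" and K: "a_kernel R S h = K"
  shows "ideal K R" and "quot_lift h \<in> ring_iso (R Quot K) S"
  using kernel_is_ideal FactRing_iso_set[OF surj] by (simp_all add: K quot_lift_def[abs_def])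

end

lemma ring_hom_ring_comp:
  assumes "ring_hom_ring A B f" "ring_hom_ring B C g"
  shows "ring_hom_ring A C (g \<circ> f)"
proof -
  interpret f: ring_hom_ring A B f by fact
  interpret g: ring_hom_ring B C g by fact
  show ?thesis
    by (rule ring_hom_ringI2[OF f.R.ring_axioms g.S.ring_axioms ring_hom_trans[OF f.homh g.homh]])
qed

text \<open>Exponent zero gives the whole ring, the unit for products of ideals, and each further
  power adds a factor on the right.\<close>

lemma ideals_set_pow:
  "I [^]\<^bsub>ideals_set A\<^esub> (0::nat) = carrier A"
  "I [^]\<^bsub>ideals_set A\<^esub> Suc k = (I [^]\<^bsub>ideals_set A\<^esub> k) \<cdot>\<^bsub>A\<^esub> I"
  by (simp_all add: nat_pow_def ideals_set_def)

section \<open>Localization modulo an ideal\<close>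

text \<open>The quotient is presented by a surjection \<open>h\<close> instead of an ideal, so that
  one set of facts covers four projections: from \<open>R\<close> to \<open>R/\<aa>\<close>, from
  there to its quotient by the prime radical, and from both of these quotients to
  \<open>R/\<pp>\<close>. Regularity on both sides lets \<open>K_cancel\<close> strip denominators
  from either end of a product.\<close>

locale loc_quotient = Q: left_denominator_ring Q T + h: ring_hom_ring Q Q' h
  for Q :: "('a, 'c) ring_scheme" and T and Q' :: "('b, 'd) ring_scheme" and h +
  assumes surj: "h ` carrier Q = carrier Q'"
    and regular: "\<And>s. s \<in> T \<Longrightarrow> regular_elem Q' (h s)"
    and one_neq_zero: "\<one>\<^bsub>Q'\<^esub> \<noteq> \<zero>\<^bsub>Q'\<^esub>"
begin

abbreviation K where "K \<equiv> {x \<in> carrier Q. h x = \<zero>\<^bsub>Q'\<^esub>}"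

lemma ideal_K: "ideal K Q"
  using h.kernel_is_ideal unfolding a_kernel_def' .

lemma K_cancel:
  assumes "s \<in> T" "r \<in> carrier Q"
  shows "s \<otimes>\<^bsub>Q\<^esub> r \<in> K \<longleftrightarrow> r \<in> K" and "r \<otimes>\<^bsub>Q\<^esub> s \<in> K \<longleftrightarrow> r \<in> K"
  using assms Q.S_carrier[OF assms(1)] regular_elemD(2,3)[OF regular[OF assms(1)], of "h r"] by auto

text \<open>The Ore condition passes to any surjective image. The condition on zero divisors becomes
  immediate because the images of denominators are regular: the element in question is already zero,
  and \<open>\<one>\<close> annihilates it.\<close>

lemma image_left_den_set: "left_den_set Q' (h ` T)" and image_ass: "ass Q' (h ` T) = {\<zero>\<^bsub>Q'\<^esub>}"
proof -
  have img: "\<exists>x\<in>carrier Q. y = h x" if "y \<in> carrier Q'" for y using surj that by auto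
  have "submonoid T Q"
    using Q.den by (simp add: left_den_set_def left_Ore_set_def mult_subset_def)
  then have "submonoid (h ` T) Q'" by (rule h.submonoid_image)
  moreover have "\<zero>\<^bsub>Q'\<^esub> \<notin> h ` T"
  proof
    assume "\<zero>\<^bsub>Q'\<^esub> \<in> h ` T"
    then obtain s where s: "s \<in> T" "h s = \<zero>\<^bsub>Q'\<^esub>" by auto
    show False using regular_elemD(2)[OF regular[OF s(1)], of "\<one>\<^bsub>Q'\<^esub>"] s(2) one_neq_zero by auto
  qed
  moreover have "((h ` T) #>\<^bsub>Q'\<^esub> y) \<inter> (carrier Q' #>\<^bsub>Q'\<^esub> h s) \<noteq> {}"
    if y: "y \<in> carrier Q'" and s: "s \<in> T" for y s
  proof -
    obtain r where r: "r \<in> carrier Q" "y = h r" using img[OF y] by blast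
    obtain u v where uv: "u \<in> T" "v \<in> carrier Q" "u \<otimes>\<^bsub>Q\<^esub> r = v \<otimes>\<^bsub>Q\<^esub> s" using Q.ore[OF r(1) s] .
    then have "h u \<otimes>\<^bsub>Q'\<^esub> y = h v \<otimes>\<^bsub>Q'\<^esub> h s"
      using r Q.S_carrier[OF s] Q.S_carrier[OF uv(1)] by (simp flip: h.hom_mult)
    moreover have "h u \<otimes>\<^bsub>Q'\<^esub> y \<in> (h ` T) #>\<^bsub>Q'\<^esub> y" "h v \<otimes>\<^bsub>Q'\<^esub> h s \<in> carrier Q' #>\<^bsub>Q'\<^esub> h s"
      using uv by (auto simp: r_coset_def)
    ultimately show ?thesis by auto
  qed
  ultimately have "left_Ore_set Q' (h ` T)" by (auto simp: left_Ore_set_def mult_subset_def)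
  moreover have "\<exists>t\<in>h ` T. t \<otimes>\<^bsub>Q'\<^esub> y = \<zero>\<^bsub>Q'\<^esub>"
    if "y \<in> carrier Q'" "s \<in> h ` T" "y \<otimes>\<^bsub>Q'\<^esub> s = \<zero>\<^bsub>Q'\<^esub>" for y s
  proof -
    have "y = \<zero>\<^bsub>Q'\<^esub>" using that regular regular_elemD(3) by (metis imageE)
    then have "h \<one>\<^bsub>Q\<^esub> \<otimes>\<^bsub>Q'\<^esub> y = \<zero>\<^bsub>Q'\<^esub>" by simp
    then show ?thesis using Q.one_in_S by blast
  qed
  ultimately show "left_den_set Q' (h ` T)" by (auto simp: left_den_set_def)
  have "y = \<zero>\<^bsub>Q'\<^esub>" if "y \<in> carrier Q'" "t \<in> h ` T" "t \<otimes>\<^bsub>Q'\<^esub> y = \<zero>\<^bsub>Q'\<^esub>" for y t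
    using that regular regular_elemD(2) by (metis imageE)
  moreover have "h \<one>\<^bsub>Q\<^esub> \<in> h ` T" "h \<one>\<^bsub>Q\<^esub> \<otimes>\<^bsub>Q'\<^esub> \<zero>\<^bsub>Q'\<^esub> = \<zero>\<^bsub>Q'\<^esub>"
    using imageI[OF Q.one_in_S] by (simp_all del: h.hom_one)
  ultimately show "ass Q' (h ` T) = {\<zero>\<^bsub>Q'\<^esub>}" unfolding ass_def by blast
qed

sublocale Q': left_denominator_ring Q' "h ` T"
  by (rule left_denominator_ringI[OF h.S.ring_axioms image_left_den_set])

sublocale loc: loc_hom Q T Q' "h ` T" h
  by unfold_locales (use h.homh in auto)

lemma loc_surj: "loc.F ` carrier Q.L = carrier Q'.L"
proof (intro subset_antisym subsetI)
  fix Y assume "Y \<in> carrier Q'.L"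
  then obtain s' r' where Y: "s' \<in> h ` T" "r' \<in> carrier Q'" "Y = Q'.fr s' r'" using Q'.L_cases by blast
  then obtain s where s: "s \<in> T" "s' = h s" by auto
  obtain r where r: "r \<in> carrier Q" "r' = h r" using Y(2) unfolding surj[symmetric] by auto
  have "Y = loc.F (Q.fr s r)" using Y s r by (simp add: loc.F_fr)
  then show "Y \<in> loc.F ` carrier Q.L" using Q.fr_closed s(1) r(1) by blast
next
  fix Y assume "Y \<in> loc.F ` carrier Q.L"
  then show "Y \<in> carrier Q'.L" using ring_hom_ring.image_closed[OF loc.F_hom] by auto
qed

lemma kernel_loc: "a_kernel Q.L Q'.L loc.F = Loc_ideal T Q K"
  unfolding loc.kernel_F image_ass Loc_ideal_def by blast

lemmas ideal_Loc_ideal = ring_hom_ring.quot_lift_iso(1)[OF loc.F_hom loc_surj kernel_loc]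
  and Loc_quot_iso = ring_hom_ring.quot_lift_iso(2)[OF loc.F_hom loc_surj kernel_loc]

text \<open>Membership in \<open>Loc_ideal\<close> only asserts that some representative has its
  numerator in \<open>K\<close>. Being a kernel, the set is insensitive to the representative, so
  any numerator decides.\<close>

lemma fr_in_Loc_ideal_iff:
  assumes s: "s \<in> T" and r: "r \<in> carrier Q"
  shows "Q.fr s r \<in> Loc_ideal T Q K \<longleftrightarrow> r \<in> K"
proof
  have "loc.F (Q.fr s r) = \<zero>\<^bsub>Q'.L\<^esub> \<longleftrightarrow> h r = \<zero>\<^bsub>Q'\<^esub>"
    using s r Q'.fr_eq_zero_iff[of "h s" "h r"] by (simp add: loc.F_fr image_ass)
  then show "r \<in> K" if "Q.fr s r \<in> Loc_ideal T Q K"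
    using that r unfolding kernel_loc[symmetric] a_kernel_def' by blast
qed (use s in \<open>auto simp: Loc_ideal_def\<close>)

lemma prime_Loc_ideal:
  assumes P: "prime_ideal Q' {\<zero>\<^bsub>Q'\<^esub>}"
  shows "prime_ideal Q.L (Loc_ideal T Q K)"
proof -
  interpret L: ring Q.L by (rule Q.ring_L)
  show ?thesis unfolding L.prime_ideal_iff
  proof (intro conjI ballI impI)
    show "ideal (Loc_ideal T Q K) Q.L" by (rule ideal_Loc_ideal)
    have "\<one>\<^bsub>Q.L\<^esub> \<notin> Loc_ideal T Q K"
      using one_neq_zero fr_in_Loc_ideal_iff[of "\<one>\<^bsub>Q\<^esub>" "\<one>\<^bsub>Q\<^esub>"] Q.one_in_S by (simp add: Q.one_L)
    then show "Loc_ideal T Q K \<noteq> carrier Q.L" using L.one_closed by metis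
    fix X Y assume X: "X \<in> carrier Q.L" and Y: "Y \<in> carrier Q.L"
      and XY: "\<forall>Z\<in>carrier Q.L. X \<otimes>\<^bsub>Q.L\<^esub> Z \<otimes>\<^bsub>Q.L\<^esub> Y \<in> Loc_ideal T Q K"
    obtain s r where X': "s \<in> T" "r \<in> carrier Q" "X = Q.fr s r" using Q.L_cases[OF X] .
    obtain t q where Y': "t \<in> T" "q \<in> carrier Q" "Y = Q.fr t q" using Q.L_cases[OF Y] .
    note tc = Q.S_carrier[OF Y'(1)]
    have "h r = \<zero>\<^bsub>Q'\<^esub> \<or> h q = \<zero>\<^bsub>Q'\<^esub>"
    proof (rule ccontr)
      assume "\<not> ?thesis"
      then obtain z' where z': "z' \<in> carrier Q'" "h r \<otimes>\<^bsub>Q'\<^esub> z' \<otimes>\<^bsub>Q'\<^esub> h q \<noteq> \<zero>\<^bsub>Q'\<^esub>"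
        using h.S.prime_idealD[OF P, of "h r" "h q"] X' Y' by auto
      then obtain z where z: "z \<in> carrier Q" "z' = h z" unfolding surj[symmetric] by auto
      \<comment> \<open>The test element \<open>z t\<close> ends in the denominator of
        \<open>Y\<close>, so the product collapses: \<open>s^-1 r\<close> times \<open>z t\<close>
        times \<open>t^-1 q\<close> is \<open>s^-1 (r z q)\<close>.\<close>
      have "X \<otimes>\<^bsub>Q.L\<^esub> Q.fr \<one>\<^bsub>Q\<^esub> (z \<otimes>\<^bsub>Q\<^esub> t) = Q.fr s (r \<otimes>\<^bsub>Q\<^esub> z \<otimes>\<^bsub>Q\<^esub> t)"
        using Q.fr_mult[of s r "\<one>\<^bsub>Q\<^esub>" "z \<otimes>\<^bsub>Q\<^esub> t"] X' z(1) tc Q.one_in_S by (simp add: Q.m_assoc)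
      then have "X \<otimes>\<^bsub>Q.L\<^esub> Q.fr \<one>\<^bsub>Q\<^esub> (z \<otimes>\<^bsub>Q\<^esub> t) \<otimes>\<^bsub>Q.L\<^esub> Y = Q.fr s (r \<otimes>\<^bsub>Q\<^esub> z \<otimes>\<^bsub>Q\<^esub> q)"
        using X' Y' z(1) by (simp add: Q.fr_mult)
      then have "Q.fr s (r \<otimes>\<^bsub>Q\<^esub> z \<otimes>\<^bsub>Q\<^esub> q) \<in> Loc_ideal T Q K"
        using XY Q.fr_closed[of "\<one>\<^bsub>Q\<^esub>" "z \<otimes>\<^bsub>Q\<^esub> t"] Q.one_in_S z(1) tc by force
      then have "h (r \<otimes>\<^bsub>Q\<^esub> z \<otimes>\<^bsub>Q\<^esub> q) = \<zero>\<^bsub>Q'\<^esub>"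
        using fr_in_Loc_ideal_iff X' Y' z(1) by simp
      then show False using z' z X' Y' by simp
    qed
    then show "X \<in> Loc_ideal T Q K \<or> Y \<in> Loc_ideal T Q K"
      using X' Y' fr_in_Loc_ideal_iff by auto
  qed
qed

text \<open>The powers of \<open>S^-1 K\<close> are never computed. If some \<open>X\<close> in it
  lies outside the prime, then multiplying a fraction outside the prime by a suitable
  \<open>X Z\<close> keeps it outside and moves its numerator from \<open>K^k\<close> to
  \<open>K^(k+1)\<close>; nilpotency ends this at numerator zero.\<close>

lemma Loc_ideal_nilpotent:
  assumes nil: "nilpotent_ideal Q K" and P: "prime_ideal Q.L P"
  shows "Loc_ideal T Q K \<subseteq> P"
proof (rule ccontr)
  assume not: "\<not> Loc_ideal T Q K \<subseteq> P"
  define pw where "pw k = K [^]\<^bsub>ideals_set Q\<^esub> k" for k :: nat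
  have pw0: "pw 0 = carrier Q" and pwS: "pw (Suc k) = pw k \<cdot>\<^bsub>Q\<^esub> K" for k
    unfolding pw_def by (rule ideals_set_pow)+
  interpret L: ring Q.L by (rule Q.ring_L)
  interpret P: ideal P Q.L using P by (rule prime_ideal_ideal)
  interpret N: ideal "Loc_ideal T Q K" Q.L by (rule ideal_Loc_ideal)
  have pwI: "ideal (pw k) Q" for k
  proof (induction k)
    case 0 show ?case unfolding pw0 by (rule Q.oneideal)
  next
    case (Suc k) show ?case unfolding pwS by (rule Q.ideal_prod_is_ideal[OF Suc ideal_K])
  qed
  \<comment> \<open>Powers grow by a factor on the right, whereas the argument below multiplies
    numerators by elements of \<open>K\<close> on the left.\<close>
  have pwS2: "K \<cdot>\<^bsub>Q\<^esub> pw k \<subseteq> pw (Suc k)" for k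
  proof (induction k)
    case 0
    show ?case unfolding pwS pw0 Q.ideal_prod_one[OF ideal_K]
    proof
      fix x assume "x \<in> K"
      then show "x \<in> carrier Q \<cdot>\<^bsub>Q\<^esub> K"
        using ideal_prod.prod[of "\<one>\<^bsub>Q\<^esub>" "carrier Q" x K Q] by auto
    qed
  next
    case (Suc k)
    have "x \<in> pw (Suc k) \<cdot>\<^bsub>Q\<^esub> K" if "x \<in> (K \<cdot>\<^bsub>Q\<^esub> pw k) \<cdot>\<^bsub>Q\<^esub> K" for x
      using that
    proof (induction rule: ideal_prod.induct)
      case (prod i j) then show ?case using Suc by (auto intro: ideal_prod.prod)
    qed (rule ideal_prod.sum)
    then have "(K \<cdot>\<^bsub>Q\<^esub> pw k) \<cdot>\<^bsub>Q\<^esub> K \<subseteq> pw (Suc k) \<cdot>\<^bsub>Q\<^esub> K" by (rule subsetI)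
    then show ?case
      unfolding Q.ideal_prod_assoc[OF ideal_K pwI ideal_K] pwS .
  qed
  obtain X where X: "X \<in> Loc_ideal T Q K" "X \<notin> P" using not by blast
  have "\<exists>s i. s \<in> T \<and> i \<in> pw k \<and> Q.fr s i \<notin> P" for k
  proof (induction k)
    case 0
    obtain s i where "s \<in> T" "i \<in> K" "X = Q.fr s i" using X(1) unfolding Loc_ideal_def by blast
    then show ?case using X(2) ideal.Icarr[OF ideal_K] unfolding pw0 by blast
  next
    case (Suc k)
    then obtain s' j where j: "s' \<in> T" "j \<in> pw k" "Q.fr s' j \<notin> P" by blast
    have jc: "j \<in> carrier Q" using ideal.Icarr[OF pwI j(2)] .
    obtain Z where Z: "Z \<in> carrier Q.L" "X \<otimes>\<^bsub>Q.L\<^esub> Z \<otimes>\<^bsub>Q.L\<^esub> Q.fr s' j \<notin> P"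
      using L.prime_idealD[OF P N.Icarr[OF X(1)] Q.fr_closed[OF j(1) jc] X(2) j(3)] .
    have XZ: "X \<otimes>\<^bsub>Q.L\<^esub> Z \<in> Loc_ideal T Q K" using N.I_r_closed X(1) Z(1) by blast
    obtain s w where w: "s \<in> T" "w \<in> carrier Q" "X \<otimes>\<^bsub>Q.L\<^esub> Z = Q.fr s (w \<otimes>\<^bsub>Q\<^esub> s')"
      using Q.L_adapted[OF N.Icarr[OF XZ] j(1)] .
    have "w \<otimes>\<^bsub>Q\<^esub> s' \<in> K"
      using XZ w fr_in_Loc_ideal_iff[OF w(1), of "w \<otimes>\<^bsub>Q\<^esub> s'"] Q.S_carrier[OF j(1)] by simp
    \<comment> \<open>The adapted numerator is \<open>w s'\<close>; regularity of \<open>s'\<close>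
      modulo \<open>K\<close> is what puts \<open>w\<close> itself into \<open>K\<close>.\<close>
    then have "w \<in> K" using K_cancel(2)[OF j(1) w(2)] by blast
    then have "w \<otimes>\<^bsub>Q\<^esub> j \<in> pw (Suc k)" using pwS2[of k] ideal_prod.prod[of w K j "pw k" Q] j(2) by blast
    moreover have "Q.fr s (w \<otimes>\<^bsub>Q\<^esub> j) \<notin> P" using Z(2) w j(1) jc by (simp add: Q.fr_mult)
    ultimately show ?case using w(1) by blast
  qed
  moreover obtain k where "pw k = {\<zero>\<^bsub>Q\<^esub>}" using nil by (auto simp: nilpotent_ideal_def pw_def)
  ultimately obtain s where "s \<in> T" "Q.fr s \<zero>\<^bsub>Q\<^esub> \<notin> P" by (metis singletonD)
  then show False using Q.fr_zero P.zero_closed by simp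
qed

end

section \<open>Denominator sets with enough normal elements\<close>

text \<open>Normality moves any middle factor past \<open>x\<close>, so \<open>x r = 0\<close> gives
  \<open>x R r = 0\<close>, and primeness leaves only \<open>r = 0\<close>. The other side is
  symmetric.\<close>

lemma (in ring) normal_regular_of_prime:
  assumes prime: "prime_ideal R {\<zero>}" and x: "normal_elem R x" "x \<noteq> \<zero>"
  shows "regular_elem R x"
  unfolding regular_elem_def
proof (intro conjI ballI impI)
  show xc: "x \<in> carrier R" using normal_elemD(1)[OF x(1)] .
  fix r assume r: "r \<in> carrier R"
  show "r = \<zero>" if "x \<otimes> r = \<zero>"
  proof -
    have "x \<otimes> q \<otimes> r = \<zero>" if q: "q \<in> carrier R" for q
    proof -
      obtain q' where "q' \<in> carrier R" "x \<otimes> q = q' \<otimes> x" using normal_elemD(2)[OF x(1) q] by blast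
      then show ?thesis using \<open>x \<otimes> r = \<zero>\<close> xc r by (simp add: m_assoc)
    qed
    then show ?thesis using prime_idealD[OF prime xc r] x(2) by auto
  qed
  show "r = \<zero>" if "r \<otimes> x = \<zero>"
  proof -
    have "r \<otimes> q \<otimes> x = \<zero>" if q: "q \<in> carrier R" for q
    proof -
      obtain q' where q': "q' \<in> carrier R" "q \<otimes> x = x \<otimes> q'" using normal_elemD(3)[OF x(1) q] by blast
      have "r \<otimes> q \<otimes> x = r \<otimes> x \<otimes> q'" using xc r q q' by (simp add: m_assoc)
      then show ?thesis using \<open>r \<otimes> x = \<zero>\<close> q' by simp
    qed
    then show ?thesis using prime_idealD[OF prime r xc] x(2) by auto
  qed
qed

text \<open>The hypothesis concerns left multiples. Cancellation of \<open>s\<close> on the left and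
  the left Ore condition follow at once from the element \<open>t s\<close>, whereas the two
  statements on the right take a detour.\<close>

lemma (in ring) normal_regular_Den:
  assumes T: "submonoid T R" "\<one> \<noteq> \<zero>"
    and norm: "\<And>s. s \<in> T \<Longrightarrow> \<exists>t\<in>T. normal_elem R (t \<otimes> s) \<and> regular_elem R (t \<otimes> s)"
  shows "\<And>s. s \<in> T \<Longrightarrow> regular_elem R s" and "T \<in> Den R {\<zero>}"
proof -
  interpret T: submonoid T R by fact
  have c: "s \<in> carrier R" if "s \<in> T" for s using that by (rule T.mem_carrier)
  have lreg: "r = \<zero>" if s: "s \<in> T" and r: "r \<in> carrier R" "s \<otimes> r = \<zero>" for s r
  proof -
    obtain t where t: "t \<in> T" "regular_elem R (t \<otimes> s)" using norm[OF s] by blast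
    have "t \<otimes> s \<otimes> r = \<zero>" using c[OF s] c[OF t(1)] r by (simp add: m_assoc)
    then show ?thesis using regular_elemD(2)[OF t(2) r(1)] by blast
  qed
  \<comment> \<open>The multiplier \<open>t\<close> cannot be inserted between \<open>r\<close> and
    \<open>s\<close>. Conjugating \<open>r\<close> by the normal element \<open>t' t\<close> turns
    it into \<open>r1\<close>, and \<open>r1 t'\<close> times the regular element \<open>t s\<close>
    equals \<open>t' t r s = 0\<close>. Hence \<open>r1 t' = 0\<close>, so
    \<open>t' t r = 0\<close>, and the regular \<open>t' t\<close> cancels.\<close>
  have rreg: "r = \<zero>" if s: "s \<in> T" and r: "r \<in> carrier R" "r \<otimes> s = \<zero>" for s r
  proof -
    obtain t where t: "t \<in> T" "regular_elem R (t \<otimes> s)" using norm[OF s] by blast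
    obtain t' where t': "t' \<in> T" "normal_elem R (t' \<otimes> t)" "regular_elem R (t' \<otimes> t)"
      using norm[OF t(1)] by blast
    obtain r1 where r1: "r1 \<in> carrier R" "t' \<otimes> t \<otimes> r = r1 \<otimes> (t' \<otimes> t)"
      using normal_elemD(2)[OF t'(2) r(1)] by blast
    note k = c[OF s] c[OF t(1)] c[OF t'(1)] r(1) r1(1)
    have "r1 \<otimes> t' \<otimes> (t \<otimes> s) = r1 \<otimes> (t' \<otimes> t) \<otimes> s" using k by (simp add: m_assoc)
    also have "\<dots> = t' \<otimes> t \<otimes> (r \<otimes> s)" using k by (simp add: m_assoc flip: r1(2))
    finally have "r1 \<otimes> t' = \<zero>" using k r(2) regular_elemD(3)[OF t(2), of "r1 \<otimes> t'"] by simp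
    then have "r1 \<otimes> (t' \<otimes> t) = \<zero>" using k by (simp flip: m_assoc)
    then show ?thesis using r1(2) regular_elemD(2)[OF t'(3) r(1)] by simp
  qed
  show reg: "regular_elem R s" if "s \<in> T" for s
    using that c lreg rreg unfolding regular_elem_def by blast
  have "\<zero> \<notin> T" using lreg[of \<zero> \<one>] T(2) by auto
  then have mult: "mult_subset R T" using T(1) by (simp add: mult_subset_def)
  have one: "\<exists>t\<in>T. t \<otimes> \<zero> = \<zero>" "\<exists>t\<in>T. \<zero> \<otimes> t = \<zero>"
    by (rule bexI[OF _ T.one_closed], simp)+
  have "(T #> r) \<inter> (carrier R #> s) \<noteq> {}" if r: "r \<in> carrier R" and s: "s \<in> T" for r s
  proof -
    obtain t where t: "t \<in> T" "normal_elem R (t \<otimes> s)" using norm[OF s] by blast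
    obtain q where q: "q \<in> carrier R" "t \<otimes> s \<otimes> r = q \<otimes> (t \<otimes> s)" using normal_elemD(2)[OF t(2) r] by blast
    have "t \<otimes> s \<otimes> r = (q \<otimes> t) \<otimes> s" using q c[OF s] c[OF t(1)] by (simp add: m_assoc)
    moreover have "t \<otimes> s \<otimes> r \<in> T #> r" "(q \<otimes> t) \<otimes> s \<in> carrier R #> s"
      unfolding r_coset_def using T.m_closed[OF t(1) s] m_closed[OF q(1) c[OF t(1)]] by blast+
    ultimately show ?thesis by auto
  qed
  then have "left_den_set R T"
    using mult rreg one unfolding left_den_set_def left_Ore_set_def by blast
  moreover have "(r <# T) \<inter> (s <# carrier R) \<noteq> {}" if r: "r \<in> carrier R" and s: "s \<in> T" for r s
  proof -
    obtain t where t: "t \<in> T" "normal_elem R (t \<otimes> s)" using norm[OF s] by blast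
    note k = r c[OF s] c[OF t(1)]
    \<comment> \<open>The factor \<open>t\<close> put in front of \<open>r\<close> matches the one
      in front of \<open>s q\<close>; cancelling it leaves \<open>r (t s) = s q\<close>.\<close>
    obtain q where q: "q \<in> carrier R" "(t \<otimes> r) \<otimes> (t \<otimes> s) = (t \<otimes> s) \<otimes> q"
      using normal_elemD(3)[OF t(2), of "t \<otimes> r"] k by auto
    have "t \<otimes> (r \<otimes> (t \<otimes> s)) = t \<otimes> (s \<otimes> q)" using q k by (simp add: m_assoc)
    then have "r \<otimes> (t \<otimes> s) = s \<otimes> q"
      using regular_elem_cancel(1)[OF reg[OF t(1)]] k q(1) by simp
    moreover have "r \<otimes> (t \<otimes> s) \<in> r <# T" "s \<otimes> q \<in> s <# carrier R"
      unfolding l_coset_def using T.m_closed[OF t(1) s] q(1) by blast+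
    ultimately show ?thesis by auto
  qed
  then have "right_den_set R T"
    using mult lreg one unfolding right_den_set_def right_Ore_set_def by blast
  moreover have "ass R T = {\<zero>}" using lreg one by (auto simp: ass_def)
  ultimately show "T \<in> Den R {\<zero>}" by (simp add: Den_def)
qed

text \<open>Equal annihilators make the map injective. It is surjective because a fraction can be
  expanded by the left multiplier that brings its denominator into the smaller set.\<close>

lemma loc_lift_id_iso:
  assumes R: "ring R" and S': "left_den_set R S'" and S: "left_den_set R S" "S \<subseteq> S'"
    and ass: "ass R S = ass R S'"
    and cof: "\<And>s. s \<in> S' \<Longrightarrow> \<exists>t\<in>S'. t \<otimes>\<^bsub>R\<^esub> s \<in> S"
  shows "loc_lift S' R (\<lambda>r. r) \<in> ring_iso (Loc S R) (Loc S' R)"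
proof -
  interpret A: left_denominator_ring R S' using R S' by (rule left_denominator_ringI)
  interpret B: left_denominator_ring R S using R S(1) by (rule left_denominator_ringI)
  interpret loc_hom R S R S' "\<lambda>r. r"
    by unfold_locales (use S(2) in \<open>auto simp: ring_hom_def\<close>)
  show ?thesis
  proof (rule ring_hom_ring.ring_iso_of_trivial_kernel[OF F_hom])
    show "X = \<zero>\<^bsub>B.L\<^esub>" if "X \<in> carrier B.L" "F X = \<zero>\<^bsub>A.L\<^esub>" for X
    proof -
      have "X \<in> a_kernel B.L A.L F" using that unfolding a_kernel_def' by blast
      then obtain s r where "s \<in> S" "r \<in> carrier R" "r \<in> ass R S'" "X = B.fr s r"
        unfolding kernel_F by blast
      then show ?thesis using B.fr_eq_zero_iff ass by simp
    qed
    have "Y \<in> F ` carrier B.L" if Y: "Y \<in> carrier A.L" for Y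
    proof -
      obtain s r where sr: "s \<in> S'" "r \<in> carrier R" "Y = A.fr s r" using A.L_cases[OF Y] .
      obtain t where t: "t \<in> S'" "t \<otimes>\<^bsub>R\<^esub> s \<in> S" using cof[OF sr(1)] by blast
      note tr = A.m_closed[OF A.S_carrier[OF t(1)] sr(2)]
      have "t \<otimes>\<^bsub>R\<^esub> s \<in> S'" using t(2) S(2) by blast
      then have "Y = F (B.fr (t \<otimes>\<^bsub>R\<^esub> s) (t \<otimes>\<^bsub>R\<^esub> r))"
        unfolding F_fr[OF t(2) tr] using A.fr_expand[OF sr(1,2) A.S_carrier[OF t(1)]] sr(3) by simp
      then show ?thesis using B.fr_closed[OF t(2) tr] by blast
    qed
    then show "F ` carrier B.L = carrier A.L" using ring_hom_ring.image_closed[OF F_hom] by auto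
  qed
qed

section \<open>Denominator sets in which every element divides a normal one\<close>

text \<open>The notation of the theorem appears as parameters with defining equations, which the
  theorem discharges by its own hypotheses. \<open>hb\<close> names the map from
  \<open>R/\<aa>\<close> to \<open>R/\<pp>\<close>, the intermediate stage in the construction of
  \<open>\<pi>t\<close>.\<close>

locale normal_localization =
  fixes R :: "('a, 'b) ring_scheme" and \<aa> S' S :: "'a set"
    and Rb qb Sb nb Rt qt St pb pt Rp \<pi> Sp \<pi>t hb
  assumes R: "ring R" and \<aa>: "ideal \<aa> R" and S': "S' \<in> Den_l R \<aa>"
    and ex_normal: "\<And>s. s \<in> S' \<Longrightarrow> \<exists>t \<in> S'. normal_elem R (t \<otimes>\<^bsub>R\<^esub> s)"
    and S: "S = {s \<in> S'. normal_elem R s}"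
    and Rb: "Rb = R Quot \<aa>" and qb: "qb = (\<lambda>r. \<aa> +>\<^bsub>R\<^esub> r)" and Sb: "Sb = qb ` S'"
    and nb: "nb = prime_radical Rb"
    and Rt: "Rt = Rb Quot nb" and qt: "qt = (\<lambda>x. nb +>\<^bsub>Rb\<^esub> x)" and St: "St = qt ` Sb"
    and pb: "pb = (\<lambda>\<pp>. qb ` \<pp>)" and pt: "pt = (\<lambda>\<pp>. qt ` pb \<pp>)"
    and Rp: "Rp = (\<lambda>\<pp>. R Quot \<pp>)" and \<pi>: "\<pi> = (\<lambda>\<pp> r. \<pp> +>\<^bsub>R\<^esub> r)" and Sp: "Sp = (\<lambda>\<pp>. \<pi> \<pp> ` S')"
    and hb: "hb = (\<lambda>\<pp>. quot_lift (\<pi> \<pp>))" and \<pi>t: "\<pi>t = (\<lambda>\<pp>. quot_lift (hb \<pp>))"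
begin

sublocale R: left_denominator_ring R S'
  using R S' by (auto simp: Den_l_def intro: left_denominator_ringI)

lemma ass_S': "ass R S' = \<aa>"
  using S' by (simp add: Den_l_def)

lemma \<aa>_iff: "r \<in> \<aa> \<longleftrightarrow> r \<in> carrier R \<and> (\<exists>s\<in>S'. s \<otimes>\<^bsub>R\<^esub> r = \<zero>\<^bsub>R\<^esub>)"
  using ass_S' by (auto simp: ass_def)

lemma one_notin_\<aa>: "\<one>\<^bsub>R\<^esub> \<notin> \<aa>"
  using R.zero_notin_S R.S_carrier by (auto simp: \<aa>_iff)

lemma S_ore:
  assumes "s \<in> S'" obtains t where "t \<in> S'" "t \<otimes>\<^bsub>R\<^esub> s \<in> S"
  using ex_normal[OF assms] R.mult_in_S assms unfolding S by blast

lemma S_subset: "S \<subseteq> S'"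
  by (auto simp: S)

text \<open>For normal elements the left Ore condition is immediate. Annihilation passes from
  \<open>S'\<close> to \<open>S\<close> because \<open>s r = 0\<close> implies
  \<open>(t s) r = 0\<close>, where \<open>t s\<close> can be chosen normal.\<close>

theorem S_Den: "S \<in> Den_l R \<aa>"
proof -
  have c: "s \<in> carrier R" if "s \<in> S" for s using that S_subset R.S_carrier by blast
  have S'_S: "\<exists>t\<in>S. t \<otimes>\<^bsub>R\<^esub> r = \<zero>\<^bsub>R\<^esub>" if r: "r \<in> \<aa>" for r
  proof -
    obtain s where s: "r \<in> carrier R" "s \<in> S'" "s \<otimes>\<^bsub>R\<^esub> r = \<zero>\<^bsub>R\<^esub>" using r unfolding \<aa>_iff by blast
    obtain t where t: "t \<in> S'" "t \<otimes>\<^bsub>R\<^esub> s \<in> S" using S_ore[OF s(2)] .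
    have "t \<otimes>\<^bsub>R\<^esub> s \<otimes>\<^bsub>R\<^esub> r = \<zero>\<^bsub>R\<^esub>"
      using s R.S_carrier[OF t(1)] R.S_carrier[OF s(2)] by (simp add: R.m_assoc)
    then show ?thesis using t(2) by blast
  qed
  have "submonoid S R"
  proof
    show "S \<subseteq> carrier R" using c by blast
    show "\<one>\<^bsub>R\<^esub> \<in> S" using R.one_in_S R.normal_elem_one by (simp add: S)
    show "x \<otimes>\<^bsub>R\<^esub> y \<in> S" if "x \<in> S" "y \<in> S" for x y
      using that R.mult_in_S R.normal_elem_mult by (simp add: S)
  qed
  then have "mult_subset R S" using R.zero_notin_S S_subset by (auto simp: mult_subset_def)
  moreover have "(S #>\<^bsub>R\<^esub> r) \<inter> (carrier R #>\<^bsub>R\<^esub> s) \<noteq> {}" if r: "r \<in> carrier R" and s: "s \<in> S" for r s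
  proof -
    have "normal_elem R s" using s by (simp add: S)
    then obtain q where "q \<in> carrier R" "s \<otimes>\<^bsub>R\<^esub> r = q \<otimes>\<^bsub>R\<^esub> s" using R.normal_elemD(2) r by blast
    then show ?thesis unfolding r_coset_def using s by blast
  qed
  moreover have "\<exists>t\<in>S. t \<otimes>\<^bsub>R\<^esub> r = \<zero>\<^bsub>R\<^esub>" if r: "r \<in> carrier R" "s \<in> S" "r \<otimes>\<^bsub>R\<^esub> s = \<zero>\<^bsub>R\<^esub>" for r s
  proof (rule S'_S)
    obtain t where t: "t \<in> S'" "t \<otimes>\<^bsub>R\<^esub> r = t \<otimes>\<^bsub>R\<^esub> \<zero>\<^bsub>R\<^esub>"
      using R.right_cancel[of s r "\<zero>\<^bsub>R\<^esub>"] r S_subset c by auto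
    then have "t \<otimes>\<^bsub>R\<^esub> r = \<zero>\<^bsub>R\<^esub>" using R.S_carrier by simp
    then show "r \<in> \<aa>" using t(1) r(1) by (auto simp: \<aa>_iff)
  qed
  moreover have "ass R S = \<aa>"
  proof (intro subset_antisym subsetI)
    fix r assume "r \<in> ass R S"
    then show "r \<in> \<aa>" using S_subset unfolding ass_def \<aa>_iff by blast
  next
    fix r assume r: "r \<in> \<aa>"
    then have "r \<in> carrier R" unfolding \<aa>_iff by blast
    then show "r \<in> ass R S" using S'_S[OF r] unfolding ass_def by blast
  qed
  ultimately show ?thesis by (auto simp: Den_l_def left_den_set_def left_Ore_set_def)
qed

theorem S_iso: "loc_lift S' R (\<lambda>r. r) \<in> ring_iso (Loc S R) (Loc S' R)"
proof (rule loc_lift_id_iso[OF R R.den _ S_subset])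
  show "left_den_set R S" "ass R S = ass R S'" using S_Den ass_S' by (auto simp: Den_l_def)
qed (use S_ore in blast)

section \<open>Passage to the quotient by \<aa>\<close>

sublocale \<aa>: ideal \<aa> R by (rule \<aa>)

sublocale qb: ring_hom_ring R Rb qb
  unfolding Rb qb by (rule \<aa>.rcos_ring_hom_ring)

lemma qb_surj: "qb ` carrier R = carrier Rb"
  by (simp add: Rb qb Quot_carrier)

lemma qb_zero_iff: "r \<in> carrier R \<Longrightarrow> qb r = \<zero>\<^bsub>Rb\<^esub> \<longleftrightarrow> r \<in> \<aa>"
  unfolding Rb qb Quot_zero by (rule \<aa>.rcos_eq_self_iff)

text \<open>Since \<open>\<aa>\<close> consists of what \<open>S'\<close> annihilates from the left,
  closure under products gives cancellation on the left modulo \<open>\<aa>\<close>. Cancellation on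
  the right is \<open>right_cancel\<close>, that is, the second denominator condition.\<close>

sublocale Lb: loc_quotient R S' Rb qb
proof unfold_locales
  show "qb ` carrier R = carrier Rb" by (rule qb_surj)
  show "\<one>\<^bsub>Rb\<^esub> \<noteq> \<zero>\<^bsub>Rb\<^esub>" using qb_zero_iff[OF R.one_closed] one_notin_\<aa> by simp
  fix s assume s: "s \<in> S'"
  note sc = R.S_carrier[OF s]
  show "regular_elem Rb (qb s)"
    unfolding regular_elem_def
  proof (intro conjI ballI impI)
    show "qb s \<in> carrier Rb" using sc by simp
    fix y assume "y \<in> carrier Rb"
    then obtain r where r: "r \<in> carrier R" "y = qb r" using qb_surj by auto
    show "y = \<zero>\<^bsub>Rb\<^esub>" if "qb s \<otimes>\<^bsub>Rb\<^esub> y = \<zero>\<^bsub>Rb\<^esub>"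
    proof -
      have "s \<otimes>\<^bsub>R\<^esub> r \<in> \<aa>" using that r sc qb_zero_iff[of "s \<otimes>\<^bsub>R\<^esub> r"] by simp
      then obtain t where t: "t \<in> S'" "t \<otimes>\<^bsub>R\<^esub> (s \<otimes>\<^bsub>R\<^esub> r) = \<zero>\<^bsub>R\<^esub>"
        unfolding \<aa>_iff by blast
      then have "t \<otimes>\<^bsub>R\<^esub> s \<otimes>\<^bsub>R\<^esub> r = \<zero>\<^bsub>R\<^esub>" using R.S_carrier sc r by (simp add: R.m_assoc)
      then have "r \<in> \<aa>" using R.mult_in_S[OF t(1) s] r(1) unfolding \<aa>_iff by blast
      then show ?thesis using qb_zero_iff r by simp
    qed
    show "y = \<zero>\<^bsub>Rb\<^esub>" if "y \<otimes>\<^bsub>Rb\<^esub> qb s = \<zero>\<^bsub>Rb\<^esub>"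
    proof -
      have "r \<otimes>\<^bsub>R\<^esub> s \<in> \<aa>" using that r sc qb_zero_iff[of "r \<otimes>\<^bsub>R\<^esub> s"] by simp
      then obtain t where t: "t \<in> S'" "t \<otimes>\<^bsub>R\<^esub> (r \<otimes>\<^bsub>R\<^esub> s) = \<zero>\<^bsub>R\<^esub>"
        unfolding \<aa>_iff by blast
      then obtain t' where t': "t' \<in> S'" "t' \<otimes>\<^bsub>R\<^esub> (t \<otimes>\<^bsub>R\<^esub> r) = t' \<otimes>\<^bsub>R\<^esub> \<zero>\<^bsub>R\<^esub>"
        using R.right_cancel[OF s, of "t \<otimes>\<^bsub>R\<^esub> r" "\<zero>\<^bsub>R\<^esub>"] r sc R.S_carrier[OF t(1)]
        by (auto simp: R.m_assoc)
      then have "t' \<otimes>\<^bsub>R\<^esub> t \<otimes>\<^bsub>R\<^esub> r = \<zero>\<^bsub>R\<^esub>"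
        using R.S_carrier[OF t(1)] R.S_carrier[OF t'(1)] r by (simp add: R.m_assoc)
      then have "r \<in> \<aa>" using R.mult_in_S[OF t'(1) t(1)] r(1) unfolding \<aa>_iff by blast
      then show ?thesis using qb_zero_iff r by simp
    qed
  qed
qed

text \<open>The kernel consists of the fractions with numerator in \<open>\<aa>\<close>, and these
  already vanish because \<open>\<aa>\<close> is the annihilator \<open>ass R S'\<close>.\<close>

theorem \<iota>_iso: "loc_lift Sb Rb qb \<in> ring_iso (Loc S' R) (Loc Sb Rb)"
  unfolding Sb
proof (rule ring_hom_ring.ring_iso_of_trivial_kernel[OF Lb.loc.F_hom Lb.loc_surj])
  fix X assume X: "X \<in> carrier (Loc S' R)" "loc_lift (qb ` S') Rb qb X = \<zero>\<^bsub>Loc (qb ` S') Rb\<^esub>"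
  then have "X \<in> Loc_ideal S' R Lb.K" unfolding Lb.kernel_loc[symmetric] a_kernel_def' by blast
  then obtain s r where "s \<in> S'" "r \<in> carrier R" "qb r = \<zero>\<^bsub>Rb\<^esub>" "X = R.fr s r"
    by (auto simp: Loc_ideal_def)
  then show "X = \<zero>\<^bsub>Loc S' R\<^esub>" using R.fr_eq_zero_iff[of s r] ass_S' qb_zero_iff by simp
qed

lemma ring_LSb: "ring (Loc Sb Rb)"
  unfolding Sb by (rule Lb.Q'.ring_L)

lemmas \<iota>_Spec = ring_iso_Spec[OF R.ring_L ring_LSb \<iota>_iso]

lemma min_primes_Rb: "bij_betw pb (min_primes_over R \<aa>) (min_primes Rb)"
  unfolding pb by (rule qb.min_primes_over_image[OF qb_surj qb_zero_iff]) (use \<aa>.Icarr in auto)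

text \<open>Guards against the empty intersection, which would make the prime radical of
  \<open>R/\<aa>\<close> the whole ring and the quotient by it zero.\<close>

lemma min_primes_over_nonempty: "min_primes_over R \<aa> \<noteq> {}"
proof -
  obtain P where P: "prime_ideal Rb P" using qb.S.ex_prime Lb.one_neq_zero by blast
  then have "{\<zero>\<^bsub>Rb\<^esub>} \<subseteq> P"
    using additive_subgroup.zero_closed[OF ideal.axioms(1)[OF prime_ideal_ideal[OF P]]] by simp
  then have "min_primes Rb \<noteq> {}"
    using qb.S.prime_contains_min_prime_over[OF P] unfolding qb.S.min_primes_eq_over_zero by blast
  then show ?thesis using min_primes_Rb by (auto simp: bij_betw_def)
qed

end

section \<open>A single prime minimal over \<aa>\<close>

locale normal_localization_min = normal_localization +
  fixes \<pp>
  assumes fin: "finite (min_primes_over R \<aa>)" and \<pp>: "\<pp> \<in> min_primes_over R \<aa>"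
begin

lemma prime: "prime_ideal R \<pp>" and \<aa>_subset: "\<aa> \<subseteq> \<pp>"
  using \<pp> by (auto simp: min_primes_over_def Spec_def)

sublocale \<pp>: ideal \<pp> R using prime by (rule prime_ideal_ideal)

sublocale \<pi>: ring_hom_ring R "Rp \<pp>" "\<pi> \<pp>"
  unfolding Rp \<pi> by (rule \<pp>.rcos_ring_hom_ring)

lemma \<pi>_surj: "\<pi> \<pp> ` carrier R = carrier (Rp \<pp>)"
  by (simp add: Rp \<pi> Quot_carrier)

lemma \<pi>_zero_iff: "r \<in> carrier R \<Longrightarrow> \<pi> \<pp> r = \<zero>\<^bsub>Rp \<pp>\<^esub> \<longleftrightarrow> r \<in> \<pp>"
  unfolding Rp \<pi> Quot_zero by (rule \<pp>.rcos_eq_self_iff)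

lemma one_neq_zero_Rp: "\<one>\<^bsub>Rp \<pp>\<^esub> \<noteq> \<zero>\<^bsub>Rp \<pp>\<^esub>"
  using \<pi>_zero_iff[OF R.one_closed] R.prime_ideal_one_notin[OF prime] by simp

lemma prime_Rp: "prime_ideal (Rp \<pp>) {\<zero>\<^bsub>Rp \<pp>\<^esub>}"
proof -
  have "\<pi> \<pp> ` \<pp> = {\<zero>\<^bsub>Rp \<pp>\<^esub>}"
  proof (intro subset_antisym subsetI)
    fix y assume "y \<in> \<pi> \<pp> ` \<pp>"
    then show "y \<in> {\<zero>\<^bsub>Rp \<pp>\<^esub>}" using \<pi>_zero_iff \<pp>.Icarr by blast
  next
    fix y assume "y \<in> {\<zero>\<^bsub>Rp \<pp>\<^esub>}"
    then have "y = \<pi> \<pp> \<zero>\<^bsub>R\<^esub>" by simp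
    then show "y \<in> \<pi> \<pp> ` \<pp>" using \<pp>.zero_closed by blast
  qed
  then show ?thesis using \<pi>.prime_ideal_image(1)[OF \<pi>_surj prime] \<pi>_zero_iff by simp
qed

text \<open>The theorem on regular normal elements is applied in \<open>R/\<aa>\<close>: elements of
  \<open>S\<close> may be zero divisors in \<open>R\<close>, and \<open>\<pp>\<close> need not be a
  minimal prime of \<open>R\<close>.\<close>

lemma S_notin: "s \<in> S \<Longrightarrow> s \<notin> \<pp>"
proof
  assume s: "s \<in> S" "s \<in> \<pp>"
  have "qb s \<notin> pb \<pp>"
  proof (rule qb.S.regular_normal_notin_min_prime)
    show "regular_elem Rb (qb s)" using s S_subset Lb.regular by blast
    show "normal_elem Rb (qb s)" using s qb.normal_elem_image[OF qb_surj] by (simp add: S)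
    show "finite (min_primes Rb)" using fin bij_betw_finite[OF min_primes_Rb] by simp
    show "pb \<pp> \<in> min_primes Rb" using \<pp> min_primes_Rb by (auto simp: bij_betw_def)
  qed
  then show False using s by (simp add: pb)
qed

text \<open>Regularity in \<open>R/\<aa>\<close> need not persist in \<open>R/\<pp>\<close>. It is
  regained from primeness, because a normal element outside \<open>\<pp>\<close> has a nonzero
  normal image in a prime ring.\<close>

lemma Rp_normal_regular:
  assumes "s \<in> Sp \<pp>"
  shows "\<exists>t\<in>Sp \<pp>. normal_elem (Rp \<pp>) (t \<otimes>\<^bsub>Rp \<pp>\<^esub> s) \<and> regular_elem (Rp \<pp>) (t \<otimes>\<^bsub>Rp \<pp>\<^esub> s)"
proof -
  obtain s' where s': "s' \<in> S'" "s = \<pi> \<pp> s'" using assms by (auto simp: Sp)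
  obtain t where t: "t \<in> S'" "t \<otimes>\<^bsub>R\<^esub> s' \<in> S" using S_ore[OF s'(1)] .
  note k = R.S_carrier[OF s'(1)] R.S_carrier[OF t(1)]
  have n: "normal_elem (Rp \<pp>) (\<pi> \<pp> (t \<otimes>\<^bsub>R\<^esub> s'))"
    using \<pi>.normal_elem_image[OF \<pi>_surj] t(2) by (simp add: S)
  moreover have "\<pi> \<pp> (t \<otimes>\<^bsub>R\<^esub> s') \<noteq> \<zero>\<^bsub>Rp \<pp>\<^esub>"
    using \<pi>_zero_iff[of "t \<otimes>\<^bsub>R\<^esub> s'"] S_notin[OF t(2)] k by simp
  ultimately have "regular_elem (Rp \<pp>) (\<pi> \<pp> (t \<otimes>\<^bsub>R\<^esub> s'))"
    using \<pi>.S.normal_regular_of_prime[OF prime_Rp] by blast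
  then show ?thesis
    using n t(1) s' k by (intro bexI[of _ "\<pi> \<pp> t"]) (auto simp: Sp)
qed

lemma submonoid_S': "submonoid S' R"
  using R.den by (simp add: left_den_set_def left_Ore_set_def mult_subset_def)

lemma submonoid_Sp: "submonoid (Sp \<pp>) (Rp \<pp>)"
  unfolding Sp by (rule \<pi>.submonoid_image[OF submonoid_S'])

theorem Sp_Den: "Sp \<pp> \<in> Den (Rp \<pp>) {\<zero>\<^bsub>Rp \<pp>\<^esub>}"
  by (rule \<pi>.S.normal_regular_Den(2)[OF submonoid_Sp one_neq_zero_Rp Rp_normal_regular])

lemma \<pi>_regular: "s \<in> S' \<Longrightarrow> regular_elem (Rp \<pp>) (\<pi> \<pp> s)"
  by (rule \<pi>.S.normal_regular_Den(1)[OF submonoid_Sp one_neq_zero_Rp Rp_normal_regular])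
    (auto simp: Sp)

lemma \<pi>_\<aa>: "r \<in> \<aa> \<Longrightarrow> \<pi> \<pp> r = \<zero>\<^bsub>Rp \<pp>\<^esub>"
  using \<aa>_subset \<pi>_zero_iff \<aa>.Icarr by blast

lemma hb_qb: "r \<in> carrier R \<Longrightarrow> hb \<pp> (qb r) = \<pi> \<pp> r"
  unfolding hb qb by (rule \<pi>.quot_lift_rcos[OF \<aa> \<pi>_\<aa>])

lemma hb_hom: "ring_hom_ring Rb (Rp \<pp>) (hb \<pp>)"
  unfolding Rb hb by (rule \<pi>.quot_lift_hom[OF \<aa> \<pi>_\<aa>])

lemma pb_eq: "{x \<in> carrier Rb. hb \<pp> x = \<zero>\<^bsub>Rp \<pp>\<^esub>} = pb \<pp>"
proof -
  have "hb \<pp> (qb r) = \<zero>\<^bsub>Rp \<pp>\<^esub> \<longleftrightarrow> r \<in> \<pp>" if "r \<in> carrier R" for r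
    using that by (simp add: hb_qb \<pi>_zero_iff)
  then show ?thesis using \<pp>.Icarr unfolding qb_surj[symmetric] pb by blast
qed

sublocale pb: loc_quotient Rb "qb ` S'" "Rp \<pp>" "hb \<pp>"
proof (intro loc_quotient.intro loc_quotient_axioms.intro Lb.Q'.left_denominator_ring_axioms hb_hom)
  show "hb \<pp> ` carrier Rb = carrier (Rp \<pp>)"
    unfolding qb_surj[symmetric] \<pi>_surj[symmetric] image_image by (intro image_cong refl hb_qb)
  show "regular_elem (Rp \<pp>) (hb \<pp> s)" if "s \<in> qb ` S'" for s
    using that \<pi>_regular hb_qb R.S_carrier by auto
qed (rule one_neq_zero_Rp)

lemma qb_mem_iff: "r \<in> carrier R \<Longrightarrow> qb r \<in> pb \<pp> \<longleftrightarrow> r \<in> \<pp>"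
  using hb_qb \<pi>_zero_iff by (simp flip: pb_eq)

end

context normal_localization begin

lemma minI:
  assumes "finite (min_primes_over R \<aa>)" "\<pp> \<in> min_primes_over R \<aa>"
  shows "normal_localization_min R \<aa> S' S Rb qb Sb nb Rt qt St pb pt Rp \<pi> Sp \<pi>t hb \<pp>"
  using assms by unfold_locales

end

section \<open>All primes minimal over \<aa>, and the quotient by the prime radical\<close>

locale normal_localization_fin = normal_localization +
  assumes fin: "finite (min_primes_over R \<aa>)"
begin

lemma mem_nb_iff: "x \<in> nb \<longleftrightarrow> x \<in> carrier Rb \<and> (\<forall>\<pp>\<in>min_primes_over R \<aa>. x \<in> pb \<pp>)"
  unfolding nb qb.S.prime_radical_eq_Inter_min_primes
  using min_primes_Rb by (auto simp: bij_betw_def)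

sublocale nb: ideal nb Rb
  unfolding nb by (rule qb.S.ideal_prime_radical)

sublocale qt: ring_hom_ring Rb Rt qt
  unfolding Rt qt by (rule nb.rcos_ring_hom_ring)

lemma qt_surj: "qt ` carrier Rb = carrier Rt"
  by (simp add: Rt qt Quot_carrier)

lemma qt_zero_iff: "x \<in> carrier Rb \<Longrightarrow> qt x = \<zero>\<^bsub>Rt\<^esub> \<longleftrightarrow> x \<in> nb"
  unfolding Rt qt Quot_zero by (rule nb.rcos_eq_self_iff)

lemma qt_qb_zero_iff:
  assumes "r \<in> carrier R"
  shows "qt (qb r) = \<zero>\<^bsub>Rt\<^esub> \<longleftrightarrow> (\<forall>\<pp>\<in>min_primes_over R \<aa>. r \<in> \<pp>)"
  using qt_zero_iff[of "qb r"] assms normal_localization_min.qb_mem_iff[OF minI[OF fin]]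
  by (simp add: mem_nb_iff)

lemma qt_qb_hom: "ring_hom_ring R Rt (\<lambda>r. qt (qb r))" (is ?hom)
  and qt_qb_surj: "(\<lambda>r. qt (qb r)) ` carrier R = carrier Rt" (is ?surj)
proof -
  show ?hom
    using ring_hom_ring_comp[OF qb.ring_hom_ring_axioms qt.ring_hom_ring_axioms] by (simp add: comp_def)
  show ?surj using qb_surj qt_surj by (metis image_image)
qed

lemma one_neq_zero_Rt: "\<one>\<^bsub>Rt\<^esub> \<noteq> \<zero>\<^bsub>Rt\<^esub>"
proof -
  obtain \<pp> where "\<pp> \<in> min_primes_over R \<aa>" using min_primes_over_nonempty by blast
  moreover from this have "\<one>\<^bsub>R\<^esub> \<notin> \<pp>"
    using R.prime_ideal_one_notin by (auto simp: min_primes_over_def Spec_def)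
  ultimately show ?thesis using qt_qb_zero_iff[OF R.one_closed] by auto
qed

text \<open>The quotient by the prime radical embeds in the product of the rings
  \<open>R/\<pp>\<close>, so cancellation may be checked modulo each \<open>\<pp>\<close>
  separately.\<close>

lemma qt_qb_regular:
  assumes s: "s \<in> S'" shows "regular_elem Rt (qt (qb s))"
proof -
  interpret h: ring_hom_ring R Rt "\<lambda>r. qt (qb r)" by (rule qt_qb_hom)
  note sc = R.S_carrier[OF s]
  have cancel: "s \<otimes>\<^bsub>R\<^esub> r \<in> \<pp> \<longleftrightarrow> r \<in> \<pp>" "r \<otimes>\<^bsub>R\<^esub> s \<in> \<pp> \<longleftrightarrow> r \<in> \<pp>"
    if "\<pp> \<in> min_primes_over R \<aa>" "r \<in> carrier R" for \<pp> r
  proof -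
    interpret normal_localization_min R \<aa> S' S Rb qb Sb nb Rt qt St pb pt Rp \<pi> Sp \<pi>t hb \<pp>
      by (rule minI[OF fin that(1)])
    note reg = regular_elemD(2,3)[OF \<pi>_regular[OF s] \<pi>.image_closed[OF that(2)]]
    show "s \<otimes>\<^bsub>R\<^esub> r \<in> \<pp> \<longleftrightarrow> r \<in> \<pp>"
      using reg(1) that(2) sc \<pi>_zero_iff[of "s \<otimes>\<^bsub>R\<^esub> r"] \<pi>_zero_iff[of r] by auto
    show "r \<otimes>\<^bsub>R\<^esub> s \<in> \<pp> \<longleftrightarrow> r \<in> \<pp>"
      using reg(2) that(2) sc \<pi>_zero_iff[of "r \<otimes>\<^bsub>R\<^esub> s"] \<pi>_zero_iff[of r] by auto
  qed
  show ?thesis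
    unfolding regular_elem_def
  proof (intro conjI ballI impI)
    show "qt (qb s) \<in> carrier Rt" using sc by simp
    fix y assume "y \<in> carrier Rt"
    then obtain r where r: "r \<in> carrier R" "y = qt (qb r)" unfolding qt_qb_surj[symmetric] by blast
    show "y = \<zero>\<^bsub>Rt\<^esub>" if "qt (qb s) \<otimes>\<^bsub>Rt\<^esub> y = \<zero>\<^bsub>Rt\<^esub>"
    proof -
      have "qt (qb (s \<otimes>\<^bsub>R\<^esub> r)) = \<zero>\<^bsub>Rt\<^esub>" using that r sc by simp
      then show ?thesis using qt_qb_zero_iff[of r] qt_qb_zero_iff[of "s \<otimes>\<^bsub>R\<^esub> r"] cancel r sc by simp
    qed
    show "y = \<zero>\<^bsub>Rt\<^esub>" if "y \<otimes>\<^bsub>Rt\<^esub> qt (qb s) = \<zero>\<^bsub>Rt\<^esub>"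
    proof -
      have "qt (qb (r \<otimes>\<^bsub>R\<^esub> s)) = \<zero>\<^bsub>Rt\<^esub>" using that r sc by simp
      then show ?thesis using qt_qb_zero_iff[of r] qt_qb_zero_iff[of "r \<otimes>\<^bsub>R\<^esub> s"] cancel r sc by simp
    qed
  qed
qed

sublocale Lt: loc_quotient Rb "qb ` S'" Rt qt
proof (intro loc_quotient.intro loc_quotient_axioms.intro Lb.Q'.left_denominator_ring_axioms
    qt.ring_hom_ring_axioms qt_surj one_neq_zero_Rt)
qed (use qt_qb_regular in auto)

lemma St_eq: "St = qt ` qb ` S'"
  by (simp add: St Sb)

theorem St_Den: "St \<in> Den Rt {\<zero>\<^bsub>Rt\<^esub>}"
proof (rule qt.S.normal_regular_Den(2)[OF _ one_neq_zero_Rt])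
  show "submonoid St Rt"
    using Lt.image_left_den_set by (simp add: St_eq left_den_set_def left_Ore_set_def mult_subset_def)
  fix s assume "s \<in> St"
  then obtain s' where s': "s' \<in> S'" "s = qt (qb s')" by (auto simp: St_eq)
  obtain t where t: "t \<in> S'" "t \<otimes>\<^bsub>R\<^esub> s' \<in> S" using S_ore[OF s'(1)] .
  note k = R.S_carrier[OF s'(1)] R.S_carrier[OF t(1)]
  have "normal_elem Rt (qt (qb (t \<otimes>\<^bsub>R\<^esub> s')))"
    using ring_hom_ring.normal_elem_image[OF qt_qb_hom qt_qb_surj] t(2) by (simp add: S)
  moreover have "regular_elem Rt (qt (qb (t \<otimes>\<^bsub>R\<^esub> s')))"
    using qt_qb_regular t(2) S_subset by blast
  ultimately show "\<exists>t\<in>St. normal_elem Rt (t \<otimes>\<^bsub>Rt\<^esub> s) \<and> regular_elem Rt (t \<otimes>\<^bsub>Rt\<^esub> s)"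
    using t(1) s' k by (intro bexI[of _ "qt (qb t)"]) (auto simp: St_eq)
qed

lemma nb_eq: "{x \<in> carrier Rb. qt x = \<zero>\<^bsub>Rt\<^esub>} = nb"
  using qt_zero_iff nb.Icarr by blast

end

text \<open>Combining the two settings supplies the inclusion of the radical in
  \<open>pb \<pp>\<close>, by which \<open>hb \<pp>\<close> is constant on its cosets and
  \<open>\<pi>t \<pp>\<close> is well defined.\<close>

locale normal_localization_fin_min = normal_localization_fin + normal_localization_min
begin

lemma hb_nb: "x \<in> nb \<Longrightarrow> hb \<pp> x = \<zero>\<^bsub>Rp \<pp>\<^esub>"
  using \<pp> by (auto simp: mem_nb_iff simp flip: pb_eq)

lemma \<pi>t_qt: "x \<in> carrier Rb \<Longrightarrow> \<pi>t \<pp> (qt x) = hb \<pp> x"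
  unfolding \<pi>t qt by (rule pb.h.quot_lift_rcos[OF nb.is_ideal hb_nb])

lemma \<pi>t_hom: "ring_hom_ring Rt (Rp \<pp>) (\<pi>t \<pp>)"
  unfolding Rt \<pi>t by (rule pb.h.quot_lift_hom[OF nb.is_ideal hb_nb])

lemma \<pi>t_qt_qb: "r \<in> carrier R \<Longrightarrow> \<pi>t \<pp> (qt (qb r)) = \<pi> \<pp> r"
  by (simp add: \<pi>t_qt hb_qb)

lemma pt_eq: "{x \<in> carrier Rt. \<pi>t \<pp> x = \<zero>\<^bsub>Rp \<pp>\<^esub>} = pt \<pp>"
proof -
  have "\<pi>t \<pp> (qt x) = \<zero>\<^bsub>Rp \<pp>\<^esub> \<longleftrightarrow> x \<in> pb \<pp>" if "x \<in> carrier Rb" for x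
    using that by (simp add: \<pi>t_qt flip: pb_eq)
  moreover have "pb \<pp> \<subseteq> carrier Rb" by (auto simp flip: pb_eq)
  ultimately show ?thesis unfolding qt_surj[symmetric] pt by blast
qed

sublocale pt: loc_quotient Rt "qt ` qb ` S'" "Rp \<pp>" "\<pi>t \<pp>"
proof (intro loc_quotient.intro loc_quotient_axioms.intro Lt.Q'.left_denominator_ring_axioms \<pi>t_hom)
  show "\<pi>t \<pp> ` carrier Rt = carrier (Rp \<pp>)"
    unfolding qt_qb_surj[symmetric] \<pi>_surj[symmetric] image_image by (intro image_cong refl \<pi>t_qt_qb)
  show "regular_elem (Rp \<pp>) (\<pi>t \<pp> s)" if "s \<in> qt ` qb ` S'" for s
    using that \<pi>_regular \<pi>t_qt_qb R.S_carrier by auto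
qed (rule one_neq_zero_Rp)

lemma Sp_eq: "\<pi>t \<pp> ` qt ` qb ` S' = Sp \<pp>"
  unfolding Sp image_image using \<pi>t_qt_qb R.S_carrier by (intro image_cong) auto

lemma qt_mem_pt_iff: "x \<in> carrier Rb \<Longrightarrow> qt x \<in> pt \<pp> \<longleftrightarrow> x \<in> pb \<pp>"
  using \<pi>t_qt by (simp flip: pb_eq pt_eq)

end

section \<open>The prime ideals of the localizations\<close>

context normal_localization_fin_min
begin

lemma in_Sb_p_iff:
  "\<lbrakk>s \<in> Sb; x \<in> carrier Rb\<rbrakk> \<Longrightarrow> frac Sb Rb s x \<in> Loc_ideal Sb Rb (pb \<pp>) \<longleftrightarrow> x \<in> pb \<pp>"
  using pb.fr_in_Loc_ideal_iff[unfolded pb_eq, folded Sb] .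

lemma in_St_p_iff:
  "\<lbrakk>s \<in> St; x \<in> carrier Rt\<rbrakk> \<Longrightarrow> frac St Rt s x \<in> Loc_ideal St Rt (pt \<pp>) \<longleftrightarrow> x \<in> pt \<pp>"
  using pt.fr_in_Loc_ideal_iff[unfolded pt_eq, folded St_eq] .

text \<open>The general facts speak of kernels of projections and of iterated images of
  \<open>S'\<close>; rewriting replaces these by \<open>pb \<pp>\<close>, \<open>pt \<pp>\<close>
  and the named sets of denominators.\<close>

lemmas prime_Sb_p = pb.prime_Loc_ideal[OF prime_Rp, unfolded pb_eq, folded Sb]
  and prime_St_p = pt.prime_Loc_ideal[OF prime_Rp, unfolded pt_eq, folded St_eq]
  and ideal_St_p = pt.ideal_Loc_ideal[unfolded Sp_eq pt_eq, folded St_eq]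
  and \<psi>_hom = pt.loc.F_hom[unfolded Sp_eq, folded St_eq]
  and \<psi>_loc_map = pt.loc.F_loc_map[unfolded Sp_eq, folded St_eq]
  and \<psi>_iso = pt.Loc_quot_iso[unfolded Sp_eq pt_eq, folded St_eq]
  and kernel_\<psi> = pt.kernel_loc[unfolded Sp_eq pt_eq, folded St_eq]
  and \<pi>_hom = \<pi>.ring_hom_ring_axioms
  and loc_map_Rp_hom = pt.Q'.loc_map_hom[unfolded Sp_eq]

end

context normal_localization_fin
begin

lemmas \<phi>_hom = Lt.loc.F_hom[folded St_eq, folded Sb]
  and \<phi>_surj = Lt.loc_surj[folded St_eq, folded Sb]
  and \<phi>_fr = Lt.loc.F_fr[folded St_eq, folded Sb]
  and \<phi>_loc_map = Lt.loc.F_loc_map[folded St_eq, folded Sb]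
  and \<phi>_iso = Lt.Loc_quot_iso[unfolded nb_eq, folded St_eq, folded Sb]
  and kernel_\<phi> = Lt.kernel_loc[unfolded nb_eq, folded St_eq, folded Sb]
  and ideal_Sb_nb = Lt.ideal_Loc_ideal[unfolded nb_eq, folded St_eq, folded Sb]
  and in_Sb_nb_iff = Lt.fr_in_Loc_ideal_iff[unfolded nb_eq, folded Sb]
  and Sb_nb_nilpotent = Lt.Loc_ideal_nilpotent[unfolded nb_eq, folded Sb]
  and Lb_cases = Lb.Q'.L_cases[folded Sb]
  and Lt_cases = Lt.Q'.L_cases[folded St_eq]
  and one_in_Sb = Lb.Q'.one_in_S[folded Sb]
  and one_in_St = Lt.Q'.one_in_S[folded St_eq]
  and ring_Lt = Lt.Q'.ring_L[folded St_eq]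
  and loc_map_Rb_hom = Lb.Q'.loc_map_hom[folded Sb]
  and loc_map_Rt_hom = Lt.Q'.loc_map_hom[folded St_eq]
  and fr_zero_Lt = Lt.Q'.fr_zero[folded St_eq]

lemma fin_minI:
  "\<pp> \<in> min_primes_over R \<aa> \<Longrightarrow>
    normal_localization_fin_min R \<aa> S' S Rb qb Sb nb Rt qt St pb pt Rp \<pi> Sp \<pi>t hb \<pp>"
  by (rule normal_localization_fin_min.intro[OF normal_localization_fin_axioms minI[OF fin]])

lemma min_primes_over_eqI:
  assumes "\<pp> \<in> min_primes_over R \<aa>" "\<qq> \<in> min_primes_over R \<aa>"
    and "\<And>r. \<lbrakk>r \<in> carrier R; r \<in> \<pp>\<rbrakk> \<Longrightarrow> r \<in> \<qq>"
  shows "\<pp> = \<qq>"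
proof -
  have "prime_ideal R \<pp>" using assms(1) by (simp add: min_primes_over_def Spec_def)
  then have "\<pp> \<subseteq> \<qq>" using assms(3) prime_ideal_subset by blast
  then show ?thesis using assms(1,2) by (simp add: min_primes_over_def)
qed

text \<open>Fractions with denominator one recover \<open>\<pp>\<close> from its localization, so an
  inclusion descends to \<open>\<pp> \<subseteq> \<qq>\<close>, and \<open>\<qq>\<close> is minimal.
  Beyond injectivity, this incomparability is what \<open>min_primes_eqI\<close> asks for.\<close>

lemma Sb_p_incomparable:
  assumes "\<pp> \<in> min_primes_over R \<aa>" "\<qq> \<in> min_primes_over R \<aa>"
    and "Loc_ideal Sb Rb (pb \<pp>) \<subseteq> Loc_ideal Sb Rb (pb \<qq>)"
  shows "\<pp> = \<qq>"
proof (rule min_primes_over_eqI[OF assms(1,2)])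
  interpret p: normal_localization_fin_min R \<aa> S' S Rb qb Sb nb Rt qt St pb pt Rp \<pi> Sp \<pi>t hb \<pp>
    by (rule fin_minI[OF assms(1)])
  interpret q: normal_localization_fin_min R \<aa> S' S Rb qb Sb nb Rt qt St pb pt Rp \<pi> Sp \<pi>t hb \<qq>
    by (rule fin_minI[OF assms(2)])
  fix r assume r: "r \<in> carrier R" "r \<in> \<pp>"
  have c: "qb r \<in> carrier Rb" using r(1) by (rule qb.image_closed)
  have "qb r \<in> pb \<pp>" using p.qb_mem_iff r by blast
  then have "frac Sb Rb \<one>\<^bsub>Rb\<^esub> (qb r) \<in> Loc_ideal Sb Rb (pb \<qq>)"
    using p.in_Sb_p_iff[OF one_in_Sb c] assms(3) by blast
  then show "r \<in> \<qq>" using q.in_Sb_p_iff[OF one_in_Sb c] q.qb_mem_iff[OF r(1)] by blast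
qed

lemma St_p_incomparable:
  assumes "\<pp> \<in> min_primes_over R \<aa>" "\<qq> \<in> min_primes_over R \<aa>"
    and "Loc_ideal St Rt (pt \<pp>) \<subseteq> Loc_ideal St Rt (pt \<qq>)"
  shows "\<pp> = \<qq>"
proof (rule min_primes_over_eqI[OF assms(1,2)])
  interpret p: normal_localization_fin_min R \<aa> S' S Rb qb Sb nb Rt qt St pb pt Rp \<pi> Sp \<pi>t hb \<pp>
    by (rule fin_minI[OF assms(1)])
  interpret q: normal_localization_fin_min R \<aa> S' S Rb qb Sb nb Rt qt St pb pt Rp \<pi> Sp \<pi>t hb \<qq>
    by (rule fin_minI[OF assms(2)])
  fix r assume r: "r \<in> carrier R" "r \<in> \<pp>"
  have c: "qb r \<in> carrier Rb" using r(1) by (rule qb.image_closed)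
  have c': "qt (qb r) \<in> carrier Rt" using c by (rule qt.image_closed)
  have "qt (qb r) \<in> pt \<pp>" using p.qt_mem_pt_iff[OF c] p.qb_mem_iff r by blast
  then have "frac St Rt \<one>\<^bsub>Rt\<^esub> (qt (qb r)) \<in> Loc_ideal St Rt (pt \<qq>)"
    using p.in_St_p_iff[OF one_in_St c'] assms(3) by blast
  then show "r \<in> \<qq>"
    using q.in_St_p_iff[OF one_in_St c'] q.qt_mem_pt_iff[OF c] q.qb_mem_iff[OF r(1)] by blast
qed

abbreviation Sb_p where "Sb_p \<equiv> (\<lambda>\<pp>. Loc_ideal Sb Rb (pb \<pp>))"
abbreviation St_p where "St_p \<equiv> (\<lambda>\<pp>. Loc_ideal St Rt (pt \<pp>))"
abbreviation Sb_nb where "Sb_nb \<equiv> Loc_ideal Sb Rb nb"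

lemma inj_Sb_p: "inj_on Sb_p (min_primes_over R \<aa>)"
  and inj_St_p: "inj_on St_p (min_primes_over R \<aa>)"
  using Sb_p_incomparable St_p_incomparable unfolding inj_on_def by (metis subset_refl)+

lemma Sb_p_Spec: "Sb_p ` min_primes_over R \<aa> \<subseteq> Spec (Loc Sb Rb)"
  and St_p_Spec: "St_p ` min_primes_over R \<aa> \<subseteq> Spec (Loc St Rt)"
  using normal_localization_fin_min.prime_Sb_p[OF fin_minI]
    normal_localization_fin_min.prime_St_p[OF fin_minI] by (auto simp: Spec_def)

text \<open>A single representation \<open>s^-1 x\<close> is tested against all \<open>\<pp>\<close>
  at once: any numerator decides membership, so \<open>x\<close> lies in every
  \<open>pb \<pp>\<close> and hence in \<open>nb\<close>.\<close>

lemma Inter_Sb_p: "carrier (Loc Sb Rb) \<inter> \<Inter>(Sb_p ` min_primes_over R \<aa>) \<subseteq> Sb_nb"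
proof
  fix X assume X: "X \<in> carrier (Loc Sb Rb) \<inter> \<Inter>(Sb_p ` min_primes_over R \<aa>)"
  then obtain s x where sx: "s \<in> Sb" "x \<in> carrier Rb" "X = frac Sb Rb s x" using Lb_cases by blast
  have "x \<in> pb \<pp>" if \<pp>: "\<pp> \<in> min_primes_over R \<aa>" for \<pp>
  proof -
    have "X \<in> Sb_p \<pp>" using X \<pp> by blast
    then show ?thesis
      using normal_localization_fin_min.in_Sb_p_iff[OF fin_minI[OF \<pp>] sx(1,2)] sx(3) by simp
  qed
  then have "x \<in> nb" using sx(2) by (simp add: mem_nb_iff)
  then show "X \<in> Sb_nb" using in_Sb_nb_iff sx by simp
qed

theorem prime_radical_Lb: "prime_radical (Loc Sb Rb) \<subseteq> Sb_nb"
  using Inter_Sb_p Sb_p_Spec unfolding prime_radical_def by blast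

lemma Inter_St_p: "carrier (Loc St Rt) \<inter> \<Inter>(St_p ` min_primes_over R \<aa>) \<subseteq> {\<zero>\<^bsub>Loc St Rt\<^esub>}"
proof
  fix X assume X: "X \<in> carrier (Loc St Rt) \<inter> \<Inter>(St_p ` min_primes_over R \<aa>)"
  then obtain s y where sy: "s \<in> St" "y \<in> carrier Rt" "X = frac St Rt s y" using Lt_cases by blast
  obtain x where x: "x \<in> carrier Rb" "y = qt x" using sy(2) unfolding qt_surj[symmetric] by blast
  have "x \<in> pb \<pp>" if \<pp>: "\<pp> \<in> min_primes_over R \<aa>" for \<pp>
  proof -
    interpret normal_localization_fin_min R \<aa> S' S Rb qb Sb nb Rt qt St pb pt Rp \<pi> Sp \<pi>t hb \<pp>
      by (rule fin_minI[OF \<pp>])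
    have "X \<in> St_p \<pp>" using X \<pp> by blast
    then have "y \<in> pt \<pp>" using in_St_p_iff[OF sy(1,2)] sy(3) by simp
    then show ?thesis using qt_mem_pt_iff[OF x(1)] x(2) by simp
  qed
  then have "y = \<zero>\<^bsub>Rt\<^esub>" using qt_zero_iff[OF x(1)] x by (simp add: mem_nb_iff)
  then show "X \<in> {\<zero>\<^bsub>Loc St Rt\<^esub>}" using sy fr_zero_Lt by simp
qed

text \<open>After division by the prime radical the localized primes intersect in zero, and zero
  lies in the prime radical of any ring, so the finite family is the whole set of minimal
  primes.\<close>

theorem min_primes_Lt: "bij_betw St_p (min_primes_over R \<aa>) (min_primes (Loc St Rt))"
proof -
  interpret Lt: ring "Loc St Rt" by (rule ring_Lt)
  have "min_primes (Loc St Rt) = St_p ` min_primes_over R \<aa>"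
  proof (rule Lt.min_primes_eqI)
    have "\<zero>\<^bsub>Loc St Rt\<^esub> \<in> prime_radical (Loc St Rt)"
      using additive_subgroup.zero_closed[OF ideal.axioms(1)[OF Lt.ideal_prime_radical]] .
    then show "carrier (Loc St Rt) \<inter> \<Inter>(St_p ` min_primes_over R \<aa>) \<subseteq> prime_radical (Loc St Rt)"
      using Inter_St_p by blast
  qed (use fin St_p_Spec St_p_incomparable in auto)
  then show ?thesis using inj_St_p by (simp add: bij_betw_def)
qed

text \<open>Nilpotency puts the localized radical into every prime of the localization, including
  primes that are not known to come from a prime of \<open>R\<close>.\<close>

lemma nilpotent_Sb_nb:
  assumes "nilpotent_ideal Rb nb" shows "Sb_nb = prime_radical (Loc Sb Rb)"
proof (rule subset_antisym)
  show "Sb_nb \<subseteq> prime_radical (Loc Sb Rb)"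
    using Sb_nb_nilpotent[OF assms] ideal.Icarr[OF ideal_Sb_nb] by (auto simp: prime_radical_def Spec_def)
qed (rule prime_radical_Lb)

section \<open>Maps out of the localization of R/\<aa>\<close>

abbreviation \<phi> where "\<phi> \<equiv> loc_lift St Rt qt"
abbreviation \<kappa>0 where "\<kappa>0 \<equiv> (\<lambda>x. prime_radical (Loc Sb Rb) +>\<^bsub>Loc Sb Rb\<^esub> x)"
abbreviation \<kappa>n where "\<kappa>n \<equiv> (\<lambda>x. Sb_nb +>\<^bsub>Loc Sb Rb\<^esub> x)"

lemmas ideal_prime_radical_Lb = ring.ideal_prime_radical[OF ring_LSb]

lemmas \<kappa>0_hom = ideal.rcos_ring_hom_ring[OF ideal_prime_radical_Lb]
  and \<kappa>n_hom = ideal.rcos_ring_hom_ring[OF ideal_Sb_nb]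

lemma \<kappa>n_zero: "x \<in> Sb_nb \<Longrightarrow> \<kappa>n x = \<zero>\<^bsub>Loc Sb Rb Quot Sb_nb\<^esub>"
  unfolding Quot_zero using ideal.rcos_eq_self_iff[OF ideal_Sb_nb] ideal.Icarr[OF ideal_Sb_nb] by blast

lemma \<phi>_zero: "x \<in> Sb_nb \<Longrightarrow> \<phi> x = \<zero>\<^bsub>Loc St Rt\<^esub>"
  using kernel_\<phi> unfolding a_kernel_def' by blast

text \<open>The arrow between the two quotients of \<open>Loc Sb Rb\<close> exists because its prime
  radical lies in \<open>Sb_nb\<close>, so that \<open>\<kappa>n\<close> vanishes there.\<close>

lemmas quot_lift_\<phi>_\<kappa>n = ring_hom_ring.quot_lift_rcos[OF \<phi>_hom ideal_Sb_nb \<phi>_zero]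
  and quot_lift_\<kappa>n_hom = ring_hom_ring.quot_lift_hom
    [OF \<kappa>n_hom ideal_prime_radical_Lb \<kappa>n_zero[OF subsetD[OF prime_radical_Lb]]]
  and quot_lift_\<kappa>n_\<kappa>0 = ring_hom_ring.quot_lift_rcos
    [OF \<kappa>n_hom ideal_prime_radical_Lb \<kappa>n_zero[OF subsetD[OF prime_radical_Lb]]]

lemma quot_lift_\<kappa>n_iso:
  assumes "nilpotent_ideal Rb nb"
  shows "quot_lift \<kappa>n \<in> ring_iso (Loc Sb Rb Quot prime_radical (Loc Sb Rb)) (Loc Sb Rb Quot Sb_nb)"
proof (rule ring_hom_ring.quot_lift_iso(2)[OF \<kappa>n_hom])
  have "a_kernel (Loc Sb Rb) (Loc Sb Rb Quot Sb_nb) \<kappa>n = Sb_nb"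
    unfolding a_kernel_def' Quot_zero
    using ideal.rcos_eq_self_iff[OF ideal_Sb_nb] ideal.Icarr[OF ideal_Sb_nb] by blast
  then show "a_kernel (Loc Sb Rb) (Loc Sb Rb Quot Sb_nb) \<kappa>n = prime_radical (Loc Sb Rb)"
    using nilpotent_Sb_nb[OF assms] by simp
qed (simp add: Quot_carrier)

lemma quot_lift_\<phi>_iso:
  assumes "nilpotent_ideal Rb nb"
  shows "quot_lift \<phi> \<in> ring_iso (Loc Sb Rb Quot prime_radical (Loc Sb Rb)) (Loc St Rt)"
  using \<phi>_iso nilpotent_Sb_nb[OF assms] by simp

text \<open>The intersection of the localized primes is bounded by \<open>Sb_nb\<close>, and
  nilpotency identifies this bound with the prime radical, as the criterion for minimal primes
  demands.\<close>

theorem min_primes_Lb: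
  assumes "nilpotent_ideal Rb nb"
  shows "bij_betw Sb_p (min_primes_over R \<aa>) (min_primes (Loc Sb Rb))"
proof -
  interpret Lb: ring "Loc Sb Rb" by (rule ring_LSb)
  have "min_primes (Loc Sb Rb) = Sb_p ` min_primes_over R \<aa>"
    by (rule Lb.min_primes_eqI)
      (use fin Sb_p_Spec Sb_p_incomparable Inter_Sb_p nilpotent_Sb_nb[OF assms] in auto)
  then show ?thesis using inj_Sb_p by (simp add: bij_betw_def)
qed

end

section \<open>The diagram at one prime\<close>

context normal_localization_fin_min
begin

abbreviation \<psi> where "\<psi> \<equiv> loc_lift (Sp \<pp>) (Rp \<pp>) (\<pi>t \<pp>)"
abbreviation \<kappa>t where "\<kappa>t \<equiv> (\<lambda>x. St_p \<pp> +>\<^bsub>Loc St Rt\<^esub> x)"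

lemmas \<kappa>t_hom = ideal.rcos_ring_hom_ring[OF ideal_St_p]

lemmas \<kappa>t_\<phi>_hom = ring_hom_ring_comp[OF \<phi>_hom \<kappa>t_hom]

lemma \<kappa>t_\<phi>_surj: "(\<kappa>t \<circ> \<phi>) ` carrier (Loc Sb Rb) = carrier (Loc St Rt Quot St_p \<pp>)"
  unfolding image_comp[symmetric] \<phi>_surj Quot_carrier ..

text \<open>Numerators decide membership in both localizations, and \<open>qt x\<close> lies in
  \<open>pt \<pp>\<close> exactly when \<open>x\<close> lies in \<open>pb \<pp>\<close>. The one
  composite thus induces the isomorphism on the quotient by \<open>Sb_p \<pp>\<close> and, as
  \<open>Sb_nb\<close> is contained in the kernel, also the arrow on the quotient by
  \<open>Sb_nb\<close>.\<close>

lemma kernel_\<kappa>t_\<phi>: "a_kernel (Loc Sb Rb) (Loc St Rt Quot St_p \<pp>) (\<kappa>t \<circ> \<phi>) = Sb_p \<pp>"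
proof -
  have "(\<kappa>t \<circ> \<phi>) X = \<zero>\<^bsub>Loc St Rt Quot St_p \<pp>\<^esub> \<longleftrightarrow> X \<in> Sb_p \<pp>" if X: "X \<in> carrier (Loc Sb Rb)" for X
  proof -
    obtain s x where sx: "s \<in> Sb" "x \<in> carrier Rb" "X = frac Sb Rb s x" using Lb_cases[OF X] .
    have qs: "qt s \<in> St" using sx(1) by (simp add: St)
    have "(\<kappa>t \<circ> \<phi>) X = \<zero>\<^bsub>Loc St Rt Quot St_p \<pp>\<^esub> \<longleftrightarrow> \<phi> X \<in> St_p \<pp>"
      unfolding Quot_zero comp_apply
      by (rule ideal.rcos_eq_self_iff[OF ideal_St_p ring_hom_ring.image_closed[OF \<phi>_hom X]])
    also have "\<dots> \<longleftrightarrow> qt x \<in> pt \<pp>"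
      unfolding sx(3) \<phi>_fr[OF sx(1,2)] by (rule in_St_p_iff[OF qs qt.image_closed[OF sx(2)]])
    also have "\<dots> \<longleftrightarrow> X \<in> Sb_p \<pp>"
      unfolding sx(3) qt_mem_pt_iff[OF sx(2)] in_Sb_p_iff[OF sx(1,2)] ..
    finally show ?thesis .
  qed
  moreover have "Sb_p \<pp> \<subseteq> carrier (Loc Sb Rb)" using prime_ideal_subset[OF prime_Sb_p] .
  ultimately show ?thesis unfolding a_kernel_def' by blast
qed

lemmas ideal_Sb_p = prime_ideal_ideal[OF prime_Sb_p]

lemma \<kappa>t_\<phi>_zero: "X \<in> Sb_p \<pp> \<Longrightarrow> (\<kappa>t \<circ> \<phi>) X = \<zero>\<^bsub>Loc St Rt Quot St_p \<pp>\<^esub>"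
  using kernel_\<kappa>t_\<phi> unfolding a_kernel_def' by blast

lemma Sb_nb_subset: "Sb_nb \<subseteq> Sb_p \<pp>"
  using \<pp> unfolding Loc_ideal_def by (auto simp: mem_nb_iff)

lemmas \<kappa>t_\<phi>_iso = ring_hom_ring.quot_lift_iso(2)[OF \<kappa>t_\<phi>_hom \<kappa>t_\<phi>_surj kernel_\<kappa>t_\<phi>]
  and quot_lift_\<kappa>t_\<phi>_hom = ring_hom_ring.quot_lift_hom
    [OF \<kappa>t_\<phi>_hom ideal_Sb_nb \<kappa>t_\<phi>_zero[OF subsetD[OF Sb_nb_subset]]]
  and quot_lift_\<kappa>t_\<phi>_\<kappa>n = ring_hom_ring.quot_lift_rcos
    [OF \<kappa>t_\<phi>_hom ideal_Sb_nb \<kappa>t_\<phi>_zero[OF subsetD[OF Sb_nb_subset]]]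
  and quot_lift_\<kappa>t_\<phi>_\<kappa>p = ring_hom_ring.quot_lift_rcos[OF \<kappa>t_\<phi>_hom ideal_Sb_p \<kappa>t_\<phi>_zero]

abbreviation \<kappa>p where "\<kappa>p \<equiv> (\<lambda>x. Sb_p \<pp> +>\<^bsub>Loc Sb Rb\<^esub> x)"

lemmas \<kappa>p_hom = ideal.rcos_ring_hom_ring[OF ideal_Sb_p]

lemma \<kappa>p_zero: "x \<in> Sb_nb \<Longrightarrow> \<kappa>p x = \<zero>\<^bsub>Loc Sb Rb Quot Sb_p \<pp>\<^esub>"
  unfolding Quot_zero
  using ideal.rcos_eq_self_iff[OF ideal_Sb_p] ideal.Icarr[OF ideal_Sb_p] Sb_nb_subset by blast

lemmas quot_lift_\<kappa>p_hom = ring_hom_ring.quot_lift_hom[OF \<kappa>p_hom ideal_Sb_nb \<kappa>p_zero]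
  and quot_lift_\<kappa>p_\<kappa>n = ring_hom_ring.quot_lift_rcos[OF \<kappa>p_hom ideal_Sb_nb \<kappa>p_zero]

lemma \<psi>_zero: "x \<in> St_p \<pp> \<Longrightarrow> \<psi> x = \<zero>\<^bsub>Loc (Sp \<pp>) (Rp \<pp>)\<^esub>"
  using kernel_\<psi> unfolding a_kernel_def' by blast

lemmas quot_lift_\<psi>_\<kappa>t = ring_hom_ring.quot_lift_rcos[OF \<psi>_hom ideal_St_p \<psi>_zero]

lemma Lb_Sb_nb_cases:
  assumes "X \<in> carrier (Loc Sb Rb Quot Sb_nb)"
  obtains x where "x \<in> carrier (Loc Sb Rb)" "X = \<kappa>n x"
  using assms by (auto simp: Quot_carrier)

lemma quot_lift_\<kappa>t_\<phi>_eq: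
  assumes "X \<in> carrier (Loc Sb Rb Quot Sb_nb)"
  shows "quot_lift (\<kappa>t \<circ> \<phi>) X = \<kappa>t (quot_lift \<phi> X)"
  using assms by (rule Lb_Sb_nb_cases) (simp only: quot_lift_\<kappa>t_\<phi>_\<kappa>n quot_lift_\<phi>_\<kappa>n comp_apply)

text \<open>The same expression \<open>quot_lift (\<kappa>t \<circ> \<phi>)\<close> acts here on
  cosets of two different ideals; both sides are evaluated at a representative.\<close>

lemma quot_lift_\<kappa>t_\<phi>_\<kappa>p_eq:
  assumes "X \<in> carrier (Loc Sb Rb Quot Sb_nb)"
  shows "quot_lift (\<kappa>t \<circ> \<phi>) (quot_lift \<kappa>p X) = quot_lift (\<kappa>t \<circ> \<phi>) X"
  using assms
  by (rule Lb_Sb_nb_cases) (simp only: quot_lift_\<kappa>t_\<phi>_\<kappa>n quot_lift_\<kappa>p_\<kappa>n quot_lift_\<kappa>t_\<phi>_\<kappa>p)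

end

section \<open>The localizations, their minimal primes and the commutative diagram\<close>

theorem lemma4p2:
  fixes R :: "('a, 'b) ring_scheme" and \<aa> S' :: "'a set"
  assumes "ring R" and "ideal \<aa> R" and "S' \<in> Den_l R \<aa>"
    and "\<And>s. s \<in> S' \<Longrightarrow> \<exists>t \<in> S'. normal_elem R (t \<otimes>\<^bsub>R\<^esub> s)"
    and "S = {s \<in> S'. normal_elem R s}"
    and "Rb = R Quot \<aa>"
    and "qb = (\<lambda>r. \<aa> +>\<^bsub>R\<^esub> r)"
    and "Sb = qb ` S'"
    and "nb = prime_radical Rb"
    and "Rt = Rb Quot nb"
    and "qt = (\<lambda>x. nb +>\<^bsub>Rb\<^esub> x)"
    and "St = qt ` Sb"
    and "pb = (\<lambda>\<pp>. qb ` \<pp>)"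
    and "pt = (\<lambda>\<pp>. qt ` pb \<pp>)"
    and "Rp = (\<lambda>\<pp>. R Quot \<pp>)"
    and "\<pi> = (\<lambda>\<pp> r. \<pp> +>\<^bsub>R\<^esub> r)"
    and "Sp = (\<lambda>\<pp>. \<pi> \<pp> ` S')"
    and "\<pi>t = (\<lambda>\<pp>. quot_lift (quot_lift (\<pi> \<pp>)))"
    and "Lb = Loc Sb Rb"
    and "Lt = Loc St Rt"
    and "Lp = (\<lambda>\<pp>. Loc (Sp \<pp>) (Rp \<pp>))"
    and "Sb_nb = Loc_ideal Sb Rb nb"
    and "Sb_p = (\<lambda>\<pp>. Loc_ideal Sb Rb (pb \<pp>))"
    and "St_p = (\<lambda>\<pp>. Loc_ideal St Rt (pt \<pp>))"
    and "\<iota> = loc_lift Sb Rb qb"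
    and "\<phi> = loc_lift St Rt qt"
    and "\<psi> = (\<lambda>\<pp>. loc_lift (Sp \<pp>) (Rp \<pp>) (\<pi>t \<pp>))"
    and "\<kappa>0 = (\<lambda>x. prime_radical Lb +>\<^bsub>Lb\<^esub> x)"
    and "\<kappa>n = (\<lambda>x. Sb_nb +>\<^bsub>Lb\<^esub> x)"
    and "\<kappa>p = (\<lambda>\<pp> x. Sb_p \<pp> +>\<^bsub>Lb\<^esub> x)"
    and "\<kappa>t = (\<lambda>\<pp> x. St_p \<pp> +>\<^bsub>Lt\<^esub> x)"
  shows
    "\<comment> \<open>part 1\<close>
     (S \<in> Den_l R \<aa> \<and> loc_lift S' R (\<lambda>r. r) \<in> ring_iso (Loc S R) (Loc S' R)) \<and>

     \<comment> \<open>identification of \<open>S'\<^sup>-\<^sup>1R\<close> with the localization of \<open>R/\<aa>\<close>\<close>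
     (\<iota> \<in> ring_iso (Loc S' R) Lb \<and> (`) \<iota> ` Spec (Loc S' R) = Spec Lb) \<and>

     \<comment> \<open>part 2\<close>
     (finite (min_primes_over R \<aa>) \<longrightarrow>
       \<comment> \<open>(i)\<close>
       (Sb_p ` min_primes_over R \<aa> \<subseteq> Spec Lb \<and> inj_on Sb_p (min_primes_over R \<aa>) \<and>
        prime_radical Lb \<subseteq> Sb_nb) \<and>

       \<comment> \<open>(ii)\<close>
       (St \<in> Den Rt {\<zero>\<^bsub>Rt\<^esub>} \<and>
        ideal Sb_nb Lb \<and> quot_lift \<phi> \<in> ring_iso (Lb Quot Sb_nb) Lt \<and>
        bij_betw St_p (min_primes_over R \<aa>) (min_primes Lt)) \<and>

       \<comment> \<open>(iii)\<close>
       (\<forall>\<pp> \<in> min_primes_over R \<aa>.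
          Sp \<pp> \<in> Den (Rp \<pp>) {\<zero>\<^bsub>Rp \<pp>\<^esub>} \<and>

          \<comment> \<open>the isomorphisms\<close>
          quot_lift (\<psi> \<pp>) \<in> ring_iso (Lt Quot St_p \<pp>) (Lp \<pp>) \<and>
          quot_lift (\<kappa>t \<pp> \<circ> \<phi>) \<in> ring_iso (Lb Quot Sb_p \<pp>) (Lt Quot St_p \<pp>) \<and>

          \<comment> \<open>the remaining arrows of the diagram\<close>
          ring_hom_ring R (Rp \<pp>) (\<pi> \<pp>) \<and>
          ring_hom_ring R Rb qb \<and>
          ring_hom_ring Rb Rt qt \<and>
          ring_hom_ring Rt (Rp \<pp>) (\<pi>t \<pp>) \<and>
          ring_hom_ring Rb Lb (loc_map Sb Rb) \<and>
          ring_hom_ring Rt Lt (loc_map St Rt) \<and>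
          ring_hom_ring (Rp \<pp>) (Lp \<pp>) (loc_map (Sp \<pp>) (Rp \<pp>)) \<and>
          ring_hom_ring Lb Lt \<phi> \<and>
          ring_hom_ring Lt (Lp \<pp>) (\<psi> \<pp>) \<and>
          ring_hom_ring Lb (Lb Quot prime_radical Lb) \<kappa>0 \<and>
          ring_hom_ring Lb (Lb Quot Sb_nb) \<kappa>n \<and>
          ring_hom_ring Lt (Lt Quot St_p \<pp>) (\<kappa>t \<pp>) \<and>
          ring_hom_ring (Lb Quot prime_radical Lb) (Lb Quot Sb_nb) (quot_lift \<kappa>n) \<and>
          ring_hom_ring (Lb Quot Sb_nb) (Lt Quot St_p \<pp>) (quot_lift (\<kappa>t \<pp> \<circ> \<phi>)) \<and>
          ring_hom_ring (Lb Quot Sb_nb) (Lb Quot Sb_p \<pp>) (quot_lift (\<kappa>p \<pp>)) \<and>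

          \<comment> \<open>commutativity of the cells of the diagram\<close>
          (\<forall>r \<in> carrier R. \<pi>t \<pp> (qt (qb r)) = \<pi> \<pp> r) \<and>
          (\<forall>x \<in> carrier Rb. \<phi> (loc_map Sb Rb x) = loc_map St Rt (qt x)) \<and>
          (\<forall>x \<in> carrier Rt. \<psi> \<pp> (loc_map St Rt x) = loc_map (Sp \<pp>) (Rp \<pp>) (\<pi>t \<pp> x)) \<and>
          (\<forall>x \<in> carrier Lb. quot_lift \<phi> (\<kappa>n x) = \<phi> x) \<and>
          (\<forall>x \<in> carrier Lt. quot_lift (\<psi> \<pp>) (\<kappa>t \<pp> x) = \<psi> \<pp> x) \<and>
          (\<forall>x \<in> carrier Lb. quot_lift \<kappa>n (\<kappa>0 x) = \<kappa>n x) \<and>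
          (\<forall>x \<in> carrier (Lb Quot Sb_nb).
             quot_lift (\<kappa>t \<pp> \<circ> \<phi>) x = \<kappa>t \<pp> (quot_lift \<phi> x)) \<and>
          (\<forall>x \<in> carrier (Lb Quot Sb_nb).
             quot_lift (\<kappa>t \<pp> \<circ> \<phi>) (quot_lift (\<kappa>p \<pp>) x) = quot_lift (\<kappa>t \<pp> \<circ> \<phi>) x)) \<and>

       \<comment> \<open>(iv)\<close>
       (nilpotent_ideal Rb nb \<longrightarrow>
          (`) \<iota> ` min_primes (Loc S' R) = min_primes Lb \<and>
          bij_betw Sb_p (min_primes_over R \<aa>) (min_primes Lb) \<and>
          St \<in> Den Rt {\<zero>\<^bsub>Rt\<^esub>} \<and>
          Sb_nb = prime_radical Lb \<and>
          quot_lift \<kappa>n \<in> ring_iso (Lb Quot prime_radical Lb) (Lb Quot Sb_nb) \<and>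
          quot_lift \<phi> \<in> ring_iso (Lb Quot prime_radical Lb) Lt))"
    (is "_ \<and> _ \<and> (_ \<longrightarrow> ?finite_part)")
proof -
  \<comment> \<open>The statement nests two lifts in \<open>\<pi>t\<close>; naming the inner one
    recovers the parameters of the locale.\<close>
  define hb where "hb = (\<lambda>\<pp>. quot_lift (\<pi> \<pp>))"
  interpret normal_localization R \<aa> S' S Rb qb Sb nb Rt qt St pb pt Rp \<pi> Sp \<pi>t hb
  proof (rule normal_localization.intro)
    show "\<pi>t = (\<lambda>\<pp>. quot_lift (hb \<pp>))" by (simp only: assms(18) hb_def)
  qed (fact assms hb_def)+
  note L = assms(19-31)
  have part1: "S \<in> Den_l R \<aa> \<and> loc_lift S' R (\<lambda>r. r) \<in> ring_iso (Loc S R) (Loc S' R)"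
    using S_Den S_iso by blast
  have ident: "\<iota> \<in> ring_iso (Loc S' R) Lb \<and> (`) \<iota> ` Spec (Loc S' R) = Spec Lb"
    unfolding L using \<iota>_iso \<iota>_Spec(1) by blast
  show ?thesis
  proof (intro conjI[OF part1] conjI[OF ident] impI)
    assume fin: "finite (min_primes_over R \<aa>)"
    interpret fin: normal_localization_fin R \<aa> S' S Rb qb Sb nb Rt qt St pb pt Rp \<pi> Sp \<pi>t hb
      by unfold_locales (fact fin)
    note p = fin.fin_minI
    note i = fin.Sb_p_Spec fin.inj_Sb_p fin.prime_radical_Lb
    note ii = fin.St_Den fin.ideal_Sb_nb fin.\<phi>_iso fin.min_primes_Lt
    note iii = normal_localization_min.Sp_Den[OF minI[OF fin]]
      normal_localization_fin_min.\<psi>_iso[OF p] normal_localization_fin_min.\<kappa>t_\<phi>_iso[OF p]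
      normal_localization_fin_min.\<pi>_hom[OF p] qb.ring_hom_ring_axioms fin.qt.ring_hom_ring_axioms
      normal_localization_fin_min.\<pi>t_hom[OF p] fin.loc_map_Rb_hom fin.loc_map_Rt_hom
      normal_localization_fin_min.loc_map_Rp_hom[OF p] fin.\<phi>_hom
      normal_localization_fin_min.\<psi>_hom[OF p] fin.\<kappa>0_hom fin.\<kappa>n_hom
      normal_localization_fin_min.\<kappa>t_hom[OF p] fin.quot_lift_\<kappa>n_hom
      normal_localization_fin_min.quot_lift_\<kappa>t_\<phi>_hom[OF p]
      normal_localization_fin_min.quot_lift_\<kappa>p_hom[OF p]
      normal_localization_fin_min.\<pi>t_qt_qb[OF p] fin.\<phi>_loc_map
      normal_localization_fin_min.\<psi>_loc_map[OF p] fin.quot_lift_\<phi>_\<kappa>n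
      normal_localization_fin_min.quot_lift_\<psi>_\<kappa>t[OF p] fin.quot_lift_\<kappa>n_\<kappa>0
      normal_localization_fin_min.quot_lift_\<kappa>t_\<phi>_eq[OF p]
      normal_localization_fin_min.quot_lift_\<kappa>t_\<phi>_\<kappa>p_eq[OF p]
    note iv = bij_betw_imp_surj_on[OF \<iota>_Spec(2)] fin.min_primes_Lb fin.nilpotent_Sb_nb
      fin.quot_lift_\<kappa>n_iso fin.quot_lift_\<phi>_iso
    \<comment> \<open>Only the names for the localizations, their ideals and the maps between them
      are unfolded, since the locale carries all other notation as parameters; each conjunct is then
      one collected fact.\<close>
    show ?finite_part
      unfolding L by (intro conjI ballI impI) (rule i ii iii iv; assumption?)+
  qed
qed

end
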